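(* Let $e(G/K) \in H^2(\mathrm{Diff}_+(S^1);\mathbb{R})$ be the Euler class of the flux extension $0 \to \mathbb{R} \to G/K \to \mathrm{Diff}_+(S^1) \to 1$, and let $e_{\mathbb{R}} \in H^2(\mathrm{Diff}_+(S^1);\mathbb{R})$ be the real Euler class of the universal covering extension of $\mathrm{Diff}_+(S^1)$. Then $$e(G/K) = \pi\, e_{\mathbb{R}}.$$
   Context: $D=\{(x,y)\in\mathbb{R}^2 \mid x^2+y^2\le 1\}$ is the closed unit disk with symplectic form $\omega = dx\wedge dy$, and $\eta=(x\,dy-y\,dx)/2$, so $d\eta=\omega$. For a form $\alpha$ and a diffeomorphism $g$, $\alpha^g=g^*\alpha$ is the pullback. $\mathrm{Diff}_+(S^1)$ is the group (under composition, regarded as a discrete group) of orientation-preserving smooth diffeomorphisms of $S^1=\partial D$. Let $G=\{g\in \mathrm{Diff}(D)\mid g^*\omega=\omega,\ g(0,0)=(0,0)\}$ and $G_{\mathrm{rel}}=\{g\in G\mid g|_{\partial D}=\mathrm{id}\}$. Restriction to the boundary gives an exact sequence $1\to G_{\mathrm{rel}}\to G\to \mathrm{Diff}_+(S^1)\to 1$. Let $\gamma:[0,1]\to D$, $\gamma(t)=(t,0)$. The flux homomorphism is $\mathrm{Flux}_{\mathbb{R}}:G_{\mathrm{rel}}\to\mathbb{R}$, $\mathrm{Flux}_{\mathbb{R}}(g)=\int_\gamma (g^*\eta-\eta)$; it is a surjective homomorphism whose kernel $K$ is normal in $G$. Identifying $G_{\mathrm{rel}}/K$ with $\mathbb{R}$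 via $\mathrm{Flux}_{\mathbb{R}}$, one obtains a central extension $0\to\mathbb{R}\to G/K\to \mathrm{Diff}_+(S^1)\to 1$, called the flux extension. Group cohomology and Euler class conventions: for a trivial $\Gamma$-module $A$, a $1$-cochain $\tau:\Gamma\to A$ has coboundary $\delta\tau(g,h)=\tau(h)-\tau(gh)+\tau(g)$. For a central extension $0\to A\to E\to\Gamma\to 1$, the Euler class $e(E)\in H^2(\Gamma;A)$ is the class corresponding to the extension: if $\tau:E\to A$ satisfies $\tau(ga)=\tau(g)+a$ for $g\in E$, $a\in A$ (a connection cochain), then $\delta\tau$ is the pullback of a unique $2$-cocycle $\sigma$ on $\Gamma$, and $e(E)=[-\sigma]$. The class $e_{\mathbb{R}}$ is the image in $H^2(\mathrm{Diff}_+(S^1);\mathbb{R})$ of the Euler class of $0\to\mathbb{Z}\to\widetilde{\mathrm{Diff}_+(S^1)}\to \mathrm{Diff}_+(S^1)\to 1$, where $\widetilde{\mathrm{Diff}_+(S^1)}$ is the group of orientation-preserving diffeomorphisms $\varphi$ of $\mathbb{R}$ with $\varphi(x+2\pi)=\varphi(x)+2\pi$, $S^1=\mathbb{R}/2\pi\mathbb{Z}$ via the angle coordinate, and $1 \in \mathbb{Z}$ acts as $x\mapsto x+2\pi$. It is represented by the cocycle $(\mu,\nu)\mapsto \frac{1}{2\pi}(\varphi\psi(0)-\varphi(0)-\psi(0))$, where $\varphi,\psi$ are any lifts of $\mu,\nu$. *)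

theory Defs
  imports "HOL-Analysis.Analysis" "HOL-Algebra.Bij" "HOL-Algebra.Coset"
begin

section \<open>Second group cohomology with trivial coefficients and Euler classes\<close>

text \<open>
  Cochains on \<open>\<Gamma>\<close> with values in the trivial module \<open>'a\<close> are functions on the whole type; only
  their values on \<^term>\<open>carrier \<Gamma>\<close> are ever constrained.
\<close>

definition coboundary1 :: "('g, 'm) monoid_scheme \<Rightarrow> ('g \<Rightarrow> 'a::ab_group_add) \<Rightarrow> 'g \<Rightarrow> 'g \<Rightarrow> 'a"
  where "coboundary1 \<Gamma> \<tau> g h = \<tau> h - \<tau> (g \<otimes>\<^bsub>\<Gamma>\<^esub> h) + \<tau> g"

definition cocycles2 :: "('g, 'm) monoid_scheme \<Rightarrow> ('g \<Rightarrow> 'g \<Rightarrow> 'a::ab_group_add) set"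
  where "cocycles2 \<Gamma> =
    {\<sigma>. \<forall>g\<in>carrier \<Gamma>. \<forall>h\<in>carrier \<Gamma>. \<forall>k\<in>carrier \<Gamma>.
          \<sigma> h k - \<sigma> (g \<otimes>\<^bsub>\<Gamma>\<^esub> h) k + \<sigma> g (h \<otimes>\<^bsub>\<Gamma>\<^esub> k) - \<sigma> g h = 0}"

definition cohomologous :: "('g, 'm) monoid_scheme \<Rightarrow> ('g \<Rightarrow> 'g \<Rightarrow> 'a::ab_group_add) rel"
  where "cohomologous \<Gamma> =
    {(\<sigma>, \<sigma>'). \<sigma> \<in> cocycles2 \<Gamma> \<and> \<sigma>' \<in> cocycles2 \<Gamma> \<and>
       (\<exists>\<tau>. \<forall>g\<in>carrier \<Gamma>. \<forall>h\<in>carrier \<Gamma>. \<sigma>' g h - \<sigma> g h = coboundary1 \<Gamma> \<tau> g h)}"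

definition H2 :: "('g, 'm) monoid_scheme \<Rightarrow> ('g \<Rightarrow> 'g \<Rightarrow> 'a::ab_group_add) set set"
  where "H2 \<Gamma> = cocycles2 \<Gamma> // cohomologous \<Gamma>"

definition cohomology_class ::
    "('g, 'm) monoid_scheme \<Rightarrow> ('g \<Rightarrow> 'g \<Rightarrow> 'a::ab_group_add) \<Rightarrow> ('g \<Rightarrow> 'g \<Rightarrow> 'a) set"
  where "cohomology_class \<Gamma> \<sigma> = cohomologous \<Gamma> `` {\<sigma>}"

text \<open>The map on classes induced by an additive map \<open>f\<close> of coefficients.\<close>

definition H2_map ::
    "('g, 'm) monoid_scheme \<Rightarrow> ('a \<Rightarrow> 'b) \<Rightarrow> ('g \<Rightarrow> 'g \<Rightarrow> 'a::ab_group_add) set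
      \<Rightarrow> ('g \<Rightarrow> 'g \<Rightarrow> 'b::ab_group_add) set"
  where "H2_map \<Gamma> f c = (\<Union>\<sigma>\<in>c. cohomology_class \<Gamma> (\<lambda>g h. f (\<sigma> g h)))"

text \<open>The scalar multiplication of the real vector space \<open>H\<^sup>2(\<Gamma>;\<real>)\<close>.\<close>

definition H2_scale ::
    "('g, 'm) monoid_scheme \<Rightarrow> real \<Rightarrow> ('g \<Rightarrow> 'g \<Rightarrow> real) set \<Rightarrow> ('g \<Rightarrow> 'g \<Rightarrow> real) set"
  where "H2_scale \<Gamma> r = H2_map \<Gamma> (\<lambda>x. r * x)"

text \<open>
  An extension of \<open>\<Gamma>\<close> by the additive group of the type \<open>'a\<close> is given by its total group \<open>E\<close>,
  the inclusion \<open>i\<close> and the projection \<open>p\<close>.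
\<close>

definition central_extension ::
    "('e, 'n) monoid_scheme \<Rightarrow> ('g, 'm) monoid_scheme \<Rightarrow> ('a::ab_group_add \<Rightarrow> 'e) \<Rightarrow> ('e \<Rightarrow> 'g) \<Rightarrow> bool"
  where "central_extension E \<Gamma> i p \<longleftrightarrow>
    group E \<and> group \<Gamma> \<and>
    inj i \<and> (\<forall>a. i a \<in> carrier E) \<and> (\<forall>a b. i (a + b) = i a \<otimes>\<^bsub>E\<^esub> i b) \<and>
    (\<forall>a. \<forall>g\<in>carrier E. g \<otimes>\<^bsub>E\<^esub> i a = i a \<otimes>\<^bsub>E\<^esub> g) \<and>
    p \<in> hom E \<Gamma> \<and> p ` carrier E = carrier \<Gamma> \<and>
    kernel E \<Gamma> p = range i"

definition connection_cochain ::
    "('e, 'n) monoid_scheme \<Rightarrow> ('a::ab_group_add \<Rightarrow> 'e) \<Rightarrow> ('e \<Rightarrow> 'a) \<Rightarrow> bool"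
  where "connection_cochain E i \<tau> \<longleftrightarrow> (\<forall>g\<in>carrier E. \<forall>a. \<tau> (g \<otimes>\<^bsub>E\<^esub> i a) = \<tau> g + a)"

definition euler_class ::
    "('e, 'n) monoid_scheme \<Rightarrow> ('g, 'm) monoid_scheme \<Rightarrow> ('a::ab_group_add \<Rightarrow> 'e) \<Rightarrow> ('e \<Rightarrow> 'g)
      \<Rightarrow> ('g \<Rightarrow> 'g \<Rightarrow> 'a) set"
  where "euler_class E \<Gamma> i p =
    (THE c. c \<in> H2 \<Gamma> \<and>
       (\<exists>\<tau> \<sigma>. connection_cochain E i \<tau> \<and> \<sigma> \<in> cocycles2 \<Gamma> \<and>
          (\<forall>g\<in>carrier E. \<forall>h\<in>carrier E. coboundary1 E \<tau> g h = \<sigma> (p g) (p h)) \<and>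
          c = cohomology_class \<Gamma> (\<lambda>g h. - \<sigma> g h)))"

text \<open>
  For a central extension a connection cochain exists, its coboundary descends to \<open>\<Gamma>\<close>, and the
  resulting class does not depend on the choice; so the description in \<^const>\<open>euler_class\<close>
  then denotes that class.
\<close>

lemma euler_class_eqI:
  fixes E :: "('e, 'n) monoid_scheme" and \<Gamma> :: "('g, 'm) monoid_scheme"
    and i :: "'a::ab_group_add \<Rightarrow> 'e"
  assumes ext: "central_extension E \<Gamma> i p"
    and conn: "connection_cochain E i \<tau>"
    and \<sigma>: "\<And>g h. g \<in> carrier E \<Longrightarrow> h \<in> carrier E \<Longrightarrow> coboundary1 E \<tau> g h = \<sigma> (p g) (p h)"
  shows "euler_class E \<Gamma> i p = cohomology_class \<Gamma> (\<lambda>g h. - \<sigma> g h)"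
proof -
  interpret E: group E using ext by (simp add: central_extension_def)
  interpret \<Gamma>: group \<Gamma> using ext by (simp add: central_extension_def)
  have p: "p \<in> hom E \<Gamma>" and surj: "p ` carrier E = carrier \<Gamma>" and ker: "kernel E \<Gamma> p = range i"
    and i: "\<And>a. i a \<in> carrier E"
    using ext by (auto simp: central_extension_def)
  interpret p: group_hom E \<Gamma> p by unfold_locales (rule p)
  have cocycle: "s \<in> cocycles2 \<Gamma>"
    if s: "\<And>g h. g \<in> carrier E \<Longrightarrow> h \<in> carrier E \<Longrightarrow> coboundary1 E t g h = s (p g) (p h)" for s :: "'g \<Rightarrow> 'g \<Rightarrow> 'a" and t
  proof -
    have "s (p g) (p k) - s (p f \<otimes>\<^bsub>\<Gamma>\<^esub> p g) (p k) + s (p f) (p g \<otimes>\<^bsub>\<Gamma>\<^esub> p k) - s (p f) (p g) = 0"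
      if "f \<in> carrier E" "g \<in> carrier E" "k \<in> carrier E" for f g k
      using that by (simp add: s[symmetric] p.hom_mult[symmetric] coboundary1_def E.m_assoc algebra_simps
          del: p.hom_mult)
    then show ?thesis unfolding cocycles2_def surj[symmetric] by blast
  qed
  have neg: "(\<lambda>g h. - s g h) \<in> cocycles2 \<Gamma>" if "s \<in> cocycles2 \<Gamma>" for s :: "'g \<Rightarrow> 'g \<Rightarrow> 'a"
    using that by (auto simp: cocycles2_def algebra_simps)
  have equiv: "equiv (cocycles2 \<Gamma>) (cohomologous \<Gamma> :: ('g \<Rightarrow> 'g \<Rightarrow> 'a) rel)"
  proof (rule equivI)
    show "cohomologous \<Gamma> \<subseteq> cocycles2 \<Gamma> \<times> (cocycles2 \<Gamma> :: ('g \<Rightarrow> 'g \<Rightarrow> 'a) set)"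
      by (auto simp: cohomologous_def)
    show "refl_on (cocycles2 \<Gamma>) (cohomologous \<Gamma> :: ('g \<Rightarrow> 'g \<Rightarrow> 'a) rel)"
      by (auto simp: refl_on_def cohomologous_def coboundary1_def intro!: exI[of _ "\<lambda>_. 0"])
    show "sym (cohomologous \<Gamma> :: ('g \<Rightarrow> 'g \<Rightarrow> 'a) rel)"
    proof (rule symI, clarsimp simp: cohomologous_def)
      fix s s' :: "'g \<Rightarrow> 'g \<Rightarrow> 'a" and t
      assume *: "\<forall>g\<in>carrier \<Gamma>. \<forall>h\<in>carrier \<Gamma>. s' g h - s g h = coboundary1 \<Gamma> t g h"
      show "\<exists>t. \<forall>g\<in>carrier \<Gamma>. \<forall>h\<in>carrier \<Gamma>. s g h - s' g h = coboundary1 \<Gamma> t g h"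
      proof (intro exI ballI)
        fix g h assume "g \<in> carrier \<Gamma>" "h \<in> carrier \<Gamma>"
        then have "s' g h - s g h = coboundary1 \<Gamma> t g h" using * by blast
        then have "s g h - s' g h = - coboundary1 \<Gamma> t g h" by (metis minus_diff_eq)
        then show "s g h - s' g h = coboundary1 \<Gamma> (\<lambda>x. - t x) g h"
          by (simp add: coboundary1_def algebra_simps)
      qed
    qed
    show "trans (cohomologous \<Gamma> :: ('g \<Rightarrow> 'g \<Rightarrow> 'a) rel)"
    proof (rule transI, clarsimp simp: cohomologous_def)
      fix s s' s'' :: "'g \<Rightarrow> 'g \<Rightarrow> 'a" and t t'
      assume *: "\<forall>g\<in>carrier \<Gamma>. \<forall>h\<in>carrier \<Gamma>. s' g h - s g h = coboundary1 \<Gamma> t g h"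
        "\<forall>g\<in>carrier \<Gamma>. \<forall>h\<in>carrier \<Gamma>. s'' g h - s' g h = coboundary1 \<Gamma> t' g h"
      show "\<exists>t. \<forall>g\<in>carrier \<Gamma>. \<forall>h\<in>carrier \<Gamma>. s'' g h - s g h = coboundary1 \<Gamma> t g h"
      proof (intro exI ballI)
        fix g h assume "g \<in> carrier \<Gamma>" "h \<in> carrier \<Gamma>"
        then have "s'' g h - s' g h = coboundary1 \<Gamma> t' g h" "s' g h - s g h = coboundary1 \<Gamma> t g h"
          using * by blast+
        moreover have "s'' g h - s g h = (s'' g h - s' g h) + (s' g h - s g h)" by simp
        ultimately have "s'' g h - s g h = coboundary1 \<Gamma> t' g h + coboundary1 \<Gamma> t g h" by argo
        then show "s'' g h - s g h = coboundary1 \<Gamma> (\<lambda>x. t' x + t x) g h"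
          by (simp add: coboundary1_def algebra_simps)
      qed
    qed
  qed
  have \<sigma>_cocycle: "\<sigma> \<in> cocycles2 \<Gamma>" using cocycle[of \<tau> \<sigma>] \<sigma> by blast
  have in_H2: "cohomology_class \<Gamma> (\<lambda>g h. - \<sigma> g h) \<in> H2 \<Gamma>"
    using neg[OF \<sigma>_cocycle] by (simp add: H2_def cohomology_class_def quotientI)
  show ?thesis unfolding euler_class_def
  proof (rule the_equality)
    show "cohomology_class \<Gamma> (\<lambda>g h. - \<sigma> g h) \<in> H2 \<Gamma> \<and>
       (\<exists>t s. connection_cochain E i t \<and> s \<in> cocycles2 \<Gamma> \<and>
          (\<forall>g\<in>carrier E. \<forall>h\<in>carrier E. coboundary1 E t g h = s (p g) (p h)) \<and>
          cohomology_class \<Gamma> (\<lambda>g h. - \<sigma> g h) = cohomology_class \<Gamma> (\<lambda>g h. - s g h))"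
      using in_H2 conn \<sigma> \<sigma>_cocycle by blast
  next
    fix c
    assume "c \<in> H2 \<Gamma> \<and>
       (\<exists>t s. connection_cochain E i t \<and> s \<in> cocycles2 \<Gamma> \<and>
          (\<forall>g\<in>carrier E. \<forall>h\<in>carrier E. coboundary1 E t g h = s (p g) (p h)) \<and>
          c = cohomology_class \<Gamma> (\<lambda>g h. - s g h))"
    then obtain t s where t: "connection_cochain E i t" and s_cocycle: "s \<in> cocycles2 \<Gamma>"
      and s: "\<And>g h. g \<in> carrier E \<Longrightarrow> h \<in> carrier E \<Longrightarrow> coboundary1 E t g h = s (p g) (p h)"
      and c: "c = cohomology_class \<Gamma> (\<lambda>g h. - s g h)"
      by blast
    define lift where "lift = inv_into (carrier E) p"
    have lift: "lift x \<in> carrier E" "p (lift x) = x" if "x \<in> carrier \<Gamma>" for x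
      using that unfolding lift_def surj[symmetric] by (rule inv_into_into, rule f_inv_into_f)
    define u where "u x = t (lift x) - \<tau> (lift x)" for x
    have u: "t g - \<tau> g = u (p g)" if g: "g \<in> carrier E" for g
    proof -
      define l where "l = lift (p g)"
      have l: "l \<in> carrier E" "p l = p g" using lift[OF p.hom_closed[OF g]] by (auto simp: l_def)
      have "inv\<^bsub>E\<^esub> l \<otimes>\<^bsub>E\<^esub> g \<in> kernel E \<Gamma> p" using l g by (simp add: kernel_def)
      then obtain a where a: "inv\<^bsub>E\<^esub> l \<otimes>\<^bsub>E\<^esub> g = i a" using ker by auto
      then have "g = l \<otimes>\<^bsub>E\<^esub> i a"
        by (metis E.inv_solve_left g i l(1))
      then have "t g = t l + a" "\<tau> g = \<tau> l + a"
        using t conn l by (auto simp: connection_cochain_def)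
      then show ?thesis by (simp add: u_def l_def[symmetric])
    qed
    have "- \<sigma> (p g) (p h) - - s (p g) (p h) = coboundary1 \<Gamma> u (p g) (p h)"
      if "g \<in> carrier E" "h \<in> carrier E" for g h
      using that by (simp add: s[symmetric] \<sigma>[symmetric] coboundary1_def p.hom_mult[symmetric]
          u[symmetric] algebra_simps del: p.hom_mult)
    then have "((\<lambda>g h. - s g h), (\<lambda>g h. - \<sigma> g h)) \<in> cohomologous \<Gamma>"
      unfolding cohomologous_def using neg[OF s_cocycle] neg[OF \<sigma>_cocycle] surj[symmetric] by auto
    then show "c = cohomology_class \<Gamma> (\<lambda>g h. - \<sigma> g h)"
      unfolding c cohomology_class_def by (rule equiv_class_eq[OF equiv])
  qed
qed

lemma connection_cochain_exists:
  fixes E :: "('e, 'n) monoid_scheme" and \<Gamma> :: "('g, 'm) monoid_scheme"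
    and i :: "'a::ab_group_add \<Rightarrow> 'e"
  assumes ext: "central_extension E \<Gamma> i p"
  obtains \<tau> \<sigma> where "connection_cochain E i \<tau>"
    and "\<And>g h. g \<in> carrier E \<Longrightarrow> h \<in> carrier E \<Longrightarrow> coboundary1 E \<tau> g h = \<sigma> (p g) (p h)"
proof -
  interpret E: group E using ext by (simp add: central_extension_def)
  interpret \<Gamma>: group \<Gamma> using ext by (simp add: central_extension_def)
  have p: "p \<in> hom E \<Gamma>" and surj: "p ` carrier E = carrier \<Gamma>" and ker: "kernel E \<Gamma> p = range i"
    and i: "\<And>a. i a \<in> carrier E" and inj: "inj i" and add: "\<And>a b. i (a + b) = i a \<otimes>\<^bsub>E\<^esub> i b"
    and central: "\<And>a g. g \<in> carrier E \<Longrightarrow> g \<otimes>\<^bsub>E\<^esub> i a = i a \<otimes>\<^bsub>E\<^esub> g"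
    using ext unfolding central_extension_def by blast+
  interpret p: group_hom E \<Gamma> p by unfold_locales (rule p)
  define lift where "lift = inv_into (carrier E) p"
  have lift: "lift x \<in> carrier E" "p (lift x) = x" if "x \<in> carrier \<Gamma>" for x
    using that unfolding lift_def surj[symmetric] by (rule inv_into_into, rule f_inv_into_f)
  define \<tau> where "\<tau> g = (THE a. g = lift (p g) \<otimes>\<^bsub>E\<^esub> i a)" for g
  have \<tau>_eq: "\<tau> g = a" if "g \<in> carrier E" "g = lift (p g) \<otimes>\<^bsub>E\<^esub> i a" for g a
    unfolding \<tau>_def
  proof (rule the_equality)
    show "g = lift (p g) \<otimes>\<^bsub>E\<^esub> i a" by fact
    fix b assume "g = lift (p g) \<otimes>\<^bsub>E\<^esub> i b"
    with that(2) have "lift (p g) \<otimes>\<^bsub>E\<^esub> i b = lift (p g) \<otimes>\<^bsub>E\<^esub> i a" by argo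
    then have "i b = i a" using i lift(1)[OF p.hom_closed[OF that(1)]] by simp
    then show "b = a" using inj by (simp add: inj_eq)
  qed
  have \<tau>: "g = lift (p g) \<otimes>\<^bsub>E\<^esub> i (\<tau> g)" if g: "g \<in> carrier E" for g
  proof -
    define l where "l = lift (p g)"
    have l: "l \<in> carrier E" "p l = p g" using lift[OF p.hom_closed[OF g]] by (auto simp: l_def)
    have "inv\<^bsub>E\<^esub> l \<otimes>\<^bsub>E\<^esub> g \<in> kernel E \<Gamma> p" using l g by (simp add: kernel_def)
    then obtain a where a: "inv\<^bsub>E\<^esub> l \<otimes>\<^bsub>E\<^esub> g = i a" using ker by auto
    then have "g = l \<otimes>\<^bsub>E\<^esub> i a" by (metis E.inv_solve_left g i l(1))
    then have "g = lift (p g) \<otimes>\<^bsub>E\<^esub> i a" by (simp only: l_def)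
    with \<tau>_eq[OF g this] show ?thesis by argo
  qed
  have pi: "p (i a) = \<one>\<^bsub>\<Gamma>\<^esub>" for a using ker by (auto simp: kernel_def)
  have conn: "connection_cochain E i \<tau>" unfolding connection_cochain_def
  proof (intro ballI allI)
    fix g a assume g: "g \<in> carrier E"
    have pg: "p (g \<otimes>\<^bsub>E\<^esub> i a) = p g" using g i by (simp add: pi)
    have "g \<otimes>\<^bsub>E\<^esub> i a = (lift (p g) \<otimes>\<^bsub>E\<^esub> i (\<tau> g)) \<otimes>\<^bsub>E\<^esub> i a" using \<tau>[OF g] by argo
    also have "\<dots> = lift (p g) \<otimes>\<^bsub>E\<^esub> i (\<tau> g + a)"
      using g i lift(1) by (simp add: add E.m_assoc)
    finally have "g \<otimes>\<^bsub>E\<^esub> i a = lift (p (g \<otimes>\<^bsub>E\<^esub> i a)) \<otimes>\<^bsub>E\<^esub> i (\<tau> g + a)"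
      unfolding pg .
    with E.m_closed[OF g i] show "\<tau> (g \<otimes>\<^bsub>E\<^esub> i a) = \<tau> g + a" by (rule \<tau>_eq)
  qed
  have conn': "\<tau> (g \<otimes>\<^bsub>E\<^esub> i a) = \<tau> g + a" if "g \<in> carrier E" for g a
    using conn that by (simp add: connection_cochain_def)
  have "coboundary1 E \<tau> g h = coboundary1 E \<tau> (lift (p g)) (lift (p h))"
    if g: "g \<in> carrier E" and h: "h \<in> carrier E" for g h
  proof -
    define a b k l where "a = \<tau> g" "b = \<tau> h" "k = lift (p g)" "l = lift (p h)"
    have k: "k \<in> carrier E" "g = k \<otimes>\<^bsub>E\<^esub> i a" and l: "l \<in> carrier E" "h = l \<otimes>\<^bsub>E\<^esub> i b"
      using \<tau> lift(1) g h unfolding a_b_k_l_def by auto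
    have "g \<otimes>\<^bsub>E\<^esub> h = k \<otimes>\<^bsub>E\<^esub> ((i a \<otimes>\<^bsub>E\<^esub> l) \<otimes>\<^bsub>E\<^esub> i b)"
      using k l i by (simp add: E.m_assoc)
    also have "\<dots> = (k \<otimes>\<^bsub>E\<^esub> l) \<otimes>\<^bsub>E\<^esub> i (a + b)"
      unfolding central[OF l(1), of a, symmetric] using k l i by (simp add: E.m_assoc add)
    finally have "\<tau> (g \<otimes>\<^bsub>E\<^esub> h) = \<tau> (k \<otimes>\<^bsub>E\<^esub> l) + (a + b)" using k l by (simp add: conn')
    moreover have "\<tau> g = \<tau> k + a" "\<tau> h = \<tau> l + b" using k l by (metis conn')+
    ultimately show ?thesis
      unfolding coboundary1_def a_b_k_l_def(3,4)[symmetric] by (simp add: algebra_simps)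
  qed
  with conn show ?thesis by (intro that[of \<tau> "\<lambda>x y. coboundary1 E \<tau> (lift x) (lift y)"])
qed


section \<open>Smooth diffeomorphisms\<close>

text \<open>\<open>C\<^sup>k\<close> functions on an open set \<open>U\<close>.\<close>

primrec Ck_on :: "nat \<Rightarrow> 'a::euclidean_space set \<Rightarrow> ('a \<Rightarrow> 'b::euclidean_space) \<Rightarrow> bool"
  where
    "Ck_on 0 U f \<longleftrightarrow> continuous_on U f"
  | "Ck_on (Suc k) U f \<longleftrightarrow>
       (\<forall>x\<in>U. f differentiable (at x)) \<and>
       (\<forall>v. Ck_on k U (\<lambda>x. frechet_derivative f (at x) v))"

text \<open>
  A map on an arbitrary subset is smooth if it extends locally to a smooth map on an open set.
  For the closed disk this is smoothness up to the boundary; for the unit circle it is smoothness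
  on the embedded submanifold.
\<close>

definition smooth_on :: "'a::euclidean_space set \<Rightarrow> ('a \<Rightarrow> 'b::euclidean_space) \<Rightarrow> bool"
  where "smooth_on M f \<longleftrightarrow>
    (\<forall>x\<in>M. \<exists>U F. open U \<and> x \<in> U \<and> (\<forall>k. Ck_on k U F) \<and> (\<forall>y\<in>U \<inter> M. F y = f y))"

definition Diff :: "'a::euclidean_space set \<Rightarrow> ('a \<Rightarrow> 'a) set"
  where "Diff M = {f \<in> Bij M. smooth_on M f \<and> smooth_on M (inv_into M f)}"


section \<open>Diffeomorphisms of the circle and the universal covering extension\<close>

text \<open>The plane \<open>\<real>\<^sup>2\<close> is the type \<^typ>\<open>complex\<close>, with \<open>x = Re\<close> and \<open>y = Im\<close>.\<close>

abbreviation disk :: "complex set"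
  where "disk \<equiv> cball 0 1"

abbreviation circle :: "complex set"
  where "circle \<equiv> sphere 0 1"

text \<open>
  Orientation: the tangent vector \<open>d/dt\<close> of \<^term>\<open>cis t\<close> is mapped to a positive multiple of the
  positively oriented tangent vector at the image point.
\<close>

definition diff_circle :: "(complex \<Rightarrow> complex) monoid"
  where "diff_circle = (BijGroup circle)
    \<lparr>carrier := {\<mu> \<in> Diff circle.
       \<forall>t. \<exists>c>0. ((\<lambda>s. \<mu> (cis s)) has_vector_derivative c *\<^sub>R (\<i> * \<mu> (cis t))) (at t)}\<rparr>"

definition diff_circle_cover :: "(real \<Rightarrow> real) monoid"
  where "diff_circle_cover = (BijGroup UNIV)
    \<lparr>carrier := {\<phi> \<in> Diff UNIV.
       (\<forall>x. deriv \<phi> x > 0) \<and> (\<forall>x. \<phi> (x + 2 * pi) = \<phi> x + 2 * pi)}\<rparr>"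

definition deck_translation :: "int \<Rightarrow> real \<Rightarrow> real"
  where "deck_translation n = (\<lambda>x. x + 2 * pi * of_int n)"

text \<open>
  For \<open>\<phi>\<close> in the cover, \<open>cover_proj \<phi>\<close> sends \<^term>\<open>cis x\<close> to \<^term>\<open>cis (\<phi> x)\<close> for every real \<open>x\<close>;
  by equivariance the choice of the angle does not matter.
\<close>

definition cover_proj :: "(real \<Rightarrow> real) \<Rightarrow> complex \<Rightarrow> complex"
  where "cover_proj \<phi> = (\<lambda>z\<in>circle. cis (\<phi> (Arg z)))"

definition integral_euler_class ::
    "((complex \<Rightarrow> complex) \<Rightarrow> (complex \<Rightarrow> complex) \<Rightarrow> int) set"
  where "integral_euler_class = euler_class diff_circle_cover diff_circle deck_translation cover_proj"

definition real_euler_class ::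
    "((complex \<Rightarrow> complex) \<Rightarrow> (complex \<Rightarrow> complex) \<Rightarrow> real) set"
  where "real_euler_class = H2_map diff_circle of_int integral_euler_class"


section \<open>Area-preserving diffeomorphisms of the disk and the flux extension\<close>

type_synonym form1 = "complex \<Rightarrow> complex \<Rightarrow> real"
type_synonym form2 = "complex \<Rightarrow> complex \<Rightarrow> complex \<Rightarrow> real"

definition omega :: form2
  where "omega p u v = Re u * Im v - Im u * Re v"

definition eta :: form1
  where "eta p v = (Re p * Im v - Im p * Re v) / 2"

text \<open>
  Derivatives are taken within the disk, where they are unique also at boundary points.
\<close>

definition disk_deriv :: "(complex \<Rightarrow> complex) \<Rightarrow> complex \<Rightarrow> complex \<Rightarrow> complex"
  where "disk_deriv g p = frechet_derivative g (at p within disk)"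

definition pullback1 :: "(complex \<Rightarrow> complex) \<Rightarrow> form1 \<Rightarrow> form1"
  where "pullback1 g \<alpha> p v = \<alpha> (g p) (disk_deriv g p v)"

definition pullback2 :: "(complex \<Rightarrow> complex) \<Rightarrow> form2 \<Rightarrow> form2"
  where "pullback2 g \<beta> p u v = \<beta> (g p) (disk_deriv g p u) (disk_deriv g p v)"

definition line_integral :: "(real \<Rightarrow> complex) \<Rightarrow> form1 \<Rightarrow> real"
  where "line_integral \<gamma> \<alpha> =
    integral {0..1} (\<lambda>t. \<alpha> (\<gamma> t) (vector_derivative \<gamma> (at t within {0..1})))"

definition symp_disk :: "(complex \<Rightarrow> complex) monoid"
  where "symp_disk = (BijGroup disk)
    \<lparr>carrier := {g \<in> Diff disk. (\<forall>p\<in>disk. pullback2 g omega p = omega p) \<and> g 0 = 0}\<rparr>"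

definition symp_disk_rel :: "(complex \<Rightarrow> complex) monoid"
  where "symp_disk_rel = symp_disk
    \<lparr>carrier := {g \<in> carrier symp_disk. \<forall>z\<in>circle. g z = z}\<rparr>"

definition flux :: "(complex \<Rightarrow> complex) \<Rightarrow> real"
  where "flux g = line_integral (\<lambda>t. Complex t 0) (\<lambda>p v. pullback1 g eta p v - eta p v)"

definition flux_kernel :: "(complex \<Rightarrow> complex) set"
  where "flux_kernel = {g \<in> carrier symp_disk_rel. flux g = 0}"

definition flux_extension :: "(complex \<Rightarrow> complex) set monoid"
  where "flux_extension = symp_disk Mod flux_kernel"

text \<open>
  The inclusion of \<open>\<real>\<close> is the inverse of the isomorphism from the quotient
  of \<^const>\<open>symp_disk_rel\<close> by \<^const>\<open>flux_kernel\<close> to \<open>\<real>\<close> induced by \<^const>\<open>flux\<close>.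
\<close>

definition flux_incl :: "real \<Rightarrow> (complex \<Rightarrow> complex) set"
  where "flux_incl =
    inv_into (carrier (symp_disk_rel Mod flux_kernel)) (\<lambda>X. the_elem (flux ` X))"

definition flux_proj :: "(complex \<Rightarrow> complex) set \<Rightarrow> complex \<Rightarrow> complex"
  where "flux_proj X = the_elem ((\<lambda>g. restrict g circle) ` X)"

end

theory Submission
  imports Defs
begin

text \<open>
  For \<open>g\<close> in \<open>G\<close> the form \<open>g\<^sup>*\<eta> - \<eta>\<close> is closed, hence has a primitive \<open>f\<^sub>g\<close> on the disk with
  \<open>f\<^sub>g(0) = 0\<close>. Then \<open>f\<^sub>g(1)\<close> extends the flux to all of \<open>G\<close>, and \<open>f\<^bsub>gh\<^esub> = f\<^sub>g \<circ> h + f\<^sub>h\<close>. On the boundary,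
  where \<open>g\<close> lifts to \<open>\<phi>\<close>, \<open>g\<^sup>*\<eta> - \<eta> = (d\<phi> - d\<theta>)/2\<close>; so this extended flux is a connection cochain on
  \<open>G/K\<close> whose coboundary is \<open>-(\<phi>\<psi>(0) - \<phi>(0) - \<psi>(0))/2\<close>, which is \<open>-\<pi>\<close> times the cocycle representing
  the real Euler class. Exactness of the flux extension needs an area-preserving extension of every
  circle diffeomorphism to the disk, which is written down by means of a generating function.
\<close>

section \<open>Smooth maps on subsets of Euclidean spaces\<close>

text \<open>The factor pi is the ratio of two normalisations of one translation defect of lifts:
  \<open>eta\<close> restricts to half the angle form on the circle, so the flux sees the defect
  divided by 2, whereas the integral Euler class counts it in units of 2 * pi. The comparison works
  with an arbitrary integral connection cochain on the cover: under the deck translation by n, both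
  pi times this cochain and \<open>\<phi> 0 / 2\<close> grow by pi * n, so their difference descends
  to circle diffeomorphisms. That elements of G have increasing lifts on the boundary is not built
  into G; it is forced by invariance of domain and preservation of area. The main obstacle is the
  extension from the circle to the disk. The factor k in the generating function needs k(0) = 0 and
  k'(0) = 1 for the boundary values, has to vanish near the origin, where polar coordinates fail,
  and must keep 1 + k' * (\<phi>' - 1) positive although \<phi>' - 1 can be large. A cut-off of
  arctan(N x) / N, of slope 1 at 0 but small height, meets these demands.\<close>

lemma Ck_on_subset: "Ck_on k U f \<Longrightarrow> V \<subseteq> U \<Longrightarrow> Ck_on k V f"
  by (induction k arbitrary: f) (auto intro: continuous_on_subset)

lemma Ck_on_cong:
  assumes "open U" "\<And>x. x \<in> U \<Longrightarrow> f x = g x" "Ck_on k U f"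
  shows "Ck_on k U g"
  using assms(2,3)
proof (induction k arbitrary: f g)
  case 0
  then show ?case by (simp cong: continuous_on_cong)
next
  case (Suc k)
  have d: "(g has_derivative frechet_derivative f (at x)) (at x)" if "x \<in> U" for x
  proof (rule has_derivative_transform_within_open[OF _ \<open>open U\<close> that])
    show "(f has_derivative frechet_derivative f (at x)) (at x)"
      using Suc.prems(2) that by (simp add: frechet_derivative_works)
  qed (use Suc.prems in auto)
  have e: "frechet_derivative f (at x) = frechet_derivative g (at x)" if "x \<in> U" for x
    using d[OF that] by (rule frechet_derivative_at)
  have "Ck_on k U (\<lambda>x. frechet_derivative g (at x) v)" for v
    by (rule Suc.IH[of "\<lambda>x. frechet_derivative f (at x) v"]) (use Suc.prems(2) in \<open>simp_all add: e\<close>)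
  with d show ?case by (auto simp: differentiable_def)
qed

text \<open>\<open>Ck_on\<close> is phrased with the chosen derivative
  \<open>frechet_derivative\<close>. Uniqueness of derivatives lets any explicit formula take its
  place, which is how concrete derivatives enter smoothness proofs.\<close>

lemma Ck_on_SucI:
  assumes "open U" "\<And>x. x \<in> U \<Longrightarrow> (f has_derivative f' x) (at x)" "\<And>v. Ck_on k U (\<lambda>x. f' x v)"
  shows "Ck_on (Suc k) U f"
proof -
  have e: "f' x = frechet_derivative f (at x)" if "x \<in> U" for x
    using assms(2)[OF that] by (rule frechet_derivative_at)
  have "Ck_on k U (\<lambda>x. frechet_derivative f (at x) v)" for v
    by (rule Ck_on_cong[OF assms(1) _ assms(3)]) (simp add: e)
  with assms(2) show ?thesis by (auto simp: differentiable_def)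
qed

lemma Ck_on_SucE:
  assumes "Ck_on (Suc k) U f" "x \<in> U"
  shows "(f has_derivative frechet_derivative f (at x)) (at x)"
  using assms by (simp add: frechet_derivative_works)

lemma Ck_on_SucD: "Ck_on (Suc k) U f \<Longrightarrow> Ck_on k U f"
proof (induction k arbitrary: f)
  case 0
  then show ?case
    by (auto intro!: continuous_at_imp_continuous_on differentiable_imp_continuous_within)
next
  case (Suc k)
  then show ?case unfolding Ck_on.simps(2)[of "Suc k"] Ck_on.simps(2)[of k U f] by blast
qed

lemma Ck_on_local:
  assumes "\<And>x. x \<in> M \<Longrightarrow> \<exists>U. open U \<and> x \<in> U \<and> Ck_on k U f"
  shows "Ck_on k M f"
  using assms
proof (induction k arbitrary: f)
  case 0
  have "isCont f x" if x: "x \<in> M" for x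
  proof -
    obtain U where "open U" "x \<in> U" "continuous_on U f" using 0[OF x] by auto
    then show ?thesis by (simp add: continuous_on_eq_continuous_at)
  qed
  then show ?case by (simp add: continuous_at_imp_continuous_on)
next
  case (Suc k)
  show ?case unfolding Ck_on.simps
  proof (intro conjI ballI allI Suc.IH)
    fix x v assume x: "x \<in> M"
    then obtain U where "open U" "x \<in> U" "Ck_on (Suc k) U f" using Suc.prems by blast
    then show "f differentiable (at x)"
      "\<exists>U. open U \<and> x \<in> U \<and> Ck_on k U (\<lambda>x. frechet_derivative f (at x) v)" by auto
  qed
qed

lemma Ck_on_const: "open U \<Longrightarrow> Ck_on k U (\<lambda>_. c)"
  by (induction k arbitrary: c) (auto intro!: Ck_on_SucI derivative_eq_intros simp del: Ck_on.simps(2))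

lemma Ck_on_linear:
  assumes "open U" "bounded_linear f"
  shows "Ck_on k U f"
proof (cases k)
  case 0
  then show ?thesis using assms by (simp add: linear_continuous_on)
next
  case (Suc n)
  show ?thesis unfolding Suc
    by (rule Ck_on_SucI[OF assms(1)]) (auto intro: bounded_linear_imp_has_derivative assms Ck_on_const)
qed

lemma Ck_on_add:
  assumes "open U" "Ck_on k U f" "Ck_on k U g"
  shows "Ck_on k U (\<lambda>x. f x + g x)"
  using assms(2,3)
proof (induction k arbitrary: f g)
  case (Suc k)
  show ?case
  proof (rule Ck_on_SucI[OF assms(1)])
    fix x assume "x \<in> U"
    then show "((\<lambda>x. f x + g x) has_derivative
        (\<lambda>v. frechet_derivative f (at x) v + frechet_derivative g (at x) v)) (at x)"
      by (intro has_derivative_add Ck_on_SucE[OF Suc.prems(1)] Ck_on_SucE[OF Suc.prems(2)])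
  qed (use Suc in simp)
qed (auto intro: continuous_on_add)

lemma Ck_on_sum:
  assumes "open U" "\<And>i. i \<in> I \<Longrightarrow> Ck_on k U (f i)"
  shows "Ck_on k U (\<lambda>x. \<Sum>i\<in>I. f i x)"
  using assms(2) by (induction I rule: infinite_finite_induct) (auto intro: Ck_on_const Ck_on_add assms(1))

lemma Ck_on_bilinear:
  fixes prod :: "'b::euclidean_space \<Rightarrow> 'c::euclidean_space \<Rightarrow> 'd::euclidean_space"
  assumes "bounded_bilinear prod" "open U" "Ck_on k U f" "Ck_on k U g"
  shows "Ck_on k U (\<lambda>x. prod (f x) (g x))"
  using assms(3,4)
proof (induction k arbitrary: f g)
  case 0
  then show ?case by (simp add: bounded_bilinear.continuous_on[OF assms(1)])
next
  case (Suc k)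
  have k: "Ck_on k U f" "Ck_on k U g"
    using Suc.prems by (auto dest: Ck_on_SucD simp del: Ck_on.simps)
  show ?case
  proof (rule Ck_on_SucI[OF assms(2)])
    fix x assume "x \<in> U"
    then show "((\<lambda>x. prod (f x) (g x)) has_derivative
        (\<lambda>v. prod (f x) (frechet_derivative g (at x) v) + prod (frechet_derivative f (at x) v) (g x))) (at x)"
      by (intro bounded_bilinear.FDERIV[OF assms(1)] Ck_on_SucE[OF Suc.prems(1)] Ck_on_SucE[OF Suc.prems(2)])
  next
    fix v
    have "Ck_on k U (\<lambda>x. frechet_derivative f (at x) v)" "Ck_on k U (\<lambda>x. frechet_derivative g (at x) v)"
      using Suc.prems by simp_all
    then show "Ck_on k U (\<lambda>x. prod (f x) (frechet_derivative g (at x) v) + prod (frechet_derivative f (at x) v) (g x))"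
      by (intro Ck_on_add assms(2) Suc.IH k)
  qed
qed

lemma has_derivative_basis_expansion:
  fixes f' :: "'a::euclidean_space \<Rightarrow> 'b::real_normed_vector"
  assumes "(f has_derivative f') F"
  shows "f' v = (\<Sum>b\<in>Basis. (v \<bullet> b) *\<^sub>R f' b)"
proof -
  have "linear f'" using assms has_derivative_linear by blast
  then have "f' (\<Sum>b\<in>Basis. (v \<bullet> b) *\<^sub>R b) = (\<Sum>b\<in>Basis. (v \<bullet> b) *\<^sub>R f' b)"
    by (simp add: linear_sum linear_scale)
  then show ?thesis by (simp only: euclidean_representation)
qed

text \<open>\<open>Ck_on\<close> speaks of derivatives in a fixed direction, whereas the chain rule
  produces the derivative of g in a direction that moves with x. Expanding this direction in
  \<open>Basis\<close> leaves products of coefficients with fixed-direction derivatives composed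
  with f, to which the induction applies.\<close>

lemma Ck_on_compose:
  fixes f :: "'a::euclidean_space \<Rightarrow> 'b::euclidean_space" and g :: "'b \<Rightarrow> 'c::euclidean_space"
  assumes "open U" "open V" "Ck_on k U f" "Ck_on k V g" "f ` U \<subseteq> V"
  shows "Ck_on k U (\<lambda>x. g (f x))"
  using assms(3-5)
proof (induction k arbitrary: g f)
  case 0
  then show ?case by (auto intro: continuous_on_compose2)
next
  case (Suc k)
  have g: "(g has_derivative frechet_derivative g (at (f x))) (at (f x))" if "x \<in> U" for x
    using Suc.prems that by (blast intro: Ck_on_SucE)
  have d: "((\<lambda>x. g (f x)) has_derivative (\<lambda>v. \<Sum>b\<in>Basis. (frechet_derivative f (at x) v \<bullet> b) *\<^sub>R
      frechet_derivative g (at (f x)) b)) (at x)" if x: "x \<in> U" for x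
    unfolding has_derivative_basis_expansion[OF g[OF x], symmetric]
    by (rule has_derivative_compose[OF Ck_on_SucE[OF Suc.prems(1) x] g[OF x]])
  show ?case
  proof (rule Ck_on_SucI[OF assms(1) d])
    fix v
    show "Ck_on k U (\<lambda>x. \<Sum>b\<in>Basis. (frechet_derivative f (at x) v \<bullet> b) *\<^sub>R
      frechet_derivative g (at (f x)) b)"
    proof (intro Ck_on_sum assms(1) Ck_on_bilinear[OF bounded_bilinear_scaleR])
      fix b :: 'b assume "b \<in> Basis"
      show "Ck_on k U (\<lambda>x. frechet_derivative f (at x) v \<bullet> b)"
        by (rule Ck_on_bilinear[OF bounded_bilinear_inner assms(1) _ Ck_on_const[OF assms(1)]])
          (use Suc.prems in auto)
      show "Ck_on k U (\<lambda>x. frechet_derivative g (at (f x)) b)"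
        using Suc.prems Ck_on_SucD[OF Suc.prems(1)] by (intro Suc.IH) auto
    qed
  qed
qed

text \<open>The hypothesis is a first order equation for f. If f is k times continuously
  differentiable, so is its derivative, being \<open>G v\<close> composed with f; each round gains
  one order.\<close>

lemma Ck_on_bootstrap:
  fixes f :: "'a::euclidean_space \<Rightarrow> 'b::euclidean_space"
  assumes "open U" "open V" "f ` U \<subseteq> V"
    and "\<And>x. x \<in> U \<Longrightarrow> (f has_derivative (\<lambda>v. G v (f x))) (at x)"
    and "\<And>v k. Ck_on k V (G v)"
  shows "Ck_on k U f"
proof (induction k)
  case 0
  then show ?case
    by (auto intro!: continuous_at_imp_continuous_on has_derivative_continuous assms(4))
next
  case (Suc k)
  show ?case
    by (rule Ck_on_SucI[OF assms(1,4)], assumption) (rule Ck_on_compose[OF assms(1,2) Suc assms(5,3)])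
qed

section \<open>Smoothness on arbitrary subsets\<close>

lemma smooth_on_open: "open U \<Longrightarrow> smooth_on U f \<longleftrightarrow> (\<forall>k. Ck_on k U f)"
proof
  assume U: "open U" and f: "smooth_on U f"
  show "\<forall>k. Ck_on k U f"
  proof
    fix k
    show "Ck_on k U f"
    proof (rule Ck_on_local)
      fix x assume "x \<in> U"
      then have "\<exists>W F. open W \<and> x \<in> W \<and> (\<forall>k. Ck_on k W F) \<and> (\<forall>y\<in>W \<inter> U. F y = f y)"
        using f by (simp add: smooth_on_def)
      then obtain W F where "open W" "x \<in> W" and F: "Ck_on k W F" and eq: "\<And>y. y \<in> W \<inter> U \<Longrightarrow> F y = f y"
        by auto
      have "open (W \<inter> U)" using U \<open>open W\<close> by (rule open_Int[rotated])
      then have "Ck_on k (W \<inter> U) f"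
        using eq Ck_on_subset[OF F, of "W \<inter> U"] by (rule Ck_on_cong) auto
      then show "\<exists>U. open U \<and> x \<in> U \<and> Ck_on k U f"
        using U \<open>open W\<close> \<open>x \<in> W\<close> \<open>x \<in> U\<close> by (intro exI[of _ "W \<inter> U"]) auto
    qed
  qed
qed (auto simp: smooth_on_def)

lemma smooth_on_obtain:
  assumes "smooth_on M f" "x \<in> M"
  obtains U F where "open U" "x \<in> U" "smooth_on U F" "\<forall>y\<in>U \<inter> M. F y = f y"
proof -
  have "\<exists>U F. open U \<and> x \<in> U \<and> (\<forall>k. Ck_on k U F) \<and> (\<forall>y\<in>U \<inter> M. F y = f y)"
    using assms by (simp add: smooth_on_def)
  then obtain U F where "open U" "x \<in> U" "\<forall>k. Ck_on k U F" "\<forall>y\<in>U \<inter> M. F y = f y" by auto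
  then show ?thesis by (intro that[of U F]) (simp_all add: smooth_on_open)
qed

lemma smooth_onI:
  assumes "\<And>x. x \<in> M \<Longrightarrow> \<exists>U F. open U \<and> x \<in> U \<and> smooth_on U F \<and> (\<forall>y\<in>U \<inter> M. F y = f y)"
  shows "smooth_on M f"
  unfolding smooth_on_def
proof
  fix x assume "x \<in> M"
  with assms obtain U F where "open U" "x \<in> U" "smooth_on U F" "\<forall>y\<in>U \<inter> M. F y = f y" by blast
  then show "\<exists>U F. open U \<and> x \<in> U \<and> (\<forall>k. Ck_on k U F) \<and> (\<forall>y\<in>U \<inter> M. F y = f y)"
    by (auto simp: smooth_on_open)
qed

lemma smooth_on_subset: "smooth_on M f \<Longrightarrow> N \<subseteq> M \<Longrightarrow> smooth_on N f"
  unfolding smooth_on_def by (meson Int_iff subsetD)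

lemma smooth_on_cong: "(\<And>x. x \<in> M \<Longrightarrow> f x = g x) \<Longrightarrow> smooth_on M f \<longleftrightarrow> smooth_on M g"
  unfolding smooth_on_def by (intro ball_cong refl ex_cong1) auto

lemma smooth_on_continuous: 
  assumes f: "smooth_on M f"
  shows "continuous_on M f"
  unfolding continuous_on_eq_continuous_within
proof
  fix x assume x: "x \<in> M"
  with f obtain U F where U: "open U" "x \<in> U" "smooth_on U F" "\<forall>y\<in>U \<inter> M. F y = f y"
    by (rule smooth_on_obtain)
  then have "Ck_on 0 U F" using smooth_on_open by blast
  then have "isCont F x" using U by (simp add: continuous_on_eq_continuous_at)
  then have "(F \<longlongrightarrow> F x) (at x within M)"
    using continuous_at_imp_continuous_at_within by (auto simp: continuous_within)
  moreover have "\<forall>\<^sub>F y in at x within M. F y = f y"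
    using U by (auto simp: eventually_at_topological)
  ultimately have "(f \<longlongrightarrow> F x) (at x within M)" by (rule Lim_transform_eventually)
  then show "continuous (at x within M) f" using U x by (simp add: continuous_within)
qed

lemma smooth_on_const: "smooth_on M (\<lambda>_. c)"
  by (rule smooth_on_subset[of UNIV]) (auto simp: smooth_on_open Ck_on_const)

lemma smooth_on_linear: "bounded_linear f \<Longrightarrow> smooth_on M f"
  by (rule smooth_on_subset[of UNIV]) (auto simp: smooth_on_open Ck_on_linear)

lemma smooth_on_binaryI:
  fixes M :: "'a::euclidean_space set"
  assumes h: "\<And>(U :: 'a set) F G. open U \<Longrightarrow> smooth_on U F \<Longrightarrow> smooth_on U G \<Longrightarrow> smooth_on U (\<lambda>x. h (F x) (G x))"
    and "smooth_on M f" "smooth_on M g"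
  shows "smooth_on M (\<lambda>x. h (f x) (g x))"
proof (rule smooth_onI)
  fix x assume x: "x \<in> M"
  from assms(2) x obtain U F where U: "open U" "x \<in> U" "smooth_on U F" "\<forall>y\<in>U \<inter> M. F y = f y"
    by (rule smooth_on_obtain)
  from assms(3) x obtain V G where V: "open V" "x \<in> V" "smooth_on V G" "\<forall>y\<in>V \<inter> M. G y = g y"
    by (rule smooth_on_obtain)
  have "smooth_on (U \<inter> V) (\<lambda>x. h (F x) (G x))"
    using U V by (intro h) (auto intro: smooth_on_subset)
  with U V show "\<exists>U F. open U \<and> x \<in> U \<and> smooth_on U F \<and> (\<forall>y\<in>U \<inter> M. F y = h (f y) (g y))"
    by (intro exI[of _ "U \<inter> V"] exI[of _ "\<lambda>x. h (F x) (G x)"]) auto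
qed

lemma smooth_on_bilinear:
  fixes prod :: "'b::euclidean_space \<Rightarrow> 'c::euclidean_space \<Rightarrow> 'd::euclidean_space"
  assumes "bounded_bilinear prod" "smooth_on M f" "smooth_on M g"
  shows "smooth_on M (\<lambda>x. prod (f x) (g x))"
  by (rule smooth_on_binaryI[of prod, OF _ assms(2,3)]) (simp add: smooth_on_open Ck_on_bilinear[OF assms(1)])

lemma smooth_on_add:
  assumes "smooth_on M f" "smooth_on M g"
  shows "smooth_on M (\<lambda>x. f x + g x)"
  by (rule smooth_on_binaryI[of "(+)", OF _ assms]) (simp add: smooth_on_open Ck_on_add)

lemma smooth_on_compose:
  fixes f :: "'a::euclidean_space \<Rightarrow> 'b::euclidean_space" and g :: "'b \<Rightarrow> 'c::euclidean_space"
  assumes "smooth_on N g" "smooth_on M f" "f ` M \<subseteq> N"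
  shows "smooth_on M (\<lambda>x. g (f x))"
proof (rule smooth_onI)
  fix x assume x: "x \<in> M"
  from assms(2) x obtain U F where U: "open U" "x \<in> U" "smooth_on U F" "\<forall>y\<in>U \<inter> M. F y = f y"
    by (rule smooth_on_obtain)
  from assms(1) obtain V G where V: "open V" "f x \<in> V" "smooth_on V G" "\<forall>y\<in>V \<inter> N. G y = g y"
    by (rule smooth_on_obtain[of N g "f x"]) (use x assms(3) in auto)
  have W: "open (U \<inter> F -` V)"
    using smooth_on_continuous[OF U(3)] U(1) V(1) continuous_on_open_vimage[of U F]
    by (simp add: Int_commute)
  have "smooth_on (U \<inter> F -` V) (\<lambda>x. G (F x))"
    unfolding smooth_on_open[OF W]
  proof
    fix k
    have F: "Ck_on k U F" and G: "Ck_on k V G" using U V by (simp_all add: smooth_on_open)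
    have "Ck_on k (U \<inter> F -` V) F" by (rule Ck_on_subset[OF F]) simp
    then show "Ck_on k (U \<inter> F -` V) (\<lambda>x. G (F x))"
      by (rule Ck_on_compose[OF W V(1) _ G]) auto
  qed
  with U V W x assms(3) show "\<exists>U F. open U \<and> x \<in> U \<and> smooth_on U F \<and> (\<forall>y\<in>U \<inter> M. F y = g (f y))"
    by (intro exI[of _ "U \<inter> F -` V"] exI[of _ "\<lambda>x. G (F x)"]) (auto simp: image_subset_iff)
qed

lemma smooth_on_id: "smooth_on M (\<lambda>x. x)"
  by (rule smooth_on_linear) (rule bounded_linear_ident)

lemma smooth_on_bounded_linear:
  fixes f :: "'a::euclidean_space \<Rightarrow> 'b::euclidean_space" and g :: "'b \<Rightarrow> 'c::euclidean_space"
  shows "bounded_linear g \<Longrightarrow> smooth_on M f \<Longrightarrow> smooth_on M (\<lambda>x. g (f x))"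
  by (rule smooth_on_compose[OF smooth_on_linear[of g UNIV]]) auto

lemma smooth_on_minus: "smooth_on M f \<Longrightarrow> smooth_on M (\<lambda>x. - f x)"
  by (rule smooth_on_bounded_linear[OF bounded_linear_minus[OF bounded_linear_ident]])

lemma smooth_on_diff: "smooth_on M f \<Longrightarrow> smooth_on M g \<Longrightarrow> smooth_on M (\<lambda>x. f x - g x)"
  using smooth_on_add[of M f "\<lambda>x. - g x"] smooth_on_minus[of M g] by simp

lemmas smooth_on_mult = smooth_on_bilinear[OF bounded_bilinear_mult]
lemmas smooth_on_scaleR = smooth_on_bilinear[OF bounded_bilinear_scaleR]
lemmas smooth_on_inner = smooth_on_bilinear[OF bounded_bilinear_inner]
lemmas smooth_on_Re = smooth_on_bounded_linear[OF bounded_linear_Re]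
lemmas smooth_on_Im = smooth_on_bounded_linear[OF bounded_linear_Im]
lemmas smooth_on_of_real = smooth_on_bounded_linear[OF bounded_linear_of_real]

lemma smooth_on_local:
  assumes "\<And>x. x \<in> M \<Longrightarrow> \<exists>U. open U \<and> x \<in> U \<and> smooth_on (U \<inter> M) f"
  shows "smooth_on M f"
proof (rule smooth_onI)
  fix x assume x: "x \<in> M"
  with assms obtain U where U: "open U" "x \<in> U" and f: "smooth_on (U \<inter> M) f" by blast
  have "x \<in> U \<inter> M" using U x by simp
  with f obtain V F where "open V" "x \<in> V" "smooth_on V F" "\<forall>y\<in>V \<inter> (U \<inter> M). F y = f y"
    by (rule smooth_on_obtain)
  with U show "\<exists>U F. open U \<and> x \<in> U \<and> smooth_on U F \<and> (\<forall>y\<in>U \<inter> M. F y = f y)"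
    by (intro exI[of _ "U \<inter> V"] exI[of _ F]) (auto intro: smooth_on_subset)
qed

lemma smooth_on_has_derivative:
  assumes "open U" "smooth_on U f" "x \<in> U"
  shows "(f has_derivative frechet_derivative f (at x)) (at x)"
  using assms by (auto simp: smooth_on_open intro: Ck_on_SucE[of 0])

lemma smooth_on_frechet_derivative:
  assumes "open U" "smooth_on U f"
  shows "smooth_on U (\<lambda>x. frechet_derivative f (at x) v)"
  using assms by (metis Ck_on.simps(2) smooth_on_open)

lemma smooth_on_bootstrap:
  fixes f :: "'a::euclidean_space \<Rightarrow> 'b::euclidean_space"
  assumes "open U" "open V" "f ` U \<subseteq> V"
    and "\<And>x. x \<in> U \<Longrightarrow> (f has_derivative (\<lambda>v. G v (f x))) (at x)"
    and "\<And>v. smooth_on V (G v)"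
  shows "smooth_on U f"
  using assms Ck_on_bootstrap[of U V f G] by (simp add: smooth_on_open)

lemma smooth_on_derivativeI:
  assumes "open U" "\<And>x. x \<in> U \<Longrightarrow> (f has_derivative f' x) (at x)" "\<And>v. smooth_on U (\<lambda>x. f' x v)"
  shows "smooth_on U f"
  unfolding smooth_on_open[OF assms(1)]
proof
  fix k
  have "Ck_on (Suc k) U f" using Ck_on_SucI[OF assms(1,2)] assms(1,3) by (simp add: smooth_on_open)
  then show "Ck_on k U f" by (rule Ck_on_SucD)
qed

section \<open>Smoothness of elementary functions\<close>

lemma smooth_on_inverse:
  fixes f :: "'a::euclidean_space \<Rightarrow> 'b::{real_normed_field, euclidean_space}"
  assumes "smooth_on M f" "\<And>x. x \<in> M \<Longrightarrow> f x \<noteq> 0"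
  shows "smooth_on M (\<lambda>x. inverse (f x))"
proof -
  have "smooth_on (- {0::'b}) inverse"
  proof (rule smooth_on_bootstrap[where V = UNIV and G = "\<lambda>v y. - (y * v * y)"])
    show "smooth_on UNIV (\<lambda>y::'b. - (y * v * y))" for v
      by (intro smooth_on_minus smooth_on_mult smooth_on_id smooth_on_const)
  qed (auto intro: has_derivative_inverse')
  then show ?thesis by (rule smooth_on_compose[OF _ assms(1)]) (use assms(2) in auto)
qed

lemma smooth_on_divide:
  fixes f g :: "'a::euclidean_space \<Rightarrow> 'b::{real_normed_field, euclidean_space}"
  assumes "smooth_on M f" "smooth_on M g" "\<And>x. x \<in> M \<Longrightarrow> g x \<noteq> 0"
  shows "smooth_on M (\<lambda>x. f x / g x)"
  using smooth_on_mult[OF assms(1) smooth_on_inverse[OF assms(2,3)]] by (simp add: divide_inverse)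

lemma smooth_on_power:
  fixes f :: "'a::euclidean_space \<Rightarrow> 'b::{real_normed_field, euclidean_space}"
  assumes "smooth_on M f"
  shows "smooth_on M (\<lambda>x. f x ^ n)"
  by (induction n) (auto intro: smooth_on_mult assms smooth_on_const)

lemma smooth_on_exp:
  fixes f :: "'a::euclidean_space \<Rightarrow> 'b::{real_normed_field, banach, euclidean_space}"
  assumes "smooth_on M f"
  shows "smooth_on M (\<lambda>x. exp (f x))"
proof -
  have "smooth_on (UNIV :: 'b set) exp"
  proof (rule smooth_on_bootstrap[where V = UNIV and G = "\<lambda>v y. y * v"])
    show "smooth_on UNIV (\<lambda>y::'b. y * v)" for v
      by (intro smooth_on_mult smooth_on_id smooth_on_const)
    show "(exp has_derivative (\<lambda>v. exp x * v)) (at x)" for x :: 'b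
      using DERIV_exp[of x] by (simp add: has_field_derivative_def)
  qed auto
  then show ?thesis by (rule smooth_on_compose[OF _ assms]) auto
qed

lemma smooth_on_cis:
  assumes "smooth_on M f"
  shows "smooth_on M (\<lambda>x. cis (f x))"
  unfolding cis_conv_exp by (intro smooth_on_exp smooth_on_mult smooth_on_const smooth_on_of_real assms)

lemma smooth_on_Ln:
  assumes "smooth_on M f" "\<And>x. x \<in> M \<Longrightarrow> f x \<notin> \<real>\<^sub>\<le>\<^sub>0"
  shows "smooth_on M (\<lambda>x. Ln (f x))"
proof -
  have "smooth_on (- \<real>\<^sub>\<le>\<^sub>0) Ln"
  proof (rule smooth_on_derivativeI)
    show "open (- \<real>\<^sub>\<le>\<^sub>0 :: complex set)" by (simp add: open_Compl)
    show "(Ln has_derivative (\<lambda>v. inverse z * v)) (at z)" if "z \<in> - \<real>\<^sub>\<le>\<^sub>0" for z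
      using has_field_derivative_Ln[of z] that by (simp add: has_field_derivative_def)
    show "smooth_on (- \<real>\<^sub>\<le>\<^sub>0) (\<lambda>z. inverse z * v)" for v :: complex
      by (intro smooth_on_mult smooth_on_const smooth_on_inverse smooth_on_id) auto
  qed
  then show ?thesis by (rule smooth_on_compose[OF _ assms(1)]) (use assms(2) in auto)
qed

lemma smooth_on_sqrt:
  assumes "smooth_on M f" "\<And>x. x \<in> M \<Longrightarrow> f x > 0"
  shows "smooth_on M (\<lambda>x. sqrt (f x))"
proof -
  have "smooth_on {0<..} sqrt"
  proof (rule smooth_on_bootstrap[where V = "- {0}" and G = "\<lambda>v y. inverse y / 2 * v"])
    show "smooth_on (- {0}) (\<lambda>y::real. inverse y / 2 * v)" for v
      by (intro smooth_on_mult smooth_on_divide smooth_on_inverse smooth_on_id smooth_on_const) auto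
    show "(sqrt has_derivative (\<lambda>v. inverse (sqrt x) / 2 * v)) (at x)" if "x \<in> {0<..}" for x
      by (rule DERIV_real_sqrt[unfolded has_field_derivative_def]) (use that in simp)
  qed (auto simp: open_Compl)
  then show ?thesis by (rule smooth_on_compose[OF _ assms(1)]) (use assms(2) in auto)
qed

lemma smooth_on_arctan:
  assumes "smooth_on M f"
  shows "smooth_on M (\<lambda>x. arctan (f x))"
proof -
  have nz: "1 + x\<^sup>2 \<noteq> 0" for x :: real by (metis not_sum_power2_lt_zero one_power2 power_one sum_power2_eq_zero_iff zero_neq_one)
  have "smooth_on UNIV arctan"
  proof (rule smooth_on_derivativeI)
    show "(arctan has_derivative (\<lambda>v. inverse (1 + x\<^sup>2) * v)) (at x)" for x
      using DERIV_arctan[of x] by (simp add: has_field_derivative_def)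
    show "smooth_on UNIV (\<lambda>x. inverse (1 + x\<^sup>2) * v)" for v :: real
      by (intro smooth_on_mult smooth_on_const smooth_on_inverse smooth_on_id smooth_on_add smooth_on_power nz)
  qed auto
  then show ?thesis by (rule smooth_on_compose[OF _ assms]) auto
qed

text \<open>The family exp(-1/x) / x^n, extended by 0 to x \<le> 0. The parameter n makes it closed
  under differentiation up to linear combinations, so that smoothness at 0 is one induction for all
  n at once.\<close>

definition flat_exp :: "nat \<Rightarrow> real \<Rightarrow> real"
  where "flat_exp n x = (if x \<le> 0 then 0 else exp (- inverse x) * inverse x ^ n)"

lemma flat_exp_has_derivative:
  "(flat_exp n has_real_derivative flat_exp (n + 2) x - real n * flat_exp (n + 1) x) (at x)"
proof (cases x "0::real" rule: linorder_cases)
  case less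
  have "((\<lambda>_. 0) has_real_derivative 0) (at x)" by simp
  then have "(flat_exp n has_real_derivative 0) (at x)"
    by (rule has_field_derivative_transform_within_open[where S = "{..<0}"])
      (use less in \<open>auto simp: flat_exp_def\<close>)
  with less show ?thesis by (simp add: flat_exp_def)
next
  case greater
  have "((\<lambda>x. exp (- inverse x) * inverse x ^ n) has_real_derivative
      flat_exp (n + 2) x - real n * flat_exp (n + 1) x) (at x)"
    using greater
    by (auto intro!: derivative_eq_intros simp: flat_exp_def field_simps power2_eq_square)
       (cases n; simp add: field_simps)
  then show ?thesis
    by (rule has_field_derivative_transform_within_open[where S = "{0<..}"])
      (use greater in \<open>auto simp: flat_exp_def\<close>)
next
  case equal
  \<comment> \<open>With y = 1/h the difference quotient at 0 from the right is exp(-y) * y^(n+1),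
    and the exponential wins as y grows.\<close>
  have lim: "((\<lambda>y::real. exp (- y) * y ^ Suc n) \<longlongrightarrow> 0) at_top"
    using tendsto_power_div_exp_0[of "Suc n"] by (simp add: exp_minus divide_inverse mult.commute)
  have "((\<lambda>h::real. exp (- inverse h) * inverse h ^ Suc n) \<longlongrightarrow> 0) (at_right 0)"
    by (rule filterlim_compose[OF lim filterlim_inverse_at_top_right])
  moreover have "\<forall>\<^sub>F h in at_right 0. exp (- inverse h) * inverse h ^ Suc n = flat_exp n h / h"
    using eventually_at_right_less[of 0] by eventually_elim (simp add: flat_exp_def field_simps)
  ultimately have "((\<lambda>h. flat_exp n h / h) \<longlongrightarrow> 0) (at_right 0)"
    by (rule Lim_transform_eventually)
  moreover have "((\<lambda>h. flat_exp n h / h) \<longlongrightarrow> 0) (at_left 0)"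
    by (rule tendsto_eventually) (auto simp: flat_exp_def eventually_at_filter)
  ultimately have "((\<lambda>h. flat_exp n h / h) \<longlongrightarrow> 0) (at 0)"
    by (simp add: filterlim_split_at)
  then show ?thesis using equal by (simp add: DERIV_def flat_exp_def)
qed

lemma smooth_on_flat_exp:
  assumes "smooth_on M f"
  shows "smooth_on M (\<lambda>x. flat_exp n (f x))"
proof -
  have d: "(flat_exp n has_derivative (\<lambda>v. (flat_exp (n + 2) x - real n * flat_exp (n + 1) x) * v)) (at x)" for n x
    using flat_exp_has_derivative[of n x] by (simp add: has_field_derivative_def)
  have "Ck_on k UNIV (flat_exp n)" for k
  proof (induction k arbitrary: n)
    case 0
    then show ?case
      by (auto intro!: continuous_at_imp_continuous_on has_derivative_continuous d)
  next
    case (Suc k)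
    have "Ck_on k UNIV (\<lambda>x. (flat_exp (n + 2) x + (- real n) * flat_exp (n + 1) x) * v)" for v
      by (rule Ck_on_bilinear[OF bounded_bilinear_mult open_UNIV Ck_on_add[OF open_UNIV Suc
          Ck_on_bilinear[OF bounded_bilinear_mult open_UNIV Ck_on_const Suc]] Ck_on_const]) auto
    then show ?case by (intro Ck_on_SucI[OF open_UNIV d]) simp
  qed
  then have "smooth_on UNIV (flat_exp n)" by (simp add: smooth_on_open)
  then show ?thesis by (rule smooth_on_compose[OF _ assms]) auto
qed

text \<open>The inverse function theorem gives the derivative \<open>A (g y)\<close> of g at y. This
  is an equation of the kind treated in \<open>smooth_on_bootstrap\<close>, which supplies all
  higher orders.\<close>

lemma smooth_on_inverse_function:
  fixes f g :: "'a::euclidean_space \<Rightarrow> 'a"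
  assumes "\<And>x. g (f x) = x" "\<And>y. f (g y) = y"
    and f': "\<And>x. (f has_derivative f' x) (at x)"
    and A: "\<And>x v. f' x (A x v) = v" "\<And>x. bounded_linear (A x)" "\<And>v. smooth_on UNIV (\<lambda>x. A x v)"
  shows "smooth_on UNIV g"
proof (rule smooth_on_bootstrap[where V = UNIV and G = "\<lambda>v x. A x v"])
  fix y
  have "(g has_derivative A (g y)) (at (f (g y)))"
  proof (rule has_derivative_inverse_strong[where f = f and x = "g y", OF open_UNIV])
    show "continuous_on UNIV f"
      by (auto intro!: continuous_at_imp_continuous_on has_derivative_continuous f')
    show "(f has_derivative f' (g y)) (at (g y))" by (rule f')
    show "f' (g y) \<circ> A (g y) = id" using A by auto
  qed (use assms in auto)
  then show "(g has_derivative (\<lambda>v. A (g y) v)) (at y)" using assms by simp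
qed (use A in auto)

section \<open>Symmetry of second derivatives\<close>

text \<open>Two applications of the mean value theorem to the second difference over a small
  parallelogram: along v to the difference of F across the sides, then along w to the derivative in
  direction v.\<close>

lemma mixed_difference_quotient:
  fixes F :: "'a::euclidean_space \<Rightarrow> real"
  assumes D: "\<And>y. y \<in> ball x r \<Longrightarrow> (F has_derivative D y) (at y)"
    and DD: "\<And>y. y \<in> ball x r \<Longrightarrow> ((\<lambda>y. D y v) has_derivative E y) (at y)"
    and s: "0 < s" "s * (norm v + norm w) < r"
  shows "\<exists>y\<in>ball x r. F (x + s *\<^sub>R v + s *\<^sub>R w) - F (x + s *\<^sub>R v) - F (x + s *\<^sub>R w) + F x = s\<^sup>2 * E y w"
proof -
  have mem: "x + a *\<^sub>R v + b *\<^sub>R w \<in> ball x r" if "0 \<le> a" "a \<le> s" "0 \<le> b" "b \<le> s" for a b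
  proof -
    have "norm (a *\<^sub>R v + b *\<^sub>R w) \<le> a * norm v + b * norm w"
      using norm_triangle_ineq[of "a *\<^sub>R v" "b *\<^sub>R w"] that by simp
    also have "\<dots> \<le> s * norm v + s * norm w" using that by (intro add_mono mult_right_mono) auto
    also have "\<dots> < r" using s by (simp add: algebra_simps)
    finally show ?thesis by (simp add: dist_norm norm_minus_commute add.assoc add.commute[of "b *\<^sub>R w"])
  qed
  have lin: "linear (D y)" if "y \<in> ball x r" for y using D[OF that] has_derivative_linear by blast
  have linE: "linear (E y)" if "y \<in> ball x r" for y using DD[OF that] has_derivative_linear by blast
  define \<phi> where "\<phi> a = F (x + a *\<^sub>R v + s *\<^sub>R w) - F (x + a *\<^sub>R v)" for a
  have "(\<phi> has_real_derivative D (x + a *\<^sub>R v + s *\<^sub>R w) v - D (x + a *\<^sub>R v) v) (at a)"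
    if "0 \<le> a" "a \<le> s" for a
  proof -
    have m: "x + a *\<^sub>R v + s *\<^sub>R w \<in> ball x r" "x + a *\<^sub>R v \<in> ball x r"
      using mem[of a s] mem[of a 0] that s by auto
    have "((\<lambda>a. F (x + a *\<^sub>R v + s *\<^sub>R w)) has_derivative (\<lambda>h. D (x + a *\<^sub>R v + s *\<^sub>R w) (h *\<^sub>R v))) (at a)"
      by (rule has_derivative_compose[where f = "\<lambda>a. x + a *\<^sub>R v + s *\<^sub>R w", OF _ D[OF m(1)]]) (auto intro!: derivative_eq_intros)
    moreover have "((\<lambda>a. F (x + a *\<^sub>R v)) has_derivative (\<lambda>h. D (x + a *\<^sub>R v) (h *\<^sub>R v))) (at a)"
      by (rule has_derivative_compose[where f = "\<lambda>a. x + a *\<^sub>R v", OF _ D[OF m(2)]]) (auto intro!: derivative_eq_intros)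
    ultimately have "(\<phi> has_derivative (\<lambda>h. D (x + a *\<^sub>R v + s *\<^sub>R w) (h *\<^sub>R v) - D (x + a *\<^sub>R v) (h *\<^sub>R v))) (at a)"
      unfolding \<phi>_def by (rule has_derivative_diff)
    then show ?thesis
      unfolding has_field_derivative_def
      by (rule has_derivative_eq_rhs)
        (simp add: fun_eq_iff linear_scale[OF lin[OF m(1)]] linear_scale[OF lin[OF m(2)]] right_diff_distrib mult.commute)
  qed
  from MVT2[OF s(1) this] obtain \<xi> where \<xi>: "0 < \<xi>" "\<xi> < s"
    "\<phi> s - \<phi> 0 = s * (D (x + \<xi> *\<^sub>R v + s *\<^sub>R w) v - D (x + \<xi> *\<^sub>R v) v)" by auto
  define \<psi> where "\<psi> b = D (x + \<xi> *\<^sub>R v + b *\<^sub>R w) v" for b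
  have "(\<psi> has_real_derivative E (x + \<xi> *\<^sub>R v + b *\<^sub>R w) w) (at b)" if "0 \<le> b" "b \<le> s" for b
  proof -
    have m: "x + \<xi> *\<^sub>R v + b *\<^sub>R w \<in> ball x r" using mem[of \<xi> b] that \<xi> by auto
    have "(\<psi> has_derivative (\<lambda>h. E (x + \<xi> *\<^sub>R v + b *\<^sub>R w) (h *\<^sub>R w))) (at b)"
      unfolding \<psi>_def
      by (rule has_derivative_compose[where f = "\<lambda>b. x + \<xi> *\<^sub>R v + b *\<^sub>R w", OF _ DD[OF m]]) (auto intro!: derivative_eq_intros)
    then show ?thesis
      unfolding has_field_derivative_def
      by (rule has_derivative_eq_rhs) (simp add: fun_eq_iff linear_scale[OF linE[OF m]] mult.commute)
  qed
  from MVT2[OF s(1) this] obtain \<zeta> where \<zeta>: "0 < \<zeta>" "\<zeta> < s"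
    "\<psi> s - \<psi> 0 = s * E (x + \<xi> *\<^sub>R v + \<zeta> *\<^sub>R w) w" by auto
  have "x + \<xi> *\<^sub>R v + \<zeta> *\<^sub>R w \<in> ball x r" using mem[of \<xi> \<zeta>] \<xi> \<zeta> by auto
  moreover have "F (x + s *\<^sub>R v + s *\<^sub>R w) - F (x + s *\<^sub>R v) - F (x + s *\<^sub>R w) + F x
      = s\<^sup>2 * E (x + \<xi> *\<^sub>R v + \<zeta> *\<^sub>R w) w"
    using \<xi>(3) \<zeta>(3) by (simp add: \<phi>_def \<psi>_def power2_eq_square)
  ultimately show ?thesis by blast
qed

text \<open>The second difference is unchanged when v and w are exchanged. Hence the two iterated
  derivatives take a common value, at possibly different points, in every small ball around x, and
  continuity carries the equality to x.\<close>

lemma symmetric_second_derivative_real: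
  fixes F :: "'a::euclidean_space \<Rightarrow> real"
  assumes "open U" "smooth_on U F" "x \<in> U"
  shows "frechet_derivative (\<lambda>y. frechet_derivative F (at y) v) (at x) w
    = frechet_derivative (\<lambda>y. frechet_derivative F (at y) w) (at x) v"
proof -
  define E where "E v w y = frechet_derivative (\<lambda>y. frechet_derivative F (at y) v) (at y) w" for v w y
  have D: "(F has_derivative frechet_derivative F (at y)) (at y)" if "y \<in> U" for y
    using smooth_on_has_derivative[OF assms(1,2) that] .
  have DD: "((\<lambda>y. frechet_derivative F (at y) v) has_derivative (\<lambda>w. E v w y)) (at y)" if "y \<in> U" for y v
    unfolding E_def
    using smooth_on_has_derivative[OF assms(1) smooth_on_frechet_derivative[OF assms(1,2)] that] .
  have "isCont (E v w) x" for v w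
    unfolding E_def
    using smooth_on_continuous[OF smooth_on_frechet_derivative[OF assms(1)
        smooth_on_frechet_derivative[OF assms(1,2)]]] assms(1,3)
    by (simp add: continuous_on_eq_continuous_at)
  then have lim: "(E v w \<longlongrightarrow> E v w x) (nhds x)" for v w
    by (simp add: continuous_at tendsto_nhds_iff isCont_def)
  have "dist (E v w x) (E w v x) \<le> e" if e: "e > 0" for e
  proof -
    have "\<forall>\<^sub>F y in nhds x. y \<in> U \<and> dist (E v w y) (E v w x) < e / 2 \<and> dist (E w v y) (E w v x) < e / 2"
      using assms(1,3) e by (intro eventually_conj eventually_nhds_in_open tendstoD[OF lim]) auto
    then obtain r where r: "r > 0" and B: "\<And>y. y \<in> ball x r \<Longrightarrow>
        y \<in> U \<and> dist (E v w y) (E v w x) < e / 2 \<and> dist (E w v y) (E w v x) < e / 2"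
      unfolding eventually_nhds_metric by (auto simp: dist_commute)
    \<comment> \<open>Small enough for the parallelogram to stay inside the ball; the summand 1
      covers v = w = 0.\<close>
    define s where "s = r / (2 * (norm v + norm w + 1))"
    have pos: "norm v + norm w + 1 > 0" by (simp add: add_nonneg_pos)
    have s: "s > 0" using r pos by (simp add: s_def)
    have "s * (norm v + norm w) \<le> s * (norm v + norm w + 1)" using s by (intro mult_left_mono) auto
    also have "\<dots> = r / 2" using pos by (simp add: s_def field_simps)
    finally have sr: "s * (norm v + norm w) < r" "s * (norm w + norm v) < r" using r by (simp_all add: add.commute)
    obtain y where y: "y \<in> ball x r"
      "F (x + s *\<^sub>R v + s *\<^sub>R w) - F (x + s *\<^sub>R v) - F (x + s *\<^sub>R w) + F x = s\<^sup>2 * E v w y"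
      using mixed_difference_quotient[OF D DD s sr(1), of x] B by blast
    obtain z where z: "z \<in> ball x r"
      "F (x + s *\<^sub>R w + s *\<^sub>R v) - F (x + s *\<^sub>R w) - F (x + s *\<^sub>R v) + F x = s\<^sup>2 * E w v z"
      using mixed_difference_quotient[OF D DD s sr(2), of x] B by blast
    have "x + s *\<^sub>R w + s *\<^sub>R v = x + s *\<^sub>R v + s *\<^sub>R w" by (simp add: ac_simps)
    with y(2) z(2) have "s\<^sup>2 * E v w y = s\<^sup>2 * E w v z" by (simp only:)
    then have "E v w y = E w v z" using s by simp
    then have "dist (E v w x) (E w v x) \<le> dist (E v w y) (E v w x) + dist (E w v z) (E w v x)"
      by (metis dist_commute dist_triangle)
    also have "\<dots> \<le> e" using B[OF y(1)] B[OF z(1)] by auto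
    finally show ?thesis .
  qed
  then have "E v w x = E w v x" by (metis dist_eq_0_iff dist_le_zero_iff field_le_epsilon add_0)
  then show ?thesis by (simp add: E_def)
qed

lemma symmetric_second_derivative:
  fixes F :: "'a::euclidean_space \<Rightarrow> 'b::euclidean_space"
  assumes U: "open U" and F: "smooth_on U F" and x: "x \<in> U"
  shows "frechet_derivative (\<lambda>y. frechet_derivative F (at y) v) (at x) w
    = frechet_derivative (\<lambda>y. frechet_derivative F (at y) w) (at x) v"
proof (rule euclidean_eqI)
  let ?D = "\<lambda>f y. frechet_derivative f (at y)"
  fix b :: 'b assume "b \<in> Basis"
  define G where "G y = F y \<bullet> b" for y
  have G: "smooth_on U G" unfolding G_def by (intro smooth_on_inner F smooth_on_const)
  have 1: "?D G y = (\<lambda>v. ?D F y v \<bullet> b)" if "y \<in> U" for y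
    using has_derivative_inner_left[OF smooth_on_has_derivative[OF U F that], of b] unfolding G_def
    by (rule frechet_derivative_at[symmetric])
  have 2: "?D (\<lambda>y. ?D G y v) x w =
     ?D (\<lambda>y. ?D F y v) x w \<bullet> b" for v w
  proof -
    have "((\<lambda>y. ?D F y v \<bullet> b) has_derivative
        (\<lambda>w. ?D (\<lambda>y. ?D F y v) x w \<bullet> b)) (at x)"
      by (rule has_derivative_inner_left[OF
          smooth_on_has_derivative[OF U smooth_on_frechet_derivative[OF U F] x]])
    then have "((\<lambda>y. ?D G y v) has_derivative
        (\<lambda>w. ?D (\<lambda>y. ?D F y v) x w \<bullet> b)) (at x)"
      by (rule has_derivative_transform_within_open[OF _ U x]) (simp add: 1)
    then show ?thesis by (metis frechet_derivative_at)
  qed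
  show "?D (\<lambda>y. ?D F y v) x w \<bullet> b
    = ?D (\<lambda>y. ?D F y w) x v \<bullet> b"
    using symmetric_second_derivative_real[OF U G x, of v w] by (simp add: 2)
qed

section \<open>Derivatives within convex sets\<close>

text \<open>Differentiating f along the segment from x to a point y of S shows that A and B agree on
  y - x. Differences of such vectors, with y in a ball inside S, reach every direction up to a
  scalar. This makes derivatives within the disk unique at boundary points too.\<close>

lemma has_derivative_unique_convex:
  fixes f :: "'a::euclidean_space \<Rightarrow> 'b::real_normed_vector"
  assumes S: "convex S" "interior S \<noteq> {}" and x: "x \<in> S"
    and A: "(f has_derivative A) (at x within S)" and B: "(f has_derivative B) (at x within S)"
  shows "A = B"
proof
  have lin: "linear A" "linear B" using A B has_derivative_linear by blast+
  have eq: "A (y - x) = B (y - x)" if y: "y \<in> S" for y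
  proof -
    define c where "c t = x + t *\<^sub>R (y - x)" for t :: real
    have c: "c ` {0..1} \<subseteq> S"
    proof
      fix z assume "z \<in> c ` {0..1}"
      then obtain t where "z = x + t *\<^sub>R (y - x)" "t \<in> {0..1}"
        unfolding c_def by blast
      moreover have "x + t *\<^sub>R (y - x) = (1 - t) *\<^sub>R x + t *\<^sub>R y" by (simp add: algebra_simps)
      ultimately show "z \<in> S" using S x y by (simp add: convexD)
    qed
    have "((\<lambda>t. f (c t)) has_vector_derivative L (y - x)) (at 0 within {0..1})"
      if L: "(f has_derivative L) (at x within S)" for L
    proof -
      have 1: "(c has_derivative (\<lambda>h. h *\<^sub>R (y - x))) (at 0 within {0..1})"
        unfolding c_def by (auto intro!: derivative_eq_intros)
      have 2: "(f has_derivative L) (at (c 0) within c ` {0..1})"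
        using has_derivative_subset[OF L c] by (simp add: c_def)
      have "((\<lambda>t. f (c t)) has_derivative (\<lambda>h. L (h *\<^sub>R (y - x)))) (at 0 within {0..1})"
        by (rule has_derivative_in_compose[OF 1 2])
      then show ?thesis
        using has_derivative_linear[OF L] by (simp add: has_vector_derivative_def linear_scale)
    qed
    from this[OF A] this[OF B] show ?thesis
      using vector_derivative_unique_within_closed_interval[of 0 1 0 "\<lambda>t. f (c t)"] by simp
  qed
  fix v :: 'a
  from S obtain z where "z \<in> interior S" by blast
  then obtain e where e: "e > 0" "ball z e \<subseteq> S" by (auto simp: mem_interior)
  define d where "d = e / (norm v + 1)"
  have pos: "norm v + 1 > 0" by (simp add: add_nonneg_pos)
  have d: "d > 0" using e pos by (simp add: d_def)
  have "d * norm v < d * (norm v + 1)" using d by simp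
  also have "\<dots> = e" using pos by (simp add: d_def)
  finally have "z + d *\<^sub>R v \<in> S" using e d by (auto simp: dist_norm)
  moreover have "z \<in> S" using e by auto
  ultimately have "A (z + d *\<^sub>R v - x) - A (z - x) = B (z + d *\<^sub>R v - x) - B (z - x)"
    by (simp only: eq)
  then have "A ((z + d *\<^sub>R v - x) - (z - x)) = B ((z + d *\<^sub>R v - x) - (z - x))"
    by (simp only: linear_diff[OF lin(1)] linear_diff[OF lin(2)])
  then have "d *\<^sub>R A v = d *\<^sub>R B v" by (simp add: linear_scale[OF lin(1)] linear_scale[OF lin(2)])
  then show "A v = B v" using d by simp
qed

context
  fixes S :: "'a::euclidean_space set"
  assumes S: "convex S" "interior S \<noteq> {}"
begin

lemma frechet_derivative_within_eq:
  assumes "x \<in> S" "(f has_derivative f') (at x within S)"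
  shows "frechet_derivative f (at x within S) = f'"
proof -
  have "(f has_derivative frechet_derivative f (at x within S)) (at x within S)"
    using assms(2) by (auto simp: frechet_derivative_works[symmetric] differentiable_def)
  from has_derivative_unique_convex[OF S assms(1) this assms(2)] show ?thesis .
qed

text \<open>Questions about derivatives at boundary points of S are moved in this way to an open
  set, where the ordinary calculus is available.\<close>

lemma local_extension_derivative:
  fixes f F :: "'a \<Rightarrow> 'b::euclidean_space"
  assumes U: "open U" "smooth_on U F" "\<forall>y\<in>U \<inter> S. F y = f y" and x: "x \<in> U" "x \<in> S"
  shows "(f has_derivative frechet_derivative F (at x)) (at x within S)"
proof -
  obtain d where d: "d > 0" "ball x d \<subseteq> U" using U x openE by blast
  have "(F has_derivative frechet_derivative F (at x)) (at x within S)"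
    using smooth_on_has_derivative[OF U(1,2) x(1)] by (rule has_derivative_at_withinI)
  then show ?thesis
    by (rule has_derivative_transform_within[OF _ d(1) x(2)])
      (use U d in \<open>auto simp: subset_iff dist_commute\<close>)
qed

lemma smooth_on_has_derivative_within:
  fixes f :: "'a \<Rightarrow> 'b::euclidean_space"
  assumes "smooth_on S f" "x \<in> S"
  shows "(f has_derivative frechet_derivative f (at x within S)) (at x within S)"
proof -
  from assms obtain U F where U: "open U" "x \<in> U" "smooth_on U F" "\<forall>y\<in>U \<inter> S. F y = f y"
    by (rule smooth_on_obtain)
  from local_extension_derivative[OF U(1,3,4,2) assms(2)]
  show ?thesis by (auto simp: frechet_derivative_works[symmetric] differentiable_def)
qed

lemma smooth_on_frechet_derivative_within:
  fixes f :: "'a \<Rightarrow> 'b::euclidean_space"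
  assumes "smooth_on S f"
  shows "smooth_on S (\<lambda>x. frechet_derivative f (at x within S) v)"
proof (rule smooth_onI)
  let ?D = "\<lambda>f y. frechet_derivative f (at y)" and ?DS = "\<lambda>f y. frechet_derivative f (at y within S)"
  fix x assume x: "x \<in> S"
  with assms obtain U F where U: "open U" "x \<in> U" "smooth_on U F" "\<forall>y\<in>U \<inter> S. F y = f y"
    by (rule smooth_on_obtain)
  have "\<forall>y\<in>U \<inter> S. ?D F y v = ?DS f y v"
    by (auto simp: frechet_derivative_within_eq[OF _ local_extension_derivative[OF U(1,3,4)]])
  then show "\<exists>U F. open U \<and> x \<in> U \<and> smooth_on U F \<and>
      (\<forall>y\<in>U \<inter> S. F y = ?DS f y v)"
    using U smooth_on_frechet_derivative[OF U(1,3)] by blast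
qed

text \<open>The derivative of a local extension is a local extension of the derivative within S, so
  the second derivatives agree as well and symmetry is inherited from the open set.\<close>

lemma symmetric_second_derivative_within:
  fixes f :: "'a \<Rightarrow> 'b::euclidean_space"
  assumes f: "smooth_on S f" and x: "x \<in> S"
  shows "frechet_derivative (\<lambda>y. frechet_derivative f (at y within S) v) (at x within S) w
    = frechet_derivative (\<lambda>y. frechet_derivative f (at y within S) w) (at x within S) v"
proof -
  let ?D = "\<lambda>f y. frechet_derivative f (at y)" and ?DS = "\<lambda>f y. frechet_derivative f (at y within S)"
  from f x obtain U F where U: "open U" "x \<in> U" "smooth_on U F" "\<forall>y\<in>U \<inter> S. F y = f y"
    by (rule smooth_on_obtain)
  have 1: "\<forall>y\<in>U \<inter> S. ?D F y v = ?DS f y v" for v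
    by (auto simp: frechet_derivative_within_eq[OF _ local_extension_derivative[OF U(1,3,4)]])
  have "?DS (\<lambda>y. ?DS f y v) x
      = ?D (\<lambda>y. ?D F y v) x" for v
    by (rule frechet_derivative_within_eq[OF x local_extension_derivative[OF U(1)
            smooth_on_frechet_derivative[OF U(1,3)] 1 U(2) x]])
  then show ?thesis using symmetric_second_derivative[OF U(1,3,2)] by simp
qed

text \<open>The primitive is the integral of \<open>\<alpha>\<close> along the segment from the origin.\<close>

lemma poincare_lemma:
  fixes \<alpha> :: "'a \<Rightarrow> 'a \<Rightarrow> real"
  assumes zero: "0 \<in> S"
    and lin: "\<And>p. p \<in> S \<Longrightarrow> linear (\<alpha> p)"
    and smooth: "\<And>v. smooth_on S (\<lambda>p. \<alpha> p v)"
    and closed: "\<And>p v w. p \<in> S \<Longrightarrow> frechet_derivative (\<lambda>q. \<alpha> q v) (at p within S) w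
      = frechet_derivative (\<lambda>q. \<alpha> q w) (at p within S) v"
  shows "\<exists>f. f 0 = 0 \<and> (\<forall>p\<in>S. (f has_derivative \<alpha> p) (at p within S))"
proof -
  define D where "D p v w = frechet_derivative (\<lambda>q. \<alpha> q v) (at p within S) w" for p v w
  have D: "((\<lambda>q. \<alpha> q v) has_derivative D p v) (at p within S)" if "p \<in> S" for p v
    unfolding D_def by (rule smooth_on_has_derivative_within[OF smooth that])
  have Dlin: "linear (D p v)" if "p \<in> S" for p v using D[OF that] has_derivative_linear by blast
  have contD: "continuous_on S (\<lambda>p. D p v w)" for v w
    unfolding D_def by (intro smooth_on_continuous smooth_on_frechet_derivative_within smooth)
  have cont: "continuous_on S (\<lambda>p. \<alpha> p v)" for v by (intro smooth_on_continuous smooth)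
  have ray: "t *\<^sub>R p \<in> S" if "p \<in> S" "t \<in> {0..1}" for p t
    using convexD[OF S(1) zero that(1), of "1 - t" t] that by simp
  have exp: "L w = (\<Sum>b\<in>Basis. (w \<bullet> b) * L b)" if "linear L" for L :: "'a \<Rightarrow> real" and w
  proof -
    have "L (\<Sum>b\<in>Basis. (w \<bullet> b) *\<^sub>R b) = (\<Sum>b\<in>Basis. (w \<bullet> b) * L b)"
      using that by (simp add: linear_sum linear_scale)
    then show ?thesis by (simp only: euclidean_representation)
  qed
  \<comment> \<open>The derivative of the integrand in p. The vector p occurs both as base point and
    as argument, so it is expanded in \<open>Basis\<close> before the product rule is
    applied.\<close>
  define G where "G p t v = t * (\<Sum>b\<in>Basis. (p \<bullet> b) * D (t *\<^sub>R p) b v) + \<alpha> (t *\<^sub>R p) v" for p t v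
  have bl: "bounded_linear (G p t)" if "p \<in> S" "t \<in> {0..1}" for p t
  proof -
    have "linear (G p t)" unfolding G_def[abs_def]
      by (rule linearI)
         (simp_all add: linear_add[OF Dlin[OF ray[OF that]]] linear_add[OF lin[OF ray[OF that]]]
           linear_scale[OF Dlin[OF ray[OF that]]] linear_scale[OF lin[OF ray[OF that]]]
           algebra_simps sum.distrib sum_distrib_left)
    then show ?thesis by (simp add: linear_conv_bounded_linear)
  qed
  \<comment> \<open>Closedness exchanges the two vectors in D. In this form \<open>G p t v\<close>
    is the derivative in t of \<open>t * \<alpha> (t *\<^sub>R p) v\<close>, so its integral over
    [0,1] is \<open>\<alpha> p v\<close>.\<close>
  have G: "G p t v = t * D (t *\<^sub>R p) v p + \<alpha> (t *\<^sub>R p) v" if "p \<in> S" "t \<in> {0..1}" for p t v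
    using ray[OF that] closed[OF ray[OF that]] exp[OF Dlin[OF ray[OF that]], of v p]
    by (simp add: G_def D_def)
  define f where "f p = integral (cbox 0 1) (\<lambda>t. \<alpha> (t *\<^sub>R p) p)" for p
  have contray: "continuous_on {0..1} (\<lambda>t. h (t *\<^sub>R p))" if "continuous_on S h" "p \<in> S" for h :: "'a \<Rightarrow> real" and p
    by (rule continuous_on_compose2[OF that(1)]) (auto intro!: continuous_intros ray that)
  have "(f has_derivative \<alpha> p) (at p within S)" if p: "p \<in> S" for p
  proof -
    have "(f has_derivative integral (cbox 0 1) (\<lambda>t. Blinfun (G p t))) (at p within S)"
      unfolding f_def
    proof (rule leibniz_rule[where fx = "\<lambda>p t. Blinfun (G p t)", OF _ _ _ p S(1)])
      fix q and t :: real assume q: "q \<in> S" and t: "t \<in> cbox 0 1"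
      then have t': "t \<in> {0..1}" by simp
      have "((\<lambda>q. \<Sum>b\<in>Basis. (q \<bullet> b) * \<alpha> (t *\<^sub>R q) b) has_derivative
         (\<lambda>v. \<Sum>b\<in>Basis. (q \<bullet> b) * D (t *\<^sub>R q) b (t *\<^sub>R v) + (v \<bullet> b) * \<alpha> (t *\<^sub>R q) b)) (at q within S)"
      proof (rule has_derivative_sum)
        fix b :: 'a
        have "((\<lambda>q. \<alpha> (t *\<^sub>R q) b) has_derivative (\<lambda>v. D (t *\<^sub>R q) b (t *\<^sub>R v))) (at q within S)"
          by (rule has_derivative_in_compose2[where t = S and g = "\<lambda>q. \<alpha> q b" and f = "\<lambda>q. t *\<^sub>R q"])
            (use q t' ray in \<open>auto intro!: D derivative_eq_intros\<close>)
        then show "((\<lambda>q. (q \<bullet> b) * \<alpha> (t *\<^sub>R q) b) has_derivative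
            (\<lambda>v. (q \<bullet> b) * D (t *\<^sub>R q) b (t *\<^sub>R v) + (v \<bullet> b) * \<alpha> (t *\<^sub>R q) b)) (at q within S)"
          by (intro has_derivative_mult has_derivative_inner_left has_derivative_ident)
      qed
      moreover have "(\<Sum>b\<in>Basis. (q \<bullet> b) * D (t *\<^sub>R q) b (t *\<^sub>R v) + (v \<bullet> b) * \<alpha> (t *\<^sub>R q) b) = G q t v" for v
        unfolding G_def exp[OF lin[OF ray[OF q t']], of v]
        by (simp add: linear_scale[OF Dlin[OF ray[OF q t']]] sum.distrib sum_distrib_left algebra_simps)
      ultimately have "((\<lambda>q. \<Sum>b\<in>Basis. (q \<bullet> b) * \<alpha> (t *\<^sub>R q) b) has_derivative G q t) (at q within S)"
        by simp
      then have "((\<lambda>q. \<alpha> (t *\<^sub>R q) q) has_derivative G q t) (at q within S)"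
        by (rule has_derivative_transform[OF q, rotated]) (rule exp[OF lin[OF ray[OF _ t']]])
      then show "((\<lambda>q. \<alpha> (t *\<^sub>R q) q) has_derivative blinfun_apply (Blinfun (G q t))) (at q within S)"
        by (simp add: bounded_linear_Blinfun_apply[OF bl[OF q t']])
    next
      fix q assume q: "q \<in> S"
      have "continuous_on {0..1} (\<lambda>t. \<alpha> (t *\<^sub>R q) q)" by (rule contray[OF cont q])
      then show "(\<lambda>t. \<alpha> (t *\<^sub>R q) q) integrable_on cbox 0 1"
        by (simp add: integrable_continuous_real)
    next
      show "continuous_on (S \<times> cbox 0 1) (\<lambda>(q, t). Blinfun (G q t))"
      proof (rule continuous_on_blinfun_componentwise)
        fix v :: 'a
        have m: "continuous_on (S \<times> {0..1}) (\<lambda>x. h (snd x *\<^sub>R fst x))" if "continuous_on S h" for h :: "'a \<Rightarrow> real"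
          by (rule continuous_on_compose2[OF that]) (auto intro!: continuous_intros ray)
        have "continuous_on (S \<times> {0..1}) (\<lambda>x. G (fst x) (snd x) v)"
          unfolding G_def by (intro continuous_intros m contD cont)
        then show "continuous_on (S \<times> cbox 0 1) (\<lambda>x. blinfun_apply (case x of (q, t) \<Rightarrow> Blinfun (G q t)) v)"
          unfolding cbox_interval
          by (rule continuous_on_eq) (auto simp: bounded_linear_Blinfun_apply[OF bl])
      qed
    qed
    moreover have "blinfun_apply (integral (cbox 0 1) (\<lambda>t. Blinfun (G p t))) v = \<alpha> p v" for v
    proof -
      have "continuous_on {0..1} (\<lambda>t. Blinfun (G p t))"
      proof (rule continuous_on_blinfun_componentwise)
        fix v :: 'a
        have "continuous_on {0..1} (\<lambda>t. G p t v)"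
          unfolding G_def by (intro continuous_intros contray[OF _ p] contD cont)
        then show "continuous_on {0..1} (\<lambda>t. blinfun_apply (Blinfun (G p t)) v)"
          by (rule continuous_on_eq) (simp add: bounded_linear_Blinfun_apply[OF bl[OF p]])
      qed
      then have "(\<lambda>t. Blinfun (G p t)) integrable_on cbox 0 1"
        by (simp add: integrable_continuous_real)
      then have "blinfun_apply (integral (cbox 0 1) (\<lambda>t. Blinfun (G p t))) v
          = integral (cbox 0 1) (\<lambda>t. blinfun_apply (Blinfun (G p t)) v)"
        by (rule blinfun_apply_integral)
      also have "\<dots> = integral {0..1} (\<lambda>t. t * D (t *\<^sub>R p) v p + \<alpha> (t *\<^sub>R p) v)"
        unfolding cbox_interval
        by (rule integral_cong) (simp add: bounded_linear_Blinfun_apply[OF bl[OF p]] G[OF p])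
      also have "\<dots> = 1 * \<alpha> (1 *\<^sub>R p) v - 0 * \<alpha> (0 *\<^sub>R p) v"
      proof (rule integral_unique, rule fundamental_theorem_of_calculus)
        fix t :: real assume t: "t \<in> {0..1}"
        have "((\<lambda>t. \<alpha> (t *\<^sub>R p) v) has_derivative (\<lambda>h. D (t *\<^sub>R p) v (h *\<^sub>R p))) (at t within {0..1})"
          by (rule has_derivative_in_compose2[where t = S and g = "\<lambda>q. \<alpha> q v" and f = "\<lambda>t. t *\<^sub>R p"])
            (use p t ray in \<open>auto intro!: D derivative_eq_intros\<close>)
        then have "((\<lambda>t. \<alpha> (t *\<^sub>R p) v) has_real_derivative D (t *\<^sub>R p) v p) (at t within {0..1})"
          unfolding has_field_derivative_def
          by (rule has_derivative_eq_rhs) (simp add: fun_eq_iff linear_scale[OF Dlin[OF ray[OF p t]]])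
        then have "((\<lambda>t. t * \<alpha> (t *\<^sub>R p) v) has_real_derivative t * D (t *\<^sub>R p) v p + \<alpha> (t *\<^sub>R p) v) (at t within {0..1})"
          by (auto intro!: derivative_eq_intros)
        then show "((\<lambda>t. t * \<alpha> (t *\<^sub>R p) v) has_vector_derivative t * D (t *\<^sub>R p) v p + \<alpha> (t *\<^sub>R p) v) (at t within {0..1})"
          by (simp add: has_real_derivative_iff_has_vector_derivative)
      qed simp
      finally show ?thesis by simp
    qed
    then have "blinfun_apply (integral (cbox 0 1) (\<lambda>t. Blinfun (G p t))) = \<alpha> p" by (rule ext)
    ultimately show ?thesis by simp
  qed
  moreover have "f 0 = 0" using linear_0[OF lin[OF zero]] by (simp add: f_def)
  ultimately show ?thesis by blast
qed

end

section \<open>Cohomology classes and quotient extensions\<close>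

lemma equiv_cohomologous:
  "equiv (cocycles2 \<Gamma>) (cohomologous \<Gamma> :: ('g \<Rightarrow> 'g \<Rightarrow> 'a::ab_group_add) rel)"
proof (rule equivI)
  show "cohomologous \<Gamma> \<subseteq> cocycles2 \<Gamma> \<times> (cocycles2 \<Gamma> :: ('g \<Rightarrow> 'g \<Rightarrow> 'a) set)"
    by (auto simp: cohomologous_def)
  show "refl_on (cocycles2 \<Gamma>) (cohomologous \<Gamma> :: ('g \<Rightarrow> 'g \<Rightarrow> 'a) rel)"
    by (auto simp: refl_on_def cohomologous_def coboundary1_def intro!: exI[of _ "\<lambda>_. 0"])
  show "sym (cohomologous \<Gamma> :: ('g \<Rightarrow> 'g \<Rightarrow> 'a) rel)"
  proof (rule symI)
    fix s s' :: "'g \<Rightarrow> 'g \<Rightarrow> 'a" assume "(s, s') \<in> cohomologous \<Gamma>"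
    then obtain t where t: "s \<in> cocycles2 \<Gamma>" "s' \<in> cocycles2 \<Gamma>"
      "\<And>g h. g \<in> carrier \<Gamma> \<Longrightarrow> h \<in> carrier \<Gamma> \<Longrightarrow> s' g h - s g h = coboundary1 \<Gamma> t g h"
      by (auto simp: cohomologous_def)
    have "s g h - s' g h = coboundary1 \<Gamma> (\<lambda>x. - t x) g h" if "g \<in> carrier \<Gamma>" "h \<in> carrier \<Gamma>" for g h
      using arg_cong[OF t(3)[OF that], of uminus] by (simp add: coboundary1_def algebra_simps)
    with t show "(s', s) \<in> cohomologous \<Gamma>" unfolding cohomologous_def by blast
  qed
  show "trans (cohomologous \<Gamma> :: ('g \<Rightarrow> 'g \<Rightarrow> 'a) rel)"
  proof (rule transI)
    fix s s' s'' :: "'g \<Rightarrow> 'g \<Rightarrow> 'a"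
    assume "(s, s') \<in> cohomologous \<Gamma>" "(s', s'') \<in> cohomologous \<Gamma>"
    then obtain t t' where t: "s \<in> cocycles2 \<Gamma>" "s'' \<in> cocycles2 \<Gamma>"
      "\<And>g h. g \<in> carrier \<Gamma> \<Longrightarrow> h \<in> carrier \<Gamma> \<Longrightarrow> s' g h - s g h = coboundary1 \<Gamma> t g h"
      "\<And>g h. g \<in> carrier \<Gamma> \<Longrightarrow> h \<in> carrier \<Gamma> \<Longrightarrow> s'' g h - s' g h = coboundary1 \<Gamma> t' g h"
      by (auto simp: cohomologous_def)
    have "s'' g h - s g h = coboundary1 \<Gamma> (\<lambda>x. t x + t' x) g h"
      if "g \<in> carrier \<Gamma>" "h \<in> carrier \<Gamma>" for g h
      using arg_cong2[OF t(3)[OF that] t(4)[OF that], of "(+)"] by (simp add: coboundary1_def algebra_simps)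
    with t show "(s, s'') \<in> cohomologous \<Gamma>" unfolding cohomologous_def by blast
  qed
qed

lemma cohomology_class_eqI:
  assumes "\<sigma> \<in> cocycles2 \<Gamma>" "\<sigma>' \<in> cocycles2 \<Gamma>"
    and "\<And>g h. g \<in> carrier \<Gamma> \<Longrightarrow> h \<in> carrier \<Gamma> \<Longrightarrow> \<sigma>' g h - \<sigma> g h = coboundary1 \<Gamma> \<tau> g h"
  shows "cohomology_class \<Gamma> \<sigma> = cohomology_class \<Gamma> \<sigma>'"
  unfolding cohomology_class_def
  by (rule equiv_class_eq[OF equiv_cohomologous]) (use assms in \<open>auto simp: cohomologous_def\<close>)

text \<open>\<open>H2_map\<close> is a union over all representatives. An additive f carries
  coboundaries to coboundaries, so every representative contributes the same class and the union
  collapses to it.\<close>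

lemma H2_map_cohomology_class:
  fixes f :: "'a::ab_group_add \<Rightarrow> 'b::ab_group_add"
  assumes f: "\<And>x y. f (x + y) = f x + f y" and \<sigma>: "\<sigma> \<in> cocycles2 \<Gamma>"
  shows "H2_map \<Gamma> f (cohomology_class \<Gamma> \<sigma>) = cohomology_class \<Gamma> (\<lambda>g h. f (\<sigma> g h))"
    and "(\<lambda>g h. f (\<sigma> g h)) \<in> cocycles2 \<Gamma>"
proof -
  have zero: "f 0 = 0" using f[of 0 0] by simp
  have diff: "f (x - y) = f x - f y" for x y using f[of "x - y" y] by (simp add: algebra_simps)
  have cocycle: "(\<lambda>g h. f (s g h)) \<in> cocycles2 \<Gamma>" if "s \<in> cocycles2 \<Gamma>" for s
  proof -
    have "f (s h k) - f (s (g \<otimes>\<^bsub>\<Gamma>\<^esub> h) k) + f (s g (h \<otimes>\<^bsub>\<Gamma>\<^esub> k)) - f (s g h) = 0"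
      if "g \<in> carrier \<Gamma>" "h \<in> carrier \<Gamma>" "k \<in> carrier \<Gamma>" for g h k
      unfolding f[symmetric] diff[symmetric] zero[symmetric]
      using \<open>s \<in> cocycles2 \<Gamma>\<close> that by (simp add: cocycles2_def)
    then show ?thesis by (simp add: cocycles2_def)
  qed
  show "(\<lambda>g h. f (\<sigma> g h)) \<in> cocycles2 \<Gamma>" by (rule cocycle[OF \<sigma>])
  have "cohomology_class \<Gamma> (\<lambda>g h. f (s g h)) = cohomology_class \<Gamma> (\<lambda>g h. f (\<sigma> g h))"
    if "s \<in> cohomology_class \<Gamma> \<sigma>" for s
  proof -
    from that obtain t where t: "s \<in> cocycles2 \<Gamma>"
      "\<And>g h. g \<in> carrier \<Gamma> \<Longrightarrow> h \<in> carrier \<Gamma> \<Longrightarrow> s g h - \<sigma> g h = coboundary1 \<Gamma> t g h"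
      by (auto simp: cohomology_class_def cohomologous_def)
    have "cohomology_class \<Gamma> (\<lambda>g h. f (\<sigma> g h)) = cohomology_class \<Gamma> (\<lambda>g h. f (s g h))"
      by (rule cohomology_class_eqI[where \<tau> = "\<lambda>x. f (t x)", OF cocycle[OF \<sigma>] cocycle[OF t(1)]])
        (simp add: diff[symmetric] f[symmetric] t(2) coboundary1_def)
    then show ?thesis by simp
  qed
  moreover have "\<sigma> \<in> cohomology_class \<Gamma> \<sigma>"
    unfolding cohomology_class_def by (rule equiv_class_self[OF equiv_cohomologous \<sigma>])
  ultimately show "H2_map \<Gamma> f (cohomology_class \<Gamma> \<sigma>) = cohomology_class \<Gamma> (\<lambda>g h. f (\<sigma> g h))"
    unfolding H2_map_def by blast
qed

lemma cocycles2_uminus: "\<sigma> \<in> cocycles2 \<Gamma> \<Longrightarrow> (\<lambda>g h. - \<sigma> g h) \<in> cocycles2 \<Gamma>"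
  by (rule H2_map_cohomology_class(2)[where f = uminus]) simp_all

text \<open>In the total group the cocycle identity is the vanishing of the coboundary of a
  coboundary; surjectivity of p transports it to \<Gamma>.\<close>

lemma coboundary_descends_cocycle:
  assumes ext: "central_extension E \<Gamma> i p"
    and \<sigma>: "\<And>g h. g \<in> carrier E \<Longrightarrow> h \<in> carrier E \<Longrightarrow> coboundary1 E \<tau> g h = \<sigma> (p g) (p h)"
  shows "\<sigma> \<in> cocycles2 \<Gamma>"
proof -
  interpret E: group E using ext by (simp add: central_extension_def)
  interpret \<Gamma>: group \<Gamma> using ext by (simp add: central_extension_def)
  have p: "p \<in> hom E \<Gamma>" and surj: "p ` carrier E = carrier \<Gamma>"
    using ext by (auto simp: central_extension_def)
  interpret p: group_hom E \<Gamma> p by unfold_locales (rule p)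
  have "\<sigma> (p g) (p k) - \<sigma> (p f \<otimes>\<^bsub>\<Gamma>\<^esub> p g) (p k) + \<sigma> (p f) (p g \<otimes>\<^bsub>\<Gamma>\<^esub> p k) - \<sigma> (p f) (p g) = 0"
    if "f \<in> carrier E" "g \<in> carrier E" "k \<in> carrier E" for f g k
    using that by (simp add: \<sigma>[symmetric] p.hom_mult[symmetric] coboundary1_def E.m_assoc algebra_simps
        del: p.hom_mult)
  then show ?thesis unfolding cocycles2_def surj[symmetric] by blast
qed

section \<open>Central quotients defined by a partially additive function\<close>

text \<open>An abstract model of the flux extension, with T in the role of the flux extended to all
  of G. Additivity is demanded only when one factor lies in N; on general pairs T may have a defect,
  and this defect is what the Euler class records.\<close>

locale quotient_extension = group_hom G \<Gamma> r for G (structure) and \<Gamma> (structure) and r +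
  fixes T :: "'a \<Rightarrow> 'c::ab_group_add" and N K
  assumes surj: "r ` carrier G = carrier \<Gamma>"
    and N_def: "N = kernel G \<Gamma> r"
    and T_right: "\<And>g n. g \<in> carrier G \<Longrightarrow> n \<in> N \<Longrightarrow> T (g \<otimes> n) = T g + T n"
    and T_left: "\<And>g n. g \<in> carrier G \<Longrightarrow> n \<in> N \<Longrightarrow> T (n \<otimes> g) = T n + T g"
    and T_surj: "T ` N = UNIV"
    and K_def: "K = {n \<in> N. T n = 0}"
begin

lemma N_iff: "n \<in> N \<longleftrightarrow> n \<in> carrier G \<and> r n = \<one>\<^bsub>\<Gamma>\<^esub>"
  by (auto simp: N_def kernel_def)

lemma T_one: "T \<one> = 0"
  using T_right[OF G.one_closed, of "\<one>"] by (simp add: N_iff)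

lemma T_inv: "n \<in> N \<Longrightarrow> T (inv n) = - T n"
  using T_right[of "inv n" n] T_one by (simp add: N_iff eq_neg_iff_add_eq_0)

text \<open>Left additivity computes T of
  \<open>(g \<otimes> k \<otimes> inv g) \<otimes> g\<close>, right additivity T of
  \<open>g \<otimes> k\<close>. These are the same element, so the conjugate of k has the same T as
  k.\<close>

lemma normal_K: "K \<lhd> G"
  unfolding G.normal_inv_iff
proof (intro conjI ballI)
  show "subgroup K G"
  proof
    show "K \<subseteq> carrier G" by (auto simp: K_def N_iff)
    show "\<one> \<in> K" by (simp add: K_def T_one N_iff)
    show "x \<otimes> y \<in> K" if "x \<in> K" "y \<in> K" for x y
      using that T_right[of x y] by (simp add: K_def N_iff)
    show "inv x \<in> K" if "x \<in> K" for x
      using that T_inv[of x] by (simp add: K_def N_iff)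
  qed
  fix g k assume g: "g \<in> carrier G" and k: "k \<in> K"
  have n: "k \<in> carrier G" "r k = \<one>\<^bsub>\<Gamma>\<^esub>" "T k = 0" using k by (auto simp: K_def N_iff)
  have m: "g \<otimes> k \<otimes> inv g \<in> N" using g n by (simp add: N_iff)
  have "T (g \<otimes> k \<otimes> inv g) + T g = T (g \<otimes> k)"
    using T_left[OF g m] g n by (simp add: G.m_assoc)
  also have "\<dots> = T g" using T_right[OF g, of k] n by (simp add: N_iff)
  finally show "g \<otimes> k \<otimes> inv g \<in> K" using m by (simp add: K_def)
qed

text \<open>Since a coset is determined by its common values of r and T, both maps descend to the
  quotient, and identities between cosets reduce to comparing these two values.\<close>

lemma coset_eq:
  assumes g: "g \<in> carrier G"
  shows "K #> g = {x \<in> carrier G. r x = r g \<and> T x = T g}"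
proof (intro equalityI subsetI)
  fix x assume "x \<in> K #> g"
  then obtain k where k: "k \<in> K" "x = k \<otimes> g" unfolding r_coset_def by blast
  have n: "k \<in> N" "k \<in> carrier G" "r k = \<one>\<^bsub>\<Gamma>\<^esub>" "T k = 0" using k(1) by (auto simp: K_def N_iff)
  have "T (k \<otimes> g) = T g" using T_left[OF g n(1)] n(4) by simp
  then show "x \<in> {x \<in> carrier G. r x = r g \<and> T x = T g}"
    unfolding k(2) using g n(2,3) by simp
next
  fix x assume x: "x \<in> {x \<in> carrier G. r x = r g \<and> T x = T g}"
  have n: "x \<otimes> inv g \<in> N" using x g by (simp add: N_iff)
  have "T x = T (x \<otimes> inv g) + T g" using T_left[OF g n] x g by (simp add: G.m_assoc)
  then have "x \<otimes> inv g \<in> K" using n x by (simp add: K_def)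
  moreover have "x = (x \<otimes> inv g) \<otimes> g" using x g by (simp add: G.m_assoc)
  ultimately show "x \<in> K #> g" unfolding r_coset_def by blast
qed

lemma coset_cong:
  "g \<in> carrier G \<Longrightarrow> h \<in> carrier G \<Longrightarrow> r g = r h \<Longrightarrow> T g = T h \<Longrightarrow> K #> g = K #> h"
  by (simp add: coset_eq)

lemma coset_values:
  assumes "g \<in> carrier G"
  shows "the_elem (r ` (K #> g)) = r g" "the_elem (T ` (K #> g)) = T g"
proof -
  have "r ` (K #> g) = {r g}" "T ` (K #> g) = {T g}"
    using assms by (auto simp: coset_eq)
  then show "the_elem (r ` (K #> g)) = r g" "the_elem (T ` (K #> g)) = T g" by simp_all
qed

text \<open>A fibre of T inside N. By \<open>incl_coset\<close> it is a single coset of K, hence an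
  element of the quotient group.\<close>

definition incl :: "'c \<Rightarrow> 'a set" where "incl a = {n \<in> N. T n = a}"

lemma incl_coset: "n \<in> N \<Longrightarrow> incl (T n) = K #> n"
  by (auto simp: incl_def coset_eq N_iff)

lemma obtain_N: obtains n where "n \<in> N" "T n = a"
  using T_surj by (metis UNIV_I imageE)

lemma carrier_quotient: "carrier (G Mod K) = (\<lambda>g. K #> g) ` carrier G"
  by (auto simp: FactGroup_def RCOSETS_def)

lemma mult_quotient:
  "g \<in> carrier G \<Longrightarrow> h \<in> carrier G \<Longrightarrow> (K #> g) <#> (K #> h) = K #> (g \<otimes> h)"
  by (rule normal.rcos_sum[OF normal_K])

lemma central_extension_quotient:
  "central_extension (G Mod K) \<Gamma> incl (\<lambda>X. the_elem (r ` X))"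
  unfolding central_extension_def
proof (intro conjI allI ballI)
  show "group (G Mod K)" by (rule normal.factorgroup_is_group[OF normal_K])
  show "group \<Gamma>" ..
  show "inj incl"
  proof (rule injI)
    fix a b assume *: "incl a = incl b"
    obtain n where "n \<in> N" "T n = a" by (rule obtain_N)
    then have "n \<in> incl b" using * by (auto simp: incl_def)
    then show "a = b" using \<open>T n = a\<close> by (simp add: incl_def)
  qed
  show "incl a \<in> carrier (G Mod K)" for a
  proof -
    obtain n where "n \<in> N" "T n = a" by (rule obtain_N)
    then show ?thesis using incl_coset[of n] by (auto simp: carrier_quotient N_iff)
  qed
  show "incl (a + b) = incl a \<otimes>\<^bsub>G Mod K\<^esub> incl b" for a b
  proof -
    obtain n where n: "n \<in> N" "T n = a" by (rule obtain_N)
    obtain m where m: "m \<in> N" "T m = b" by (rule obtain_N)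
    have "n \<otimes> m \<in> N" "T (n \<otimes> m) = a + b" using n m T_right[of n m] by (auto simp: N_iff)
    then show ?thesis
      using incl_coset[of "n \<otimes> m"] incl_coset[of n] incl_coset[of m] n m by (simp add: mult_quotient N_iff)
  qed
  show "X \<otimes>\<^bsub>G Mod K\<^esub> incl a = incl a \<otimes>\<^bsub>G Mod K\<^esub> X" if "X \<in> carrier (G Mod K)" for X a
  proof -
    obtain n where n: "n \<in> N" "T n = a" by (rule obtain_N)
    from that obtain g where g: "g \<in> carrier G" "X = K #> g" by (auto simp: carrier_quotient)
    \<comment> \<open>Centrality: both products have the same r, since \<open>r n\<close> is
      trivial, and the same T, since addition commutes.\<close>
    have "K #> (g \<otimes> n) = K #> (n \<otimes> g)"
      using n g T_left[of g n] T_right[of g n] by (intro coset_cong) (auto simp: N_iff algebra_simps)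
    then show ?thesis using g n incl_coset[of n] by (simp add: mult_quotient N_iff)
  qed
  show "(\<lambda>X. the_elem (r ` X)) \<in> hom (G Mod K) \<Gamma>"
    by (rule homI) (auto simp: carrier_quotient mult_quotient coset_values)
  show "(\<lambda>X. the_elem (r ` X)) ` carrier (G Mod K) = carrier \<Gamma>"
    unfolding surj[symmetric] by (simp add: carrier_quotient image_image coset_values)
  show "kernel (G Mod K) \<Gamma> (\<lambda>X. the_elem (r ` X)) = range incl"
  proof (intro equalityI subsetI)
    fix X assume "X \<in> kernel (G Mod K) \<Gamma> (\<lambda>X. the_elem (r ` X))"
    then obtain g where g: "g \<in> carrier G" "X = K #> g" "r g = \<one>\<^bsub>\<Gamma>\<^esub>"
      by (auto simp: kernel_def carrier_quotient coset_values)
    then show "X \<in> range incl" using incl_coset[of g] by (metis N_iff rangeI)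
  next
    fix X assume "X \<in> range incl"
    then obtain a where "X = incl a" by blast
    moreover obtain n where "n \<in> N" "T n = a" by (rule obtain_N)
    ultimately show "X \<in> kernel (G Mod K) \<Gamma> (\<lambda>X. the_elem (r ` X))"
      using incl_coset[of n] by (auto simp: kernel_def carrier_quotient coset_values N_iff)
  qed
qed

lemma connection_cochain_quotient:
  "connection_cochain (G Mod K) incl (\<lambda>X. the_elem (T ` X))"
  unfolding connection_cochain_def
proof (intro ballI allI)
  fix X a assume "X \<in> carrier (G Mod K)"
  then obtain g where g: "g \<in> carrier G" "X = K #> g" by (auto simp: carrier_quotient)
  obtain n where n: "n \<in> N" "T n = a" by (rule obtain_N)
  then show "the_elem (T ` (X \<otimes>\<^bsub>G Mod K\<^esub> incl a)) = the_elem (T ` X) + a"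
    using g incl_coset[of n] T_right[of g n] by (auto simp: mult_quotient coset_values N_iff)
qed

text \<open>Brings \<open>incl\<close> into the form in which \<open>flux_incl\<close> is defined:
  the cosets of K in N are the fibres of T, and T takes a single value on each.\<close>

lemma incl_eq_inv_into:
  "inv_into (carrier (G\<lparr>carrier := N\<rparr> Mod K)) (\<lambda>X. the_elem (T ` X)) = incl"
proof
  fix a
  have car: "carrier (G\<lparr>carrier := N\<rparr> Mod K) = range incl"
  proof -
    have "carrier (G\<lparr>carrier := N\<rparr> Mod K) = (\<lambda>n. incl (T n)) ` N"
      by (auto simp: FactGroup_def RCOSETS_def incl_coset)
    also have "\<dots> = incl ` (T ` N)" by (rule image_image[symmetric])
    finally show ?thesis by (simp add: T_surj)
  qed
  have val: "the_elem (T ` incl b) = b" for b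
  proof -
    obtain n where "n \<in> N" "T n = b" by (rule obtain_N)
    then have "T ` incl b = {b}" by (auto simp: incl_def)
    then show ?thesis by simp
  qed
  show "inv_into (carrier (G\<lparr>carrier := N\<rparr> Mod K)) (\<lambda>X. the_elem (T ` X)) a = incl a"
    unfolding car by (rule inv_into_f_eq) (auto simp: val inj_on_def)
qed

end

section \<open>Groups of diffeomorphisms\<close>

lemma BijGroup_mult: "f \<in> Bij S \<Longrightarrow> g \<in> Bij S \<Longrightarrow> f \<otimes>\<^bsub>BijGroup S\<^esub> g = compose S f g"
  by (simp add: BijGroup_def)

lemma Diff_id: "(\<lambda>x\<in>M. x) \<in> Diff M"
proof -
  have "inv_into M (\<lambda>x\<in>M. x) x = x" if "x \<in> M" for x
    using that by (intro inv_into_f_eq) (auto simp: inj_on_def)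
  then show ?thesis
    by (auto simp: Diff_def id_Bij smooth_on_id cong: smooth_on_cong)
qed

lemma Diff_imp_Bij: "f \<in> Diff M \<Longrightarrow> f \<in> Bij M"
  by (simp add: Diff_def)

lemma Bij_apply: "f \<in> Bij M \<Longrightarrow> x \<in> M \<Longrightarrow> f x \<in> M"
  using Bij_imp_funcset by blast

lemma Bij_inv_into:
  assumes "f \<in> Bij M" "x \<in> M"
  shows "inv_into M f x \<in> M" "f (inv_into M f x) = x" "inv_into M f (f x) = x"
  using assms by (auto simp: Bij_def bij_betw_def f_inv_into_f inv_into_into)

lemma inv_into_restrict_inv_into:
  assumes "f \<in> Bij M" "x \<in> M"
  shows "inv_into M (\<lambda>x\<in>M. inv_into M f x) x = f x"
proof (rule inv_into_f_eq)
  show "inj_on (\<lambda>x\<in>M. inv_into M f x) M"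
    using restrict_inv_into_Bij[OF assms(1)] by (simp add: Bij_def bij_betw_def)
qed (use assms Bij_apply[OF assms] Bij_inv_into(3)[OF assms] in auto)

lemma inv_into_compose_Bij:
  assumes "f \<in> Bij M" "g \<in> Bij M" "x \<in> M"
  shows "inv_into M (compose M f g) x = inv_into M g (inv_into M f x)"
proof (rule inv_into_f_eq)
  show "inj_on (compose M f g) M" using compose_Bij[OF assms(1,2)] by (simp add: Bij_def bij_betw_def)
qed (use assms in \<open>auto simp: compose_def Bij_inv_into\<close>)

lemma Diff_inv:
  assumes "f \<in> Diff M"
  shows "(\<lambda>x\<in>M. inv_into M f x) \<in> Diff M"
  using assms by (auto simp: Diff_def restrict_inv_into_Bij inv_into_restrict_inv_into cong: smooth_on_cong)

lemma Diff_compose: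
  assumes "f \<in> Diff M" "g \<in> Diff M"
  shows "compose M f g \<in> Diff M"
proof -
  have B: "f \<in> Bij M" "g \<in> Bij M" using assms by (auto simp: Diff_def)
  have "smooth_on M (\<lambda>x. f (g x))"
    by (rule smooth_on_compose[where N = M]) (use assms B in \<open>auto simp: Diff_def Bij_apply\<close>)
  moreover have "smooth_on M (\<lambda>x. inv_into M g (inv_into M f x))"
    by (rule smooth_on_compose[where N = M]) (use assms B in \<open>auto simp: Diff_def Bij_inv_into\<close>)
  ultimately show ?thesis
    using compose_Bij[OF B] by (simp add: Diff_def inv_into_compose_Bij[OF B] compose_eq cong: smooth_on_cong)
qed

text \<open>One subgroup criterion serves the covering group, the circle diffeomorphisms and the
  area-preserving disk maps, each cut out of \<open>Diff M\<close> by a property P.\<close>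

lemma group_Diff:
  assumes "P (\<lambda>x\<in>M. x)"
    and "\<And>f g. f \<in> Diff M \<Longrightarrow> g \<in> Diff M \<Longrightarrow> P f \<Longrightarrow> P g \<Longrightarrow> P (compose M f g)"
    and "\<And>f. f \<in> Diff M \<Longrightarrow> P f \<Longrightarrow> P (\<lambda>x\<in>M. inv_into M f x)"
  shows "group (BijGroup M\<lparr>carrier := {f \<in> Diff M. P f}\<rparr>)"
proof -
  interpret group "BijGroup M" by (rule group_BijGroup)
  have "subgroup {f \<in> Diff M. P f} (BijGroup M)"
  proof
    show "{f \<in> Diff M. P f} \<subseteq> carrier (BijGroup M)" by (auto simp: Diff_def BijGroup_def)
    show "\<one>\<^bsub>BijGroup M\<^esub> \<in> {f \<in> Diff M. P f}" using assms(1) Diff_id by (simp add: BijGroup_def)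
    show "f \<otimes>\<^bsub>BijGroup M\<^esub> g \<in> {f \<in> Diff M. P f}" if "f \<in> {f \<in> Diff M. P f}" "g \<in> {f \<in> Diff M. P f}" for f g
      using that assms(2) by (simp add: BijGroup_mult Diff_imp_Bij Diff_compose)
    show "inv\<^bsub>BijGroup M\<^esub> f \<in> {f \<in> Diff M. P f}" if "f \<in> {f \<in> Diff M. P f}" for f
      using that assms(3) by (simp add: inv_BijGroup Diff_imp_Bij Diff_inv)
  qed
  then show ?thesis by (rule subgroup_imp_group)
qed

section \<open>Lifts of circle diffeomorphisms\<close>

lemma cis_eq_cis_iff: "cis a = cis b \<longleftrightarrow> (\<exists>n::int. a = b + 2 * pi * of_int n)"
  using sin_cos_eq_iff[of a b] by (auto simp: complex_eq_iff)

lemma shift_by_period: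
  assumes "\<And>x. f (x + 2 * pi) = f x + (c::real)"
  shows "f (x + 2 * pi * of_int n) = f x + c * of_int n"
proof (induction n rule: int_induct[where k = 0])
  case (step1 i)
  then show ?case using assms[of "x + 2 * pi * of_int i"] by (simp add: algebra_simps)
next
  case (step2 i)
  then show ?case using assms[of "x + 2 * pi * of_int (i - 1)"] by (simp add: algebra_simps)
qed auto

text \<open>Frees expressions in an angle from the choice of that angle; in particular
  \<open>Arg\<close> may be replaced by any other branch inside a periodic function.\<close>

lemma periodic_cis_cong:
  assumes "\<And>x. f (x + 2 * pi) = f x" "cis a = cis b"
  shows "f a = (f b :: 'a)"
proof -
  have "f (x + 2 * pi * of_int n) = f x" for x n
  proof (induction n rule: int_induct[where k = 0])
    case (step1 i)
    then show ?case using assms(1)[of "x + 2 * pi * of_int i"] by (simp add: algebra_simps)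
  next
    case (step2 i)
    then show ?case using assms(1)[of "x + 2 * pi * of_int (i - 1)"] by (simp add: algebra_simps)
  qed auto
  with assms(2) show ?thesis by (auto simp: cis_eq_cis_iff)
qed

lemma circle_cis: "z \<in> circle \<Longrightarrow> cis (Arg z) = z"
  by (subst cis_Arg) (auto simp: sgn_div_norm)

text \<open>\<open>Arg\<close> jumps across the negative real axis, but a periodic f does not see
  the jump. Around z0 the branch \<open>Im (Ln (z / z0)) + Arg z0\<close> is smooth, because z / z0
  stays in the right half plane.\<close>

lemma periodic_Arg_local:
  assumes per: "\<And>x. f (x + 2 * pi) = f x" and "z0 \<noteq> 0" "Re (z / z0) > 0"
  shows "f (Im (Ln (z / z0)) + Arg z0) = f (Arg z)"
proof (rule periodic_cis_cong[of f, OF per])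
  have nz: "z \<noteq> 0" "z / z0 \<noteq> 0" using assms by auto
  have "cis (Im (Ln (z / z0))) = sgn (z / z0)"
    using nz Arg_eq_Im_Ln cis_Arg by metis
  then show "cis (Im (Ln (z / z0)) + Arg z0) = cis (Arg z)"
    using nz assms(2) by (simp add: cis_mult[symmetric] cis_Arg sgn_div_norm norm_divide field_simps scaleR_conv_of_real)
qed

lemma smooth_on_periodic_Arg:
  fixes f :: "real \<Rightarrow> 'a::euclidean_space"
  assumes f: "smooth_on UNIV f" and per: "\<And>x. f (x + 2 * pi) = f x"
  shows "smooth_on (- {0}) (\<lambda>z. f (Arg z))"
proof (rule smooth_onI)
  fix z0 :: complex assume "z0 \<in> - {0}"
  then have z0: "z0 \<noteq> 0" by simp
  define U where "U = {z. Re (z / z0) > 0}"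
  have "open U" unfolding U_def using z0 by (intro open_Collect_less continuous_intros) auto
  moreover have "z0 \<in> U" using z0 by (simp add: U_def)
  moreover have "smooth_on U (\<lambda>z. f (Im (Ln (z / z0)) + Arg z0))"
  proof (rule smooth_on_compose[OF f])
    show "smooth_on U (\<lambda>z. Im (Ln (z / z0)) + Arg z0)"
      by (intro smooth_on_add smooth_on_const smooth_on_Im smooth_on_Ln smooth_on_divide smooth_on_id)
        (use z0 in \<open>auto simp: U_def complex_nonpos_Reals_iff\<close>)
  qed auto
  ultimately show "\<exists>U F. open U \<and> z0 \<in> U \<and> smooth_on U F \<and> (\<forall>z\<in>U \<inter> - {0}. F z = f (Arg z))"
    using periodic_Arg_local[where f = f, OF per z0]
    by (intro exI[of _ U] exI[of _ "\<lambda>z. f (Im (Ln (z / z0)) + Arg z0)"]) (auto simp: U_def)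
qed

lemma has_derivative_periodic_Arg:
  fixes f :: "real \<Rightarrow> real"
  assumes f: "(f has_real_derivative D) (at (Arg z))" and per: "\<And>x. f (x + 2 * pi) = f x" and z: "z \<noteq> 0"
  shows "((\<lambda>z. f (Arg z)) has_derivative (\<lambda>v. D * Im (v / z))) (at z)"
proof -
  define U where "U = {w. Re (w / z) > 0}"
  have U: "open U" unfolding U_def using z by (intro open_Collect_less continuous_intros) auto
  have zU: "z \<in> U" using z by (simp add: U_def)
  have "((\<lambda>w. Ln (w / z)) has_field_derivative (1 / z)) (at z)"
    using z by (auto intro!: derivative_eq_intros simp: complex_nonpos_Reals_iff)
  then have "((\<lambda>w. Ln (w / z)) has_derivative (\<lambda>v. (1 / z) * v)) (at z)"
    unfolding has_field_derivative_def .
  then have 1: "((\<lambda>w. Im (Ln (w / z)) + Arg z) has_derivative (\<lambda>v. Im (v / z))) (at z)"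
    using has_derivative_add_const[OF has_derivative_Im] by (simp add: add.commute)
  have 2: "(f has_derivative (*) D) (at (Im (Ln (z / z)) + Arg z))"
    using f z by (simp add: has_field_derivative_def)
  have "((\<lambda>w. f (Im (Ln (w / z)) + Arg z)) has_derivative (\<lambda>v. D * Im (v / z))) (at z)"
    by (rule has_derivative_compose[OF 1 2])
  then show ?thesis
    by (rule has_derivative_transform_within_open[OF _ U zU])
      (use periodic_Arg_local[where f = f, OF per z] in \<open>auto simp: U_def\<close>)
qed

lemma smooth_on_deriv:
  fixes f :: "real \<Rightarrow> real"
  assumes "smooth_on UNIV f"
  shows "(f has_real_derivative deriv f x) (at x)" "smooth_on UNIV (deriv f)"
proof -
  have D: "(f has_real_derivative frechet_derivative f (at x) 1) (at x)" for x
  proof -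
    note d = smooth_on_has_derivative[OF open_UNIV assms, of x]
    have "frechet_derivative f (at x) v = frechet_derivative f (at x) 1 * v" for v
      using linear_scale[OF has_derivative_linear[OF d[simplified]], of v 1] by simp
    then show ?thesis
      unfolding has_field_derivative_def by (intro has_derivative_eq_rhs[OF d[simplified]] ext)
  qed
  then have eq: "deriv f = (\<lambda>x. frechet_derivative f (at x) 1)" by (auto intro: DERIV_imp_deriv)
  show "(f has_real_derivative deriv f x) (at x)" using D by (simp add: eq)
  show "smooth_on UNIV (deriv f)" unfolding eq by (rule smooth_on_frechet_derivative[OF open_UNIV assms])
qed

text \<open>A continuous logarithm of h exists because the line is contractible, and its imaginary
  part is an angle function. Smoothness is local: as long as the angle differs from its value at t0
  by less than pi, the principal logarithm of h t / h t0 recovers it.\<close>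

lemma smooth_lift:
  fixes h :: "real \<Rightarrow> complex"
  assumes h: "smooth_on UNIV h" and norm: "\<And>t. norm (h t) = 1"
  shows "\<exists>\<phi>. smooth_on UNIV \<phi> \<and> (\<forall>t. h t = cis (\<phi> t))"
proof -
  have nz: "h t \<noteq> 0" for t using norm[of t] by auto
  obtain g where g: "continuous_on UNIV g" "\<And>t. h t = exp (g t)"
    using continuous_logarithm_on_contractible[of UNIV h] smooth_on_continuous[OF h] nz
      convex_imp_contractible[OF convex_UNIV] by auto
  define \<phi> where "\<phi> t = Im (g t)" for t
  have h\<phi>: "h t = cis (\<phi> t)" for t
  proof -
    have "exp (Re (g t)) = 1" using norm[of t] unfolding g(2) norm_exp_eq_Re .
    then show ?thesis unfolding g(2) exp_eq_polar[of "g t"] by (simp add: \<phi>_def)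
  qed
  have cont: "continuous_on UNIV \<phi>" unfolding \<phi>_def using g(1) by (intro continuous_intros)
  have "smooth_on UNIV \<phi>"
  proof (rule smooth_onI)
    fix t0
    define U where "U = {t. \<bar>\<phi> t - \<phi> t0\<bar> < pi}"
    have U: "open U" unfolding U_def by (intro open_Collect_less continuous_intros cont)
    have ln: "Ln (h t / h t0) = (\<phi> t - \<phi> t0) * \<i>" and np: "h t / h t0 \<notin> \<real>\<^sub>\<le>\<^sub>0" if "t \<in> U" for t
    proof -
      have b: "- pi < \<phi> t - \<phi> t0" "\<phi> t - \<phi> t0 < pi" using that by (auto simp: U_def)
      show ln: "Ln (h t / h t0) = (\<phi> t - \<phi> t0) * \<i>"
        unfolding h\<phi> cis_divide by (rule Ln_cis) (use b in auto)
      show "h t / h t0 \<notin> \<real>\<^sub>\<le>\<^sub>0"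
      proof
        assume "h t / h t0 \<in> \<real>\<^sub>\<le>\<^sub>0"
        then have "cos (\<phi> t - \<phi> t0) \<le> 0" "sin (\<phi> t - \<phi> t0) = 0"
          by (simp_all add: h\<phi> cis_divide complex_nonpos_Reals_iff)
        then show False using sin_zero_pi_iff[of "\<phi> t - \<phi> t0"] b by simp
      qed
    qed
    have "smooth_on U (\<lambda>t. Im (Ln (h t / h t0)) + \<phi> t0)"
      by (intro smooth_on_add smooth_on_const smooth_on_Im smooth_on_Ln smooth_on_divide
          smooth_on_subset[OF h] nz np) auto
    then show "\<exists>U F. open U \<and> t0 \<in> U \<and> smooth_on U F \<and> (\<forall>t\<in>U \<inter> UNIV. F t = \<phi> t)"
      using U by (intro exI[of _ U] exI[of _ "\<lambda>t. Im (Ln (h t / h t0)) + \<phi> t0"]) (auto simp: ln, auto simp: U_def)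
  qed
  with h\<phi> show ?thesis by blast
qed

lemma cis_has_vector_derivative:
  assumes "(\<phi> has_real_derivative D) (at t)"
  shows "((\<lambda>s. cis (\<phi> s)) has_vector_derivative D *\<^sub>R (\<i> * cis (\<phi> t))) (at t)"
proof -
  have "((\<lambda>s. \<i> * of_real (\<phi> s)) has_vector_derivative \<i> * of_real D) (at t)"
    using assms by (auto intro!: derivative_eq_intros simp: has_real_derivative_iff_has_vector_derivative)
  from field_vector_diff_chain_at[OF this DERIV_exp]
  show ?thesis by (simp add: cis_conv_exp o_def scaleR_conv_of_real mult_ac)
qed

text \<open>Uniqueness of the derivative forces the scalar c to be the derivative of the lift, so
  orientation can be read off from any smooth lift.\<close>

lemma orientation_iff:
  assumes "smooth_on UNIV \<phi>" "\<And>t. \<mu> (cis t) = cis (\<phi> t)"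
  shows "(\<exists>c>0. ((\<lambda>s. \<mu> (cis s)) has_vector_derivative c *\<^sub>R (\<i> * \<mu> (cis t))) (at t)) \<longleftrightarrow> deriv \<phi> t > 0"
proof -
  have D: "((\<lambda>s. \<mu> (cis s)) has_vector_derivative deriv \<phi> t *\<^sub>R (\<i> * \<mu> (cis t))) (at t)"
    unfolding assms(2) by (rule cis_has_vector_derivative[OF smooth_on_deriv(1)[OF assms(1)]])
  have "c = deriv \<phi> t" if "((\<lambda>s. \<mu> (cis s)) has_vector_derivative c *\<^sub>R (\<i> * \<mu> (cis t))) (at t)" for c
    using vector_derivative_unique_at[OF that D] by (simp add: assms(2))
  with D show ?thesis by blast
qed

section \<open>The covering group and its projection to the circle diffeomorphisms\<close>

lemma carrier_cover:
  "\<phi> \<in> carrier diff_circle_cover \<longleftrightarrow>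
    \<phi> \<in> Diff UNIV \<and> (\<forall>x. deriv \<phi> x > 0) \<and> (\<forall>x. \<phi> (x + 2 * pi) = \<phi> x + 2 * pi)"
  by (simp add: diff_circle_cover_def)

lemma strict_mono_deriv_pos:
  fixes \<phi> :: "real \<Rightarrow> real"
  assumes "smooth_on UNIV \<phi>" "\<And>x. deriv \<phi> x > 0"
  shows "strict_mono \<phi>"
  by (rule strict_monoI) (use DERIV_pos_imp_increasing smooth_on_deriv(1)[OF assms(1)] assms(2) in metis)

lemma deriv_inverse_pos:
  fixes \<phi> \<psi> :: "real \<Rightarrow> real"
  assumes "smooth_on UNIV \<phi>" "smooth_on UNIV \<psi>" "\<And>t. deriv \<phi> t > 0" "\<And>t. \<phi> (\<psi> t) = t"
  shows "deriv \<psi> t > 0"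
proof -
  have "((\<lambda>t. \<phi> (\<psi> t)) has_real_derivative deriv \<phi> (\<psi> t) * deriv \<psi> t) (at t)"
    by (rule DERIV_chain2[OF smooth_on_deriv(1)[OF assms(1)] smooth_on_deriv(1)[OF assms(2)]])
  then have "deriv \<phi> (\<psi> t) * deriv \<psi> t = 1"
    using DERIV_unique DERIV_ident by (metis (no_types, lifting) assms(4) ext)
  then show ?thesis using assms(3)[of "\<psi> t"] by (metis zero_less_mult_pos zero_less_one)
qed

lemma cover_bij:
  assumes sm: "smooth_on UNIV \<phi>" and pos: "\<And>x. deriv \<phi> x > 0" and per: "\<And>x. \<phi> (x + 2 * pi) = \<phi> x + 2 * pi"
  shows "bij \<phi>"
proof -
  have "\<exists>x. \<phi> x = y" for y
  proof -
    \<comment> \<open>Enough whole periods on either side of 0 for the values of \<phi> to enclose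
      y.\<close>
    define n where "n = \<lceil>\<bar>y - \<phi> 0\<bar> / (2 * pi)\<rceil>"
    have n: "\<bar>y - \<phi> 0\<bar> \<le> 2 * pi * of_int n"
      using mult_right_mono[OF le_of_int_ceiling[of "\<bar>y - \<phi> 0\<bar> / (2 * pi)"], of "2 * pi"]
      by (simp add: n_def mult.commute)
    have "\<phi> (0 + 2 * pi * of_int (- n)) \<le> y" "y \<le> \<phi> (0 + 2 * pi * of_int n)"
      using n unfolding shift_by_period[of \<phi> "2 * pi", OF per] by auto
    then have *: "\<phi> (2 * pi * of_int (- n)) \<le> y" "y \<le> \<phi> (2 * pi * of_int n)" by simp_all
    have "0 \<le> 2 * pi * of_int n" using n by linarith
    then have "2 * pi * of_int (- n) \<le> 2 * pi * of_int n" by simp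
    from IVT'[OF *(1,2) this] smooth_on_continuous[OF sm] show ?thesis
      by (meson continuous_on_subset subset_UNIV)
  qed
  then show ?thesis
    using strict_mono_deriv_pos[OF sm pos] by (metis bijI strict_mono_imp_inj_on surjI)
qed

text \<open>Bijectivity and smoothness of the inverse, which membership in \<open>Diff\<close> asks
  for, are consequences: equivariance makes \<phi> unbounded in both directions, and the positive
  derivative makes it smoothly invertible.\<close>

lemma cover_memI:
  assumes sm: "smooth_on UNIV \<phi>" and pos: "\<And>x. deriv \<phi> x > 0" and per: "\<And>x. \<phi> (x + 2 * pi) = \<phi> x + 2 * pi"
  shows "\<phi> \<in> carrier diff_circle_cover"
proof -
  have b: "bij \<phi>" by (rule cover_bij[OF assms])
  have "smooth_on UNIV (inv_into UNIV \<phi>)"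
  proof (rule smooth_on_inverse_function[where f = \<phi> and f' = "\<lambda>x v. deriv \<phi> x * v" and A = "\<lambda>x v. inverse (deriv \<phi> x) * v"])
    show "(\<phi> has_derivative (\<lambda>v. deriv \<phi> x * v)) (at x)" for x
      using smooth_on_deriv(1)[OF sm, of x] by (simp add: has_field_derivative_def)
    show "smooth_on UNIV (\<lambda>x. inverse (deriv \<phi> x) * v)" for v
      using pos by (intro smooth_on_mult smooth_on_const smooth_on_inverse smooth_on_deriv(2)[OF sm]) (metis less_irrefl)
    show "deriv \<phi> x * (inverse (deriv \<phi> x) * v) = v" for x v using pos[of x] by simp
  qed (use b in \<open>auto simp: bij_is_inj bij_is_surj surj_f_inv_f bounded_linear_mult_right\<close>)
  then show ?thesis using b sm pos per by (simp add: carrier_cover Diff_def Bij_def)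
qed

lemma cover_smooth: "\<phi> \<in> carrier diff_circle_cover \<Longrightarrow> smooth_on UNIV \<phi>"
  by (simp add: carrier_cover Diff_def)

lemma cover_period: "\<phi> \<in> carrier diff_circle_cover \<Longrightarrow> \<phi> (x + 2 * pi) = \<phi> x + 2 * pi"
  by (simp add: carrier_cover)

lemma deriv_cover_period:
  assumes "\<phi> \<in> carrier diff_circle_cover"
  shows "deriv \<phi> (t + 2 * pi) = deriv \<phi> t"
proof -
  note D = smooth_on_deriv(1)[OF cover_smooth[OF assms]]
  have "((\<lambda>t. \<phi> (t + 2 * pi)) has_real_derivative deriv \<phi> (t + 2 * pi)) (at t)"
    using D[of "t + 2 * pi"] by (simp add: DERIV_shift)
  moreover have "((\<lambda>t. \<phi> (t + 2 * pi)) has_real_derivative deriv \<phi> t) (at t)"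
    unfolding cover_period[OF assms] using DERIV_add[OF D[of t] DERIV_const[of "2 * pi"]] by simp
  ultimately show ?thesis by (rule DERIV_unique)
qed

lemma cover_period_int: "\<phi> \<in> carrier diff_circle_cover \<Longrightarrow> \<phi> (x + 2 * pi * of_int n) = \<phi> x + 2 * pi * of_int n"
  using shift_by_period[of \<phi> "2 * pi"] cover_period by blast

lemma cover_Bij: "\<phi> \<in> carrier diff_circle_cover \<Longrightarrow> \<phi> \<in> Bij UNIV"
  by (simp add: carrier_cover Diff_def)

lemma compose_UNIV: "compose UNIV f g = (\<lambda>x. f (g x))"
  by (simp add: compose_def restrict_UNIV)

lemma group_cover: "group diff_circle_cover"
  unfolding diff_circle_cover_def
proof (rule group_Diff)
  show "(\<forall>x. deriv (\<lambda>x\<in>UNIV. x) x > (0::real)) \<and> (\<forall>x::real. (\<lambda>x\<in>UNIV. x) (x + 2 * pi) = (\<lambda>x\<in>UNIV. x) x + 2 * pi)"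
    by (simp add: restrict_UNIV)
next
  fix f g :: "real \<Rightarrow> real"
  assume d: "f \<in> Diff UNIV" "g \<in> Diff UNIV"
    and f: "(\<forall>x. deriv f x > 0) \<and> (\<forall>x. f (x + 2 * pi) = f x + 2 * pi)"
    and g: "(\<forall>x. deriv g x > 0) \<and> (\<forall>x. g (x + 2 * pi) = g x + 2 * pi)"
  have "deriv (\<lambda>x. f (g x)) x > 0" for x
  proof -
    have "((\<lambda>x. f (g x)) has_real_derivative deriv f (g x) * deriv g x) (at x)"
      using d by (intro DERIV_chain2 smooth_on_deriv(1)) (auto simp: Diff_def)
    then have "deriv (\<lambda>x. f (g x)) x = deriv f (g x) * deriv g x" by (rule DERIV_imp_deriv)
    then show ?thesis using f g by simp
  qed
  then show "(\<forall>x. deriv (compose UNIV f g) x > 0) \<and> (\<forall>x. compose UNIV f g (x + 2 * pi) = compose UNIV f g x + 2 * pi)"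
    using f g by (simp add: compose_UNIV)
next
  fix f :: "real \<Rightarrow> real"
  assume d: "f \<in> Diff UNIV" and f: "(\<forall>x. deriv f x > 0) \<and> (\<forall>x. f (x + 2 * pi) = f x + 2 * pi)"
  have fi: "f (inv_into UNIV f t) = t" "inv_into UNIV f (f t) = t" for t using d Bij_inv_into[of f UNIV t] by (auto simp: Diff_def)
  have "deriv (inv_into UNIV f) t > 0" for t
    using deriv_inverse_pos[of f "inv_into UNIV f" t] d f fi by (auto simp: Diff_def)
  moreover have "inv_into UNIV f (x + 2 * pi) = inv_into UNIV f x + 2 * pi" for x using f fi by metis
  ultimately show "(\<forall>x. deriv (\<lambda>x\<in>UNIV. inv_into UNIV f x) x > 0) \<and> (\<forall>x. (\<lambda>x\<in>UNIV. inv_into UNIV f x) (x + 2 * pi) = (\<lambda>x\<in>UNIV. inv_into UNIV f x) x + 2 * pi)"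
    by (simp add: restrict_UNIV)
qed

lemma cover_mult: "f \<in> carrier diff_circle_cover \<Longrightarrow> g \<in> carrier diff_circle_cover \<Longrightarrow>
    f \<otimes>\<^bsub>diff_circle_cover\<^esub> g = (\<lambda>x. f (g x))"
  using BijGroup_mult[OF cover_Bij cover_Bij, of f g] by (simp add: diff_circle_cover_def compose_UNIV)

lemma cover_one: "\<one>\<^bsub>diff_circle_cover\<^esub> = (\<lambda>x. x)"
  by (simp add: diff_circle_cover_def BijGroup_def restrict_UNIV)

lemma deck_translation_cover: "deck_translation n \<in> carrier diff_circle_cover"
proof (rule cover_memI)
  show "smooth_on UNIV (deck_translation n)"
    unfolding deck_translation_def by (intro smooth_on_add smooth_on_id smooth_on_const)
  have "(deck_translation n has_real_derivative 1) (at x)" for x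
    unfolding deck_translation_def by (auto intro!: derivative_eq_intros)
  then show "deriv (deck_translation n) x > 0" for x by (metis DERIV_imp_deriv zero_less_one)
qed (simp add: deck_translation_def)

lemma cover_proj_cis:
  assumes "\<phi> \<in> carrier diff_circle_cover"
  shows "cover_proj \<phi> (cis t) = cis (\<phi> t)"
proof -
  have "cis (\<phi> (Arg (cis t))) = cis (\<phi> t)"
    by (rule periodic_cis_cong[of "\<lambda>x. cis (\<phi> x)"]) (simp_all add: cover_period[OF assms] circle_cis flip: cis_mult)
  then show ?thesis by (simp add: cover_proj_def)
qed

lemma cover_proj_comp:
  assumes "\<phi> \<in> carrier diff_circle_cover" "\<psi> \<in> carrier diff_circle_cover" "z \<in> circle"
  shows "cover_proj \<phi> (cover_proj \<psi> z) = cover_proj (\<lambda>x. \<phi> (\<psi> x)) z"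
proof -
  have "cover_proj f z = cis (f (Arg z))" for f using assms(3) by (simp add: cover_proj_def)
  then show ?thesis by (simp add: cover_proj_cis[OF assms(1)])
qed

lemma smooth_on_cover_proj:
  assumes "\<phi> \<in> carrier diff_circle_cover"
  shows "smooth_on circle (cover_proj \<phi>)"
proof -
  have "smooth_on (- {0}) (\<lambda>z. cis (\<phi> (Arg z)))"
    by (rule smooth_on_periodic_Arg)
      (auto simp: cover_period[OF assms] smooth_on_cis cover_smooth[OF assms] simp flip: cis_mult)
  then have "smooth_on circle (\<lambda>z. cis (\<phi> (Arg z)))" by (rule smooth_on_subset) auto
  then show ?thesis
    by (rule smooth_on_cong[THEN iffD1, rotated]) (simp add: cover_proj_def)
qed

lemma carrier_diff_circle:
  "\<mu> \<in> carrier diff_circle \<longleftrightarrow> \<mu> \<in> Diff circle \<and>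
    (\<forall>t. \<exists>c>0. ((\<lambda>s. \<mu> (cis s)) has_vector_derivative c *\<^sub>R (\<i> * \<mu> (cis t))) (at t))"
  by (simp add: diff_circle_def)

lemma cover_inverse:
  assumes "\<phi> \<in> carrier diff_circle_cover"
  obtains \<psi> where "\<psi> \<in> carrier diff_circle_cover" "\<And>x. \<phi> (\<psi> x) = x" "\<And>x. \<psi> (\<phi> x) = x"
proof -
  interpret group diff_circle_cover by (rule group_cover)
  have "\<phi> \<otimes>\<^bsub>diff_circle_cover\<^esub> inv\<^bsub>diff_circle_cover\<^esub> \<phi> = (\<lambda>x. x)"
    "inv\<^bsub>diff_circle_cover\<^esub> \<phi> \<otimes>\<^bsub>diff_circle_cover\<^esub> \<phi> = (\<lambda>x. x)"
    using assms by (simp_all add: cover_one)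
  then show ?thesis
    using that[of "inv\<^bsub>diff_circle_cover\<^esub> \<phi>"] assms by (simp add: cover_mult fun_eq_iff)
qed

lemma cover_proj_diff_circle:
  assumes \<phi>: "\<phi> \<in> carrier diff_circle_cover"
  shows "cover_proj \<phi> \<in> carrier diff_circle"
proof -
  obtain \<psi> where \<psi>: "\<psi> \<in> carrier diff_circle_cover" "\<And>x. \<phi> (\<psi> x) = x" "\<And>x. \<psi> (\<phi> x) = x"
    using cover_inverse[OF \<phi>] by blast
  have id: "cover_proj (\<lambda>x. x) z = z" if "z \<in> circle" for z
    using that circle_cis[OF that] by (simp add: cover_proj_def)
  have in_circle: "cover_proj f z \<in> circle" if "z \<in> circle" for f z
    using that by (simp add: cover_proj_def)
  have inv: "cover_proj \<phi> (cover_proj \<psi> z) = z" "cover_proj \<psi> (cover_proj \<phi> z) = z" if "z \<in> circle" for z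
    using cover_proj_comp[OF \<phi> \<psi>(1) that] cover_proj_comp[OF \<psi>(1) \<phi> that] id[OF that] \<psi> by simp_all
  have bij: "bij_betw (cover_proj \<phi>) circle circle"
    by (rule bij_betw_byWitness[where f' = "cover_proj \<psi>"]) (use inv in_circle in auto)
  have "inv_into circle (cover_proj \<phi>) z = cover_proj \<psi> z" if "z \<in> circle" for z
    using bij inv(1)[OF that] in_circle[OF that] by (intro inv_into_f_eq) (auto simp: bij_betw_def)
  with smooth_on_cover_proj[OF \<psi>(1)] have "smooth_on circle (inv_into circle (cover_proj \<phi>))"
    by (rule smooth_on_cong[THEN iffD2, rotated])
  then have "cover_proj \<phi> \<in> Diff circle"
    using bij smooth_on_cover_proj[OF \<phi>] by (simp add: Diff_def Bij_def) (simp add: cover_proj_def)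
  moreover have "\<exists>c>0. ((\<lambda>s. cover_proj \<phi> (cis s)) has_vector_derivative c *\<^sub>R (\<i> * cover_proj \<phi> (cis t))) (at t)" for t
    using orientation_iff[of \<phi> "cover_proj \<phi>" t] \<phi> cover_proj_cis[OF \<phi>] by (simp add: cover_smooth) (simp add: carrier_cover)
  ultimately show ?thesis by (simp add: carrier_diff_circle)
qed

text \<open>The lift gains n full turns over one period, and n > 0 since it increases. If n were at
  least 2, the value \<phi> x + 2 * pi would be taken strictly inside the period, and \<mu> would
  identify two points of the circle.\<close>

lemma lift_equivariant:
  assumes sm: "smooth_on UNIV \<phi>" and pos: "\<And>x. deriv \<phi> x > 0"
    and inj: "inj_on \<mu> circle" and lift: "\<And>t. \<mu> (cis t) = cis (\<phi> t)"
  shows "\<phi> (x + 2 * pi) = \<phi> x + 2 * pi"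
proof -
  have sm': "strict_mono \<phi>" by (rule strict_mono_deriv_pos[OF sm pos])
  have "cis (\<phi> (x + 2 * pi)) = cis (\<phi> x)"
    using lift[of "x + 2 * pi"] lift[of x] by (simp flip: cis_mult)
  then obtain n :: int where n: "\<phi> (x + 2 * pi) = \<phi> x + 2 * pi * of_int n" by (auto simp: cis_eq_cis_iff)
  have "\<phi> x < \<phi> (x + 2 * pi)" using sm' by (simp add: strict_mono_less)
  then have "n > 0" using n by (simp add: zero_less_mult_iff)
  moreover have "\<not> n > 1"
  proof
    assume "n > 1"
    then have "1 < real_of_int n" by simp
    then have b: "2 * pi * 1 < 2 * pi * of_int n" by (intro mult_strict_left_mono) auto
    have "\<exists>y\<ge>x. y \<le> x + 2 * pi \<and> \<phi> y = \<phi> x + 2 * pi"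
      by (rule IVT') (use n b continuous_on_subset[OF smooth_on_continuous[OF sm]] in auto)
    then obtain y where y: "x \<le> y" "y \<le> x + 2 * pi" "\<phi> y = \<phi> x + 2 * pi" by blast
    have "y \<noteq> x" "y \<noteq> x + 2 * pi" using y(3) n b by auto
    have "\<mu> (cis y) = \<mu> (cis x)" by (simp add: lift y(3) flip: cis_mult)
    then have "cis y = cis x" using inj by (auto dest: inj_onD)
    then obtain m :: int where m: "y = x + 2 * pi * of_int m" by (auto simp: cis_eq_cis_iff)
    have "0 \<le> 2 * pi * of_int m" "2 * pi * of_int m \<le> 2 * pi * 1" using m y by auto
    then have "0 \<le> m" "m \<le> 1" using pi_gt_zero by (simp_all add: zero_le_mult_iff)
    moreover have "m \<noteq> 0" "m \<noteq> 1" using m \<open>y \<noteq> x\<close> \<open>y \<noteq> x + 2 * pi\<close> by auto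
    ultimately show False by linarith
  qed
  ultimately have "n = 1" by simp
  then show ?thesis using n by simp
qed

lemma diff_circle_lift:
  assumes "\<mu> \<in> carrier diff_circle"
  obtains \<phi> where "\<phi> \<in> carrier diff_circle_cover" "\<And>t. \<mu> (cis t) = cis (\<phi> t)"
proof -
  have B: "\<mu> \<in> Bij circle" and s: "smooth_on circle \<mu>" using assms by (auto simp: carrier_diff_circle Diff_def)
  have "smooth_on UNIV (\<lambda>t. \<mu> (cis t))"
    by (rule smooth_on_compose[OF s]) (auto intro!: smooth_on_cis smooth_on_id)
  moreover have "norm (\<mu> (cis t)) = 1" for t using Bij_apply[OF B, of "cis t"] by simp
  ultimately obtain \<phi> where \<phi>: "smooth_on UNIV \<phi>" "\<And>t. \<mu> (cis t) = cis (\<phi> t)"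
    using smooth_lift by blast
  have pos: "deriv \<phi> t > 0" for t
    using assms orientation_iff[of \<phi> \<mu>, OF \<phi>] by (simp add: carrier_diff_circle)
  have "inj_on \<mu> circle" using B by (simp add: Bij_def bij_betw_def)
  from lift_equivariant[OF \<phi>(1) pos this \<phi>(2)] have "\<phi> \<in> carrier diff_circle_cover"
    by (intro cover_memI \<phi> pos)
  with \<phi>(2) show ?thesis using that by blast
qed

lemma diff_circle_eqI:
  assumes "\<mu> \<in> carrier diff_circle" "\<And>t. \<mu> (cis t) = cis (\<phi> t)"
  shows "\<mu> = cover_proj \<phi>"
proof -
  have "\<mu> \<in> extensional circle" using assms by (simp add: carrier_diff_circle Diff_def Bij_def)
  then show ?thesis
    by (rule extensionalityI[of _ circle]) (use assms(2) circle_cis in \<open>auto simp: cover_proj_def, metis\<close>)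
qed

lemma diff_circle_eq_range: "carrier diff_circle = cover_proj ` carrier diff_circle_cover"
proof (intro equalityI subsetI)
  fix \<mu> assume \<mu>: "\<mu> \<in> carrier diff_circle"
  then obtain \<phi> where "\<phi> \<in> carrier diff_circle_cover" "\<And>t. \<mu> (cis t) = cis (\<phi> t)"
    using diff_circle_lift by blast
  with diff_circle_eqI[OF \<mu>, of \<phi>] show "\<mu> \<in> cover_proj ` carrier diff_circle_cover" by blast
qed (auto simp: cover_proj_diff_circle)

lemma diff_circle_Bij: "\<mu> \<in> carrier diff_circle \<Longrightarrow> \<mu> \<in> Bij circle"
  by (simp add: carrier_diff_circle Diff_def)

lemma diff_circle_mult: "f \<in> carrier diff_circle \<Longrightarrow> g \<in> carrier diff_circle \<Longrightarrow>
    f \<otimes>\<^bsub>diff_circle\<^esub> g = compose circle f g"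
  using BijGroup_mult[OF diff_circle_Bij diff_circle_Bij, of f g] by (simp add: diff_circle_def)

lemma diff_circle_one: "\<one>\<^bsub>diff_circle\<^esub> = (\<lambda>x\<in>circle. x)"
  by (simp add: diff_circle_def BijGroup_def)

lemma cover_proj_compose:
  assumes "\<phi> \<in> carrier diff_circle_cover" "\<psi> \<in> carrier diff_circle_cover"
  shows "compose circle (cover_proj \<phi>) (cover_proj \<psi>) = cover_proj (\<lambda>x. \<phi> (\<psi> x))"
  by (rule extensionalityI[of _ circle]) (use cover_proj_comp[OF assms] in \<open>auto simp: compose_eq, simp add: cover_proj_def\<close>)

lemma cover_comp_closed:
  assumes "\<phi> \<in> carrier diff_circle_cover" "\<psi> \<in> carrier diff_circle_cover"
  shows "(\<lambda>x. \<phi> (\<psi> x)) \<in> carrier diff_circle_cover"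
  using group.is_monoid[OF group_cover] monoid.m_closed[of diff_circle_cover \<phi> \<psi>] assms by (simp add: cover_mult)

lemma cover_proj_id: "cover_proj (\<lambda>x. x) = (\<lambda>x\<in>circle. x)"
  by (auto simp: cover_proj_def circle_cis)

text \<open>The orientation condition passes to composites and inverses through lifts, which compose
  and invert along with the maps they cover.\<close>

lemma group_diff_circle: "group diff_circle"
proof -
  let ?P = "\<lambda>\<mu>. \<forall>t. \<exists>c>0. ((\<lambda>s. \<mu> (cis s)) has_vector_derivative c *\<^sub>R (\<i> * \<mu> (cis t))) (at t)"
  have mem: "f \<in> Diff circle \<Longrightarrow> ?P f \<Longrightarrow> f \<in> carrier diff_circle" for f by (simp add: carrier_diff_circle)
  have P: "f \<in> carrier diff_circle \<Longrightarrow> ?P f" for f by (simp add: carrier_diff_circle)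
  show ?thesis unfolding diff_circle_def
  proof (rule group_Diff)
    have "(\<lambda>x. x) \<in> carrier diff_circle_cover"
      using group.is_monoid[OF group_cover] monoid.one_closed[of diff_circle_cover] by (simp add: cover_one)
    then show "?P (\<lambda>x\<in>circle. x)" using P cover_proj_diff_circle cover_proj_id by metis
  next
    fix f g assume "f \<in> Diff circle" "g \<in> Diff circle" "?P f" "?P g"
    then obtain \<phi> \<psi> where c: "\<phi> \<in> carrier diff_circle_cover" "\<psi> \<in> carrier diff_circle_cover"
      and eq: "f = cover_proj \<phi>" "g = cover_proj \<psi>"
      using mem diff_circle_eq_range by blast
    show "?P (compose circle f g)" unfolding eq cover_proj_compose[OF c]
      by (rule P[OF cover_proj_diff_circle[OF cover_comp_closed[OF c]]])
  next
    fix f assume f: "f \<in> Diff circle" "?P f"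
    then obtain \<phi> where c: "\<phi> \<in> carrier diff_circle_cover" and eq: "f = cover_proj \<phi>"
      using mem diff_circle_eq_range by blast
    obtain \<psi> where \<psi>: "\<psi> \<in> carrier diff_circle_cover" "\<And>x. \<phi> (\<psi> x) = x" "\<And>x. \<psi> (\<phi> x) = x"
      using cover_inverse[OF c] by blast
    have "inv_into circle f z = cover_proj \<psi> z" if "z \<in> circle" for z
    proof (rule inv_into_f_eq)
      show "inj_on f circle" using f(1) by (simp add: Diff_def Bij_def bij_betw_def)
      show "cover_proj \<psi> z \<in> circle" using that by (simp add: cover_proj_def)
      show "f (cover_proj \<psi> z) = z"
        unfolding eq using cover_proj_comp[OF c \<psi>(1) that] circle_cis[OF that] that by (simp add: \<psi>(2) cover_proj_id)
    qed
    then have "(\<lambda>z\<in>circle. inv_into circle f z) = cover_proj \<psi>"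
      by (intro extensionalityI[of _ circle]) (auto simp: cover_proj_def)
    then show "?P (\<lambda>z\<in>circle. inv_into circle f z)" using P[OF cover_proj_diff_circle[OF \<psi>(1)]] by simp
  qed
qed

lemma central_extension_cover:
  "central_extension diff_circle_cover diff_circle deck_translation cover_proj"
  unfolding central_extension_def
proof (intro conjI allI ballI)
  show "inj deck_translation" by (rule injI) (auto simp: deck_translation_def fun_eq_iff)
  show "deck_translation (a + b) = deck_translation a \<otimes>\<^bsub>diff_circle_cover\<^esub> deck_translation b" for a b
    by (simp add: cover_mult deck_translation_cover) (simp add: deck_translation_def algebra_simps)
  show "g \<otimes>\<^bsub>diff_circle_cover\<^esub> deck_translation a = deck_translation a \<otimes>\<^bsub>diff_circle_cover\<^esub> g"
    if "g \<in> carrier diff_circle_cover" for g a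
    using that by (simp add: cover_mult deck_translation_cover) (simp add: deck_translation_def cover_period_int)
  show "cover_proj \<in> hom diff_circle_cover diff_circle"
    by (rule homI) (auto simp: cover_proj_diff_circle diff_circle_mult cover_mult cover_proj_compose)
  show "kernel diff_circle_cover diff_circle cover_proj = range deck_translation"
  proof (intro equalityI subsetI)
    fix \<phi> assume "\<phi> \<in> kernel diff_circle_cover diff_circle cover_proj"
    then have \<phi>: "\<phi> \<in> carrier diff_circle_cover" and one: "cover_proj \<phi> = (\<lambda>x\<in>circle. x)"
      by (auto simp: kernel_def diff_circle_one)
    have ex: "\<exists>n::int. \<phi> t = t + 2 * pi * of_int n" for t
      using cover_proj_cis[OF \<phi>, of t] by (simp add: one cis_eq_cis_iff[symmetric])
    \<comment> \<open>The number of full turns from t to \<phi> t. It is continuous and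
      integer-valued, hence constant, which makes \<phi> a deck translation.\<close>
    define d where "d t = (\<phi> t - t) / (2 * pi)" for t
    have dint: "d t \<in> \<int>" for t using ex[of t] by (auto simp: d_def)
    have "continuous_on UNIV d" unfolding d_def
      by (intro continuous_intros smooth_on_continuous[OF cover_smooth[OF \<phi>]]) auto
    then have "d constant_on UNIV"
    proof (rule continuous_discrete_range_constant[OF connected_UNIV])
      fix x
      have "1 \<le> norm (d y - d x)" if "d y \<noteq> d x" for y
        using dint[of x] dint[of y] that by (auto elim!: Ints_cases simp flip: of_int_diff)
      then show "\<exists>e>0. \<forall>y. y \<in> UNIV \<and> d y \<noteq> d x \<longrightarrow> e \<le> norm (d y - d x)" by (intro exI[of _ 1]) auto
    qed
    then obtain c where c: "\<And>t. d t = c" by (auto simp: constant_on_def)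
    obtain n where "d 0 = of_int n" using dint[of 0] by (auto elim: Ints_cases)
    then have "d t = of_int n" for t using c by metis
    then have "\<phi> = deck_translation n" by (auto simp: d_def deck_translation_def fun_eq_iff field_simps)
    then show "\<phi> \<in> range deck_translation" by simp
  next
    fix \<phi> assume "\<phi> \<in> range deck_translation"
    then obtain n where n: "\<phi> = deck_translation n" by blast
    have "cis (deck_translation n t) = cis t" for t by (auto simp: deck_translation_def cis_eq_cis_iff)
    then have "cover_proj (deck_translation n) = (\<lambda>x\<in>circle. x)"
      by (auto simp: cover_proj_def circle_cis)
    then show "\<phi> \<in> kernel diff_circle_cover diff_circle cover_proj"
      by (simp add: n kernel_def diff_circle_one deck_translation_cover)
  qed
qed (simp_all add: group_cover group_diff_circle deck_translation_cover diff_circle_eq_range[symmetric])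

section \<open>Potentials of the flux form\<close>

lemma disk_convex: "convex disk" "interior disk \<noteq> {}"
  by (auto simp: interior_cball)

lemma carrier_symp_disk:
  "g \<in> carrier symp_disk \<longleftrightarrow> g \<in> Diff disk \<and> (\<forall>p\<in>disk. pullback2 g omega p = omega p) \<and> g 0 = 0"
  by (simp add: symp_disk_def)

lemma Diff_smooth: "g \<in> Diff M \<Longrightarrow> smooth_on M g" "g \<in> Diff M \<Longrightarrow> smooth_on M (inv_into M g)"
  by (simp_all add: Diff_def)

lemma disk_deriv:
  assumes "smooth_on disk g" "p \<in> disk"
  shows "(g has_derivative disk_deriv g p) (at p within disk)"
  unfolding disk_deriv_def by (rule smooth_on_has_derivative_within[OF disk_convex assms])

lemma disk_deriv_eqI:
  assumes "p \<in> disk" "(g has_derivative g') (at p within disk)"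
  shows "disk_deriv g p = g'"
  unfolding disk_deriv_def by (rule frechet_derivative_within_eq[OF disk_convex assms])

lemma disk_deriv_comp:
  assumes "smooth_on disk f" "smooth_on disk g" "g ` disk \<subseteq> disk" "p \<in> disk"
    and "\<And>x. x \<in> disk \<Longrightarrow> h x = f (g x)"
  shows "disk_deriv h p = (\<lambda>v. disk_deriv f (g p) (disk_deriv g p v))"
proof (rule disk_deriv_eqI[OF assms(4)])
  have "((\<lambda>x. f (g x)) has_derivative (\<lambda>v. disk_deriv f (g p) (disk_deriv g p v))) (at p within disk)"
    by (rule has_derivative_in_compose2[where t = disk])
      (use assms disk_deriv in auto)
  then show "(h has_derivative (\<lambda>v. disk_deriv f (g p) (disk_deriv g p v))) (at p within disk)"
    by (rule has_derivative_transform[where f = "\<lambda>x. f (g x)", OF assms(4), rotated]) (rule assms(5))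
qed

lemma disk_deriv_id: "p \<in> disk \<Longrightarrow> (\<And>x. x \<in> disk \<Longrightarrow> h x = x) \<Longrightarrow> disk_deriv h p = (\<lambda>v. v)"
  by (rule disk_deriv_eqI) (auto intro: has_derivative_transform[OF _ _ has_derivative_ident])

lemma group_symp_disk: "group symp_disk"
  unfolding symp_disk_def
proof (rule group_Diff)
  show "(\<forall>p\<in>disk. pullback2 (\<lambda>x\<in>disk. x) omega p = omega p) \<and> (\<lambda>x\<in>disk. x) 0 = (0::complex)"
  proof (intro conjI ballI)
    fix p assume p: "p \<in> disk"
    show "pullback2 (\<lambda>x\<in>disk. x) omega p = omega p"
      using disk_deriv_id[OF p, of "\<lambda>x\<in>disk. x"] p by (simp add: pullback2_def fun_eq_iff)
  qed simp
next
  fix f g :: "complex \<Rightarrow> complex" assume d: "f \<in> Diff disk" "g \<in> Diff disk"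
    and f: "(\<forall>p\<in>disk. pullback2 f omega p = omega p) \<and> f 0 = 0"
    and g: "(\<forall>p\<in>disk. pullback2 g omega p = omega p) \<and> g 0 = 0"
  have m: "g x \<in> disk" if "x \<in> disk" for x using Bij_apply[OF Diff_imp_Bij[OF d(2)] that] .
  have "pullback2 (compose disk f g) omega p u v = omega p u v" if p: "p \<in> disk" for p u v
  proof -
    have "disk_deriv (compose disk f g) p = (\<lambda>v. disk_deriv f (g p) (disk_deriv g p v))"
      by (rule disk_deriv_comp) (use Diff_smooth d m p in \<open>auto simp: compose_eq\<close>)
    then have "pullback2 (compose disk f g) omega p u v
        = pullback2 f omega (g p) (disk_deriv g p u) (disk_deriv g p v)"
      by (simp add: pullback2_def omega_def)
    also have "\<dots> = pullback2 g omega p u v" using f m[OF p] by (simp add: pullback2_def omega_def)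
    finally show ?thesis using g p by simp
  qed
  then show "(\<forall>p\<in>disk. pullback2 (compose disk f g) omega p = omega p) \<and> compose disk f g 0 = 0"
    using f g by (simp add: compose_def fun_eq_iff)
next
  fix f :: "complex \<Rightarrow> complex" assume d: "f \<in> Diff disk"
    and f: "(\<forall>p\<in>disk. pullback2 f omega p = omega p) \<and> f 0 = 0"
  let ?h = "\<lambda>x\<in>disk. inv_into disk f x"
  note B = Diff_imp_Bij[OF d] note B' = Diff_imp_Bij[OF Diff_inv[OF d]]
  have m: "?h x \<in> disk" "f (?h x) = x" if "x \<in> disk" for x
    using Bij_inv_into[OF B that] that by simp_all
  have "pullback2 ?h omega p u v = omega p u v" if p: "p \<in> disk" for p u v
  proof -
    have "disk_deriv (\<lambda>x. x) p = (\<lambda>v. disk_deriv f (?h p) (disk_deriv ?h p v))"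
      by (rule disk_deriv_comp[OF Diff_smooth(1)[OF d] Diff_smooth(1)[OF Diff_inv[OF d]] _ p])
        (use m in auto)
    then have e: "disk_deriv f (?h p) (disk_deriv ?h p v) = v" for v
      using disk_deriv_id[OF p, of "\<lambda>x. x"] by (simp add: fun_eq_iff)
    have "pullback2 ?h omega p u v = omega (?h p) (disk_deriv ?h p u) (disk_deriv ?h p v)"
      by (simp add: pullback2_def omega_def)
    also have "\<dots> = pullback2 f omega (?h p) (disk_deriv ?h p u) (disk_deriv ?h p v)"
      using f m(1)[OF p] by simp
    also have "\<dots> = omega p u v" unfolding pullback2_def e by (simp add: omega_def)
    finally show ?thesis .
  qed
  moreover have "?h 0 = 0"
    using Bij_inv_into(3)[OF B, of 0] f by simp
  ultimately show "(\<forall>p\<in>disk. pullback2 ?h omega p = omega p) \<and> ?h 0 = 0"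
    by (simp only: fun_eq_iff) simp
qed

lemma symp_Bij: "g \<in> carrier symp_disk \<Longrightarrow> g \<in> Bij disk"
  by (simp add: carrier_symp_disk Diff_def)

lemma symp_smooth: "g \<in> carrier symp_disk \<Longrightarrow> smooth_on disk g"
  by (simp add: carrier_symp_disk Diff_def)

lemma symp_mult: "f \<in> carrier symp_disk \<Longrightarrow> g \<in> carrier symp_disk \<Longrightarrow> f \<otimes>\<^bsub>symp_disk\<^esub> g = compose disk f g"
  using BijGroup_mult[OF symp_Bij symp_Bij, of f g] by (simp add: symp_disk_def)

lemma symp_closed: "f \<in> carrier symp_disk \<Longrightarrow> g \<in> carrier symp_disk \<Longrightarrow> compose disk f g \<in> carrier symp_disk"
  using group.is_monoid[OF group_symp_disk] monoid.m_closed[of symp_disk f g] by (simp add: symp_mult)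

lemma symp_inv: "g \<in> carrier symp_disk \<Longrightarrow> (\<lambda>x\<in>disk. inv_into disk g x) \<in> carrier symp_disk"
proof -
  assume g: "g \<in> carrier symp_disk"
  interpret S: group symp_disk by (rule group_symp_disk)
  define h where "h = inv\<^bsub>symp_disk\<^esub> g"
  have h: "h \<in> carrier symp_disk" using g by (simp add: h_def)
  have "h \<otimes>\<^bsub>symp_disk\<^esub> g = \<one>\<^bsub>symp_disk\<^esub>" "g \<otimes>\<^bsub>symp_disk\<^esub> h = \<one>\<^bsub>symp_disk\<^esub>" using g by (simp_all add: h_def)
  then have "compose disk g h = (\<lambda>x\<in>disk. x)"
    using g h by (simp add: symp_mult) (simp add: symp_disk_def BijGroup_def)
  then have gh: "g (h x) = x" if "x \<in> disk" for x using that by (metis compose_eq restrict_apply')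
  have "h x = inv_into disk g x" if "x \<in> disk" for x
    using gh[OF that] Bij_inv_into(3)[OF symp_Bij[OF g] Bij_apply[OF symp_Bij[OF h] that]] by simp
  then have "(\<lambda>x\<in>disk. inv_into disk g x) = h"
    using symp_Bij[OF h] by (intro extensionalityI[of _ disk]) (auto simp: Bij_def)
  with h show ?thesis by simp
qed

lemma symp_omega:
  assumes "g \<in> carrier symp_disk" "p \<in> disk"
  shows "Re (disk_deriv g p u) * Im (disk_deriv g p v) - Im (disk_deriv g p u) * Re (disk_deriv g p v)
    = Re u * Im v - Im u * Re v"
proof -
  have "pullback2 g omega p = omega p" using assms by (simp add: carrier_symp_disk)
  then have "pullback2 g omega p u v = omega p u v" by simp
  then show ?thesis by (simp add: pullback2_def omega_def)
qed

section \<open>Boundary behaviour of area-preserving disk maps\<close>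

text \<open>By invariance of domain the image of the open ball is open in the plane; being contained
  in the disk, it lies in the interior of the disk.\<close>

lemma symp_ball: 
  assumes "g \<in> carrier symp_disk"
  shows "g ` ball 0 1 \<subseteq> ball 0 1"
proof -
  have "open (g ` ball 0 1)"
  proof (rule invariance_of_domain)
    show "continuous_on (ball 0 1) g"
      using continuous_on_subset[OF smooth_on_continuous[OF symp_smooth[OF assms]] ball_subset_cball] .
    show "inj_on g (ball 0 1)"
      using symp_Bij[OF assms] inj_on_subset[OF _ ball_subset_cball] by (auto simp: Bij_def bij_betw_def)
  qed simp
  moreover have "g ` ball 0 1 \<subseteq> disk" using Bij_apply[OF symp_Bij[OF assms]] by auto
  ultimately show ?thesis using interior_maximal by (metis interior_cball)
qed

text \<open>Otherwise the inverse, which also preserves the open ball, would take an interior point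
  to z.\<close>

lemma symp_circle:
  assumes g: "g \<in> carrier symp_disk" and z: "z \<in> circle"
  shows "g z \<in> circle"
proof (rule ccontr)
  assume n: "g z \<notin> circle"
  have zd: "z \<in> disk" using z by simp
  have "g z \<in> disk" using Bij_apply[OF symp_Bij[OF g] zd] .
  with n have "g z \<in> ball 0 1" by simp
  then have "(\<lambda>x\<in>disk. inv_into disk g x) (g z) \<in> ball 0 1"
    using symp_ball[OF symp_inv[OF g]] by blast
  then have "z \<in> ball 0 1" using Bij_inv_into(3)[OF symp_Bij[OF g] zd] \<open>g z \<in> disk\<close> by simp
  then show False using z by simp
qed

text \<open>At \<open>cis t\<close> only the derivative within the disk is available. In the
  tangential direction it is found by differentiating t \<mapsto> g (cis t) in two ways.\<close>

lemma symp_along_circle: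
  assumes g: "g \<in> carrier symp_disk" and \<phi>: "smooth_on UNIV \<phi>" "\<And>t. g (cis t) = cis (\<phi> t)"
  shows "disk_deriv g (cis t) (\<i> * cis t) = deriv \<phi> t *\<^sub>R (\<i> * cis (\<phi> t))"
proof -
  have 1: "((\<lambda>t. cis t) has_derivative (\<lambda>h. h *\<^sub>R (\<i> * cis t))) (at t)"
    using cis_has_vector_derivative[OF DERIV_ident, of t] by (simp add: has_vector_derivative_def)
  have "((\<lambda>t. g (cis t)) has_derivative (\<lambda>h. disk_deriv g (cis t) (h *\<^sub>R (\<i> * cis t)))) (at t)"
    by (rule has_derivative_in_compose2[where t = disk and s = UNIV])
      (use disk_deriv[OF symp_smooth[OF g]] 1 in auto)
  moreover have "disk_deriv g (cis t) (h *\<^sub>R v) = h *\<^sub>R disk_deriv g (cis t) v" for h v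
    by (rule linear_scale[OF has_derivative_linear[OF disk_deriv[OF symp_smooth[OF g]]]]) simp
  ultimately have "((\<lambda>t. g (cis t)) has_vector_derivative disk_deriv g (cis t) (\<i> * cis t)) (at t)"
    by (simp add: has_vector_derivative_def)
  from vector_derivative_unique_at[OF this[unfolded \<phi>(2)] cis_has_vector_derivative[OF smooth_on_deriv(1)[OF \<phi>(1)]]]
  show ?thesis .
qed

text \<open>Let X be the image of the outward radial vector u. Preservation of \<open>omega\<close>
  on the pair u, \<i> * u gives deriv \<phi> t * (X \<bullet> g u) = 1, so it remains to exclude
  that X points inwards. The squared norm of g (s u) on [0,1] has its maximum 1 at s = 1, and its
  one-sided derivative there is 2 * (X \<bullet> g u), which therefore is not negative.\<close>

lemma symp_boundary_orientation:
  assumes g: "g \<in> carrier symp_disk" and \<phi>: "smooth_on UNIV \<phi>" "\<And>t. g (cis t) = cis (\<phi> t)"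
  shows "deriv \<phi> t > 0"
proof -
  define u where "u = cis t"
  define X where "X = disk_deriv g u u"
  have ud: "u \<in> disk" by (simp add: u_def)
  have "deriv \<phi> t * (X \<bullet> g u) = Re X * Im (disk_deriv g u (\<i> * u)) - Im X * Re (disk_deriv g u (\<i> * u))"
    unfolding u_def symp_along_circle[OF g \<phi>] \<phi>(2) by (simp add: inner_complex_def algebra_simps)
  also have "\<dots> = Re u * Re u + Im u * Im u" unfolding X_def symp_omega[OF g ud] by simp
  also have "\<dots> = 1" by (simp add: u_def flip: power2_eq_square)
  finally have eq: "deriv \<phi> t * (X \<bullet> g u) = 1" .
  have "X \<bullet> g u \<ge> 0"
  proof (rule ccontr)
    assume neg: "\<not> 0 \<le> X \<bullet> g u"
    have ray: "s *\<^sub>R u \<in> disk" if "s \<in> {0..1}" for s using that by (simp add: u_def)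
    have "((\<lambda>s. s *\<^sub>R u) has_derivative (\<lambda>h. h *\<^sub>R u)) (at 1 within {0..1})"
      by (auto intro!: derivative_eq_intros)
    then have "((\<lambda>s. g (s *\<^sub>R u)) has_derivative (\<lambda>h. disk_deriv g (1 *\<^sub>R u) (h *\<^sub>R u))) (at 1 within {0..1})"
      by (intro has_derivative_in_compose2[where t = disk, OF disk_deriv[OF symp_smooth[OF g]]]) (use ray in auto)
    moreover have "disk_deriv g u (h *\<^sub>R v) = h *\<^sub>R disk_deriv g u v" for h v
      by (rule linear_scale[OF has_derivative_linear[OF disk_deriv[OF symp_smooth[OF g] ud]]])
    ultimately have d: "((\<lambda>s. g (s *\<^sub>R u)) has_derivative (\<lambda>h. h *\<^sub>R X)) (at 1 within {0..1})"
      by (simp add: X_def)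
    have "((\<lambda>s. g (s *\<^sub>R u) \<bullet> g (s *\<^sub>R u)) has_derivative (\<lambda>h. g (1 *\<^sub>R u) \<bullet> (h *\<^sub>R X) + (h *\<^sub>R X) \<bullet> g (1 *\<^sub>R u))) (at 1 within {0..1})"
      by (rule has_derivative_inner[OF d d])
    then have "((\<lambda>s. g (s *\<^sub>R u) \<bullet> g (s *\<^sub>R u)) has_real_derivative 2 * (X \<bullet> g u)) (at 1 within {0..1})"
      unfolding has_field_derivative_def
      by (rule has_derivative_eq_rhs) (simp add: fun_eq_iff inner_commute)
    from has_real_derivative_neg_dec_left[OF this] neg
    obtain d where d: "d > 0" "\<And>h. h > 0 \<Longrightarrow> 1 - h \<in> {0..1} \<Longrightarrow> h < d \<Longrightarrow>
        g (1 *\<^sub>R u) \<bullet> g (1 *\<^sub>R u) < g ((1 - h) *\<^sub>R u) \<bullet> g ((1 - h) *\<^sub>R u)" by auto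
    define h where "h = min (d / 2) 1"
    have "g (1 *\<^sub>R u) \<bullet> g (1 *\<^sub>R u) < g ((1 - h) *\<^sub>R u) \<bullet> g ((1 - h) *\<^sub>R u)"
      by (rule d(2)) (use d(1) in \<open>auto simp: h_def\<close>)
    moreover have "g ((1 - h) *\<^sub>R u) \<in> disk"
      by (intro Bij_apply[OF symp_Bij[OF g]] ray) (use d(1) in \<open>auto simp: h_def\<close>)
    ultimately show False
      using symp_circle[OF g, of u] by (simp add: u_def dot_square_norm power_le_one_iff not_le flip: not_le[of "(norm _)\<^sup>2"])
  qed
  with eq show ?thesis by (metis mult_not_zero zero_less_mult_pos2 zero_less_one order_le_less zero_neq_one)
qed

lemma symp_restrict_circle:
  assumes g: "g \<in> carrier symp_disk"
  shows "restrict g circle \<in> carrier diff_circle"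
proof -
  define h where "h = (\<lambda>x\<in>disk. inv_into disk g x)"
  have h: "h \<in> carrier symp_disk" using symp_inv[OF g] by (simp add: h_def)
  have c: "g z \<in> circle" "h z \<in> circle" if "z \<in> circle" for z using symp_circle g h that by blast+
  have hg: "h (g z) = z" "g (h z) = z" if "z \<in> circle" for z
    using Bij_inv_into[OF symp_Bij[OF g], of z] c[OF that] that by (simp_all add: h_def)
  have bij: "bij_betw g circle circle"
    by (rule bij_betw_byWitness[where f' = h]) (use c hg in auto)
  then have bij': "bij_betw (restrict g circle) circle circle" by simp
  have "inv_into circle (restrict g circle) z = h z" if "z \<in> circle" for z
    using bij' hg[OF that] c[OF that] that by (intro inv_into_f_eq) (auto simp: bij_betw_def)
  moreover have sh: "smooth_on circle h" by (rule smooth_on_subset[OF symp_smooth[OF h]]) auto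
  ultimately have "smooth_on circle (inv_into circle (restrict g circle))"
    using smooth_on_cong by metis
  moreover have sg: "smooth_on circle g" by (rule smooth_on_subset[OF symp_smooth[OF g]]) auto
  then have "smooth_on circle (restrict g circle)" by (rule smooth_on_cong[THEN iffD2, rotated]) simp
  ultimately have "restrict g circle \<in> Diff circle" using bij' by (simp add: Diff_def Bij_def)
  moreover have "\<exists>c>0. ((\<lambda>s. restrict g circle (cis s)) has_vector_derivative c *\<^sub>R (\<i> * restrict g circle (cis t))) (at t)" for t
  proof -
    have "smooth_on UNIV (\<lambda>t. g (cis t))"
      by (rule smooth_on_compose[OF sg]) (auto intro!: smooth_on_cis smooth_on_id)
    moreover have "norm (g (cis t)) = 1" for t using c(1)[of "cis t"] by simp
    ultimately obtain \<phi> where \<phi>: "smooth_on UNIV \<phi>" "\<And>t. g (cis t) = cis (\<phi> t)"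
      using smooth_lift by blast
    show ?thesis
      using orientation_iff[OF \<phi>(1), of "restrict g circle"] symp_boundary_orientation[OF g \<phi>] \<phi>(2) by simp
  qed
  ultimately show ?thesis by (simp add: carrier_diff_circle)
qed

lemma symp_lift:
  assumes "g \<in> carrier symp_disk"
  obtains \<phi> where "\<phi> \<in> carrier diff_circle_cover" "restrict g circle = cover_proj \<phi>" "\<And>t. g (cis t) = cis (\<phi> t)"
proof -
  note r = symp_restrict_circle[OF assms]
  obtain \<phi> where \<phi>: "\<phi> \<in> carrier diff_circle_cover" "\<And>t. restrict g circle (cis t) = cis (\<phi> t)"
    using diff_circle_lift[OF r] by blast
  show ?thesis using that[OF \<phi>(1) diff_circle_eqI[OF r \<phi>(2)]] \<phi>(2) by simp
qed

section \<open>Primitives of the flux form and the extended flux\<close>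

definition flux_form :: "(complex \<Rightarrow> complex) \<Rightarrow> form1"
  where "flux_form g p v = pullback1 g eta p v - eta p v"

definition flux_potential :: "(complex \<Rightarrow> complex) \<Rightarrow> complex \<Rightarrow> real"
  where "flux_potential g =
    (SOME f. f 0 = 0 \<and> (\<forall>p\<in>disk. (f has_derivative flux_form g p) (at p within disk)))"

lemma flux_form_eq:
  "flux_form g p v = (Re (g p) * Im (disk_deriv g p v) - Im (g p) * Re (disk_deriv g p v)) / 2
    - (Re p * Im v - Im p * Re v) / 2"
  by (simp add: flux_form_def pullback1_def eta_def)

text \<open>The Poincare lemma needs the flux form to be closed. Its derivative consists of half of
  the pulled-back \<open>omega\<close>, minus half of \<open>omega\<close>, and a term with second
  derivatives of g. The first two cancel because g preserves area; the third is symmetric by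
  equality of mixed derivatives.\<close>

lemma potential_exists:
  assumes g: "g \<in> carrier symp_disk"
  shows "\<exists>f. f 0 = 0 \<and> (\<forall>p\<in>disk. (f has_derivative flux_form g p) (at p within disk))"
proof (rule poincare_lemma[OF disk_convex])
  show "0 \<in> disk" by simp
  show "linear (flux_form g p)" if p: "p \<in> disk" for p
  proof -
    have lin: "linear (disk_deriv g p)" by (rule has_derivative_linear[OF disk_deriv[OF symp_smooth[OF g] p]])
    show ?thesis
      by (rule linearI) (simp_all add: flux_form_eq linear_add[OF lin] linear_scale[OF lin] field_simps)
  qed
  have sD: "smooth_on disk (\<lambda>p. disk_deriv g p v)" for v
    unfolding disk_deriv_def by (rule smooth_on_frechet_derivative_within[OF disk_convex symp_smooth[OF g]])
  show "smooth_on disk (\<lambda>p. flux_form g p v)" for v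
    unfolding flux_form_eq
    by (intro smooth_on_diff smooth_on_divide smooth_on_mult smooth_on_Re smooth_on_Im smooth_on_const
        smooth_on_id symp_smooth[OF g] sD) simp_all
  fix p v w assume p: "p \<in> disk"
  define D2 where "D2 v = frechet_derivative (\<lambda>q. disk_deriv g q v) (at p within disk)" for v
  have D2: "((\<lambda>q. disk_deriv g q v) has_derivative D2 v) (at p within disk)" for v
    unfolding D2_def by (rule smooth_on_has_derivative_within[OF disk_convex sD p])
  have sym: "D2 v w = D2 w v"
    unfolding D2_def disk_deriv_def
    by (rule symmetric_second_derivative_within[OF disk_convex symp_smooth[OF g] p])
  note Dg = disk_deriv[OF symp_smooth[OF g] p]
  have form: "((\<lambda>q. flux_form g q v) has_derivative (\<lambda>w.
      (Re (disk_deriv g p w) * Im (disk_deriv g p v) - Im (disk_deriv g p w) * Re (disk_deriv g p v)) / 2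
      + (Re (g p) * Im (D2 v w) - Im (g p) * Re (D2 v w)) / 2 - (Re w * Im v - Im w * Re v) / 2)) (at p within disk)" for v
    unfolding flux_form_eq by (auto intro!: derivative_eq_intros Dg D2 simp: field_simps)
  have fd: "frechet_derivative (\<lambda>q. flux_form g q v) (at p within disk) w
      = (Re (g p) * Im (D2 v w) - Im (g p) * Re (D2 v w)) / 2" for v w
    unfolding frechet_derivative_within_eq[OF disk_convex p form] symp_omega[OF g p] by simp
  show "frechet_derivative (\<lambda>q. flux_form g q v) (at p within disk) w
      = frechet_derivative (\<lambda>q. flux_form g q w) (at p within disk) v"
    by (simp only: fd sym)
qed

lemma flux_potential:
  assumes "g \<in> carrier symp_disk"
  shows "flux_potential g 0 = 0"
    and "p \<in> disk \<Longrightarrow> (flux_potential g has_derivative flux_form g p) (at p within disk)"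
  using someI_ex[OF potential_exists[OF assms]] by (auto simp: flux_potential_def)

lemma flux_potential_path:
  assumes g: "g \<in> carrier symp_disk" and c: "(c has_derivative (\<lambda>h. h *\<^sub>R c')) (at t within T)"
    and "c ` T \<subseteq> disk" "t \<in> T"
  shows "((\<lambda>t. flux_potential g (c t)) has_real_derivative flux_form g (c t) c') (at t within T)"
proof -
  have "((\<lambda>t. flux_potential g (c t)) has_derivative (\<lambda>h. flux_form g (c t) (h *\<^sub>R c'))) (at t within T)"
    by (rule has_derivative_in_compose2[where t = disk, OF flux_potential(2)[OF g]]) (use assms in auto)
  moreover have "flux_form g (c t) (h *\<^sub>R c') = flux_form g (c t) c' * h" for h
  proof -
    have "linear (flux_form g (c t))"
      using assms by (intro has_derivative_linear[OF flux_potential(2)[OF g]]) auto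
    from linear_scale[OF this] show ?thesis by simp
  qed
  ultimately show ?thesis unfolding has_field_derivative_def by simp
qed

lemma real_segment_vector_derivative:
  "((\<lambda>t. Complex t 0) has_vector_derivative 1) (at t within T)"
proof -
  have "((\<lambda>t. complex_of_real t) has_vector_derivative 1) (at t within T)"
    by (auto intro!: derivative_eq_intros)
  then show ?thesis by (simp add: complex_of_real_def)
qed

lemma flux_eq_integral: "flux g = integral {0..1} (\<lambda>t. flux_form g (Complex t 0) 1)"
  unfolding flux_def line_integral_def flux_form_def[symmetric]
proof (rule integral_cong)
  fix t :: real assume "t \<in> {0..1}"
  then have "vector_derivative (\<lambda>t. Complex t 0) (at t within {0..1}) = 1"
    using real_segment_vector_derivative
    by (intro vector_derivative_within_cbox[where a = 0 and b = 1, unfolded cbox_interval]) auto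
  then show "flux_form g (Complex t 0) (vector_derivative (\<lambda>t. Complex t 0) (at t within {0..1}))
      = flux_form g (Complex t 0) 1" by simp
qed

lemma flux_eq_potential:
  assumes g: "g \<in> carrier symp_disk"
  shows "flux g = flux_potential g 1"
proof -
  have "((\<lambda>t. flux_form g (Complex t 0) 1) has_integral
      flux_potential g (Complex 1 0) - flux_potential g (Complex 0 0)) {0..1}"
  proof (rule fundamental_theorem_of_calculus)
    fix t :: real assume t: "t \<in> {0..1}"
    have "((\<lambda>t. flux_potential g (Complex t 0)) has_real_derivative flux_form g (Complex t 0) 1) (at t within {0..1})"
      by (rule flux_potential_path[OF g])
        (use real_segment_vector_derivative t in \<open>auto simp: has_vector_derivative_def complex_norm\<close>)
    then show "((\<lambda>t. flux_potential g (Complex t 0)) has_vector_derivative flux_form g (Complex t 0) 1) (at t within {0..1})"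
      by (simp add: has_real_derivative_iff_has_vector_derivative)
  qed simp
  moreover have "Complex 1 0 = 1" "Complex 0 0 = 0" by (simp_all add: complex_eq_iff)
  ultimately show ?thesis
    using flux_potential(1)[OF g] by (simp add: flux_eq_integral integral_unique)
qed

text \<open>The form of the composite is the pullback by h of the form of g plus the form of h, so
  both sides have the same derivative on the convex disk. They agree at the origin, because h fixes
  it.\<close>

lemma flux_potential_compose:
  assumes g: "g \<in> carrier symp_disk" and h: "h \<in> carrier symp_disk" and p: "p \<in> disk"
  shows "flux_potential (compose disk g h) p = flux_potential g (h p) + flux_potential h p"
proof -
  define d where "d p = flux_potential (compose disk g h) p - (flux_potential g (h p) + flux_potential h p)" for p
  have m: "h x \<in> disk" if "x \<in> disk" for x using Bij_apply[OF symp_Bij[OF h] that] .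
  have "(d has_derivative (\<lambda>v. 0)) (at p within disk)" if p: "p \<in> disk" for p
  proof -
    have 1: "((\<lambda>p. flux_potential g (h p)) has_derivative (\<lambda>v. flux_form g (h p) (disk_deriv h p v))) (at p within disk)"
      by (rule has_derivative_in_compose2[where t = disk, OF flux_potential(2)[OF g] _ p disk_deriv[OF symp_smooth[OF h] p]])
        (use m in auto)
    have D: "disk_deriv (compose disk g h) p = (\<lambda>v. disk_deriv g (h p) (disk_deriv h p v))"
      by (rule disk_deriv_comp) (use symp_smooth g h m p in \<open>auto simp: compose_eq\<close>)
    have "(d has_derivative (\<lambda>v. flux_form (compose disk g h) p v -
        (flux_form g (h p) (disk_deriv h p v) + flux_form h p v))) (at p within disk)"
      unfolding d_def
      by (intro has_derivative_diff has_derivative_add 1 flux_potential(2) symp_closed g h p)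
    then show ?thesis
      by (rule has_derivative_eq_rhs) (use p in \<open>simp add: fun_eq_iff flux_form_eq D compose_eq\<close>)
  qed
  from has_derivative_zero_unique[OF disk_convex(1) this p, of 0]
  have "d p = d 0" by simp
  also have "\<dots> = 0"
    using g h symp_closed[OF g h] by (simp add: d_def flux_potential(1)) (simp add: carrier_symp_disk flux_potential(1)[OF g])
  finally show ?thesis by (simp add: d_def)
qed

text \<open>The constant of integration is fixed at t = 0: \<open>cis 0\<close> is the end point of
  the segment along which the flux is taken.\<close>

lemma flux_potential_circle:
  assumes g: "g \<in> carrier symp_disk" and \<phi>: "smooth_on UNIV \<phi>" "\<And>t. g (cis t) = cis (\<phi> t)"
  shows "flux_potential g (cis t) = flux g + (\<phi> t - \<phi> 0 - t) / 2"
proof -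
  define d where "d t = flux_potential g (cis t) - (\<phi> t - t) / 2" for t
  have "(d has_real_derivative 0) (at t)" for t
  proof -
    have 1: "((\<lambda>t. cis t) has_derivative (\<lambda>h. h *\<^sub>R (\<i> * cis t))) (at t)"
      using cis_has_vector_derivative[OF DERIV_ident, of t] by (simp add: has_vector_derivative_def)
    have "((\<lambda>t. flux_potential g (cis t)) has_real_derivative flux_form g (cis t) (\<i> * cis t)) (at t)"
      by (rule flux_potential_path[OF g 1]) (auto simp: image_subset_iff)
    moreover have "flux_form g (cis t) (\<i> * cis t) = (deriv \<phi> t - 1) / 2"
    proof -
      have e: "deriv \<phi> t * (cos (\<phi> t) * cos (\<phi> t)) + deriv \<phi> t * (sin (\<phi> t) * sin (\<phi> t)) = deriv \<phi> t"
        by (simp only: distrib_left[symmetric] sin_cos_squared_add3 mult_1_right)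
      have "flux_form g (cis t) (\<i> * cis t) = ((deriv \<phi> t * (cos (\<phi> t) * cos (\<phi> t)) + deriv \<phi> t * (sin (\<phi> t) * sin (\<phi> t)))
          - (cos t * cos t + sin t * sin t)) / 2"
        unfolding flux_form_eq symp_along_circle[OF g \<phi>] \<phi>(2)
        by (simp add: mult_ac add_divide_distrib diff_divide_distrib del: sin_cos_squared_add3)
      then show ?thesis unfolding e sin_cos_squared_add3 .
    qed
    moreover note smooth_on_deriv(1)[OF \<phi>(1), of t]
    ultimately show ?thesis unfolding d_def by (auto intro!: derivative_eq_intros)
  qed
  then have "d t = d 0" by (metis DERIV_isconst_all)
  then show ?thesis using flux_eq_potential[OF g] by (simp add: d_def field_simps)
qed

text \<open>The potential of g is evaluated at h 1 = \<open>cis (\<psi> 0)\<close> instead of 1;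
  moving it back to 1 along the circle costs half the translation defect of the lifts.\<close>

lemma flux_compose:
  assumes g: "g \<in> carrier symp_disk" and h: "h \<in> carrier symp_disk"
    and \<phi>: "smooth_on UNIV \<phi>" "\<And>t. g (cis t) = cis (\<phi> t)" and \<psi>: "\<And>t. h (cis t) = cis (\<psi> t)"
  shows "flux (compose disk g h) = flux g + flux h + (\<phi> (\<psi> 0) - \<phi> 0 - \<psi> 0) / 2"
proof -
  have "flux (compose disk g h) = flux_potential g (h 1) + flux_potential h 1"
    using flux_potential_compose[OF g h, of 1] flux_eq_potential[OF symp_closed[OF g h]] by simp
  also have "h 1 = cis (\<psi> 0)" using \<psi>[of 0] by simp
  finally show ?thesis using flux_potential_circle[OF g \<phi>, of "\<psi> 0"] flux_eq_potential[OF h] by simp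
qed

section \<open>Extending circle diffeomorphisms to the disk\<close>

lemma smooth_step_exists:
  obtains \<xi> :: "real \<Rightarrow> real" and C
  where "smooth_on UNIV \<xi>" "\<And>x. 0 \<le> \<xi> x" "\<And>x. \<xi> x \<le> 1" "\<And>x. x \<le> - 1 / 2 \<Longrightarrow> \<xi> x = 0" "\<xi> 0 = 1"
    "C > 0" "\<And>x. \<bar>deriv \<xi> x\<bar> \<le> C"
proof -
  define E where "E = flat_exp 0"
  have E: "E x \<ge> 0" "x > 0 \<Longrightarrow> E x > 0" "x \<le> 0 \<Longrightarrow> E x = 0" for x by (auto simp: E_def flat_exp_def)
  \<comment> \<open>The numbers x + 1/2 and -x sum to 1/2, so at least one of them is
    positive.\<close>
  have pos: "E (x + 1 / 2) + E (- x) > 0" for x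
    using E(1)[of "x + 1/2"] E(1)[of "- x"] E(2)[of "x + 1/2"] E(2)[of "- x"] by (cases "x < 0") (simp_all add: add_nonneg_pos add_pos_nonneg)
  define \<xi> where "\<xi> x = E (x + 1 / 2) / (E (x + 1 / 2) + E (- x))" for x
  have sm: "smooth_on UNIV \<xi>" unfolding \<xi>_def E_def
    by (intro smooth_on_divide smooth_on_add smooth_on_flat_exp smooth_on_id smooth_on_const smooth_on_minus)
      (use pos in \<open>simp add: E_def less_imp_neq[symmetric]\<close>)
  have low: "\<xi> x = 0" if "x \<le> - 1 / 2" for x using that by (simp add: \<xi>_def E(3))
  have high: "\<xi> x = 1" if "x \<ge> 0" for x using that pos[of x] by (simp add: \<xi>_def E(3)[of "- x"])
  have "deriv \<xi> x = 0" if "x \<notin> {- 1 / 2..0}" for x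
  proof -
    have "(\<xi> has_real_derivative 0) (at x)"
    proof (cases "x < - 1 / 2")
      case True
      then show ?thesis
        by (intro has_field_derivative_transform_within_open[OF DERIV_const[of 0], of "{..< - 1 / 2}"])
          (use low in auto)
    next
      case False
      then show ?thesis
        using that by (intro has_field_derivative_transform_within_open[OF DERIV_const[of 1], of "{0<..}"])
          (use high in auto)
    qed
    then show ?thesis by (rule DERIV_imp_deriv)
  qed
  moreover have "continuous_on {- 1 / 2..0} (deriv \<xi>)"
    using continuous_on_subset[OF smooth_on_continuous[OF smooth_on_deriv(2)[OF sm]]] by simp
  then have "bounded (deriv \<xi> ` {- 1 / 2..0})" by (intro compact_imp_bounded compact_continuous_image) auto
  then obtain C where C: "C > 0" "\<And>x. x \<in> {- 1 / 2..0} \<Longrightarrow> \<bar>deriv \<xi> x\<bar> \<le> C"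
    unfolding bounded_pos by auto
  ultimately have "\<bar>deriv \<xi> x\<bar> \<le> C" for x by (cases "x \<in> {- 1 / 2..0}") auto
  moreover have "0 \<le> \<xi> x" "\<xi> x \<le> 1" for x using pos[of x] E(1) by (simp_all add: \<xi>_def)
  ultimately show ?thesis using that[of \<xi> C] sm low high C(1) by simp
qed

text \<open>For a cutoff \<xi> times arctan(N x) / N the derivative has two parts. The part \<xi> /
  (1 + (N x)^2) lies in [0,1] and equals 1 at 0; adding this multiple of b to 1 gives a value
  between 1 and 1 + b, hence at least min \<delta> 1. The part containing \<xi>' is bounded by a
  multiple of 1 / N, so a large N makes its product with b small.\<close>

lemma radial_profile_exists:
  assumes \<delta>: "\<delta> > 0" and M: "M \<ge> 0"
  obtains k k' :: "real \<Rightarrow> real" and \<kappa> :: real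
  where "smooth_on UNIV k" "smooth_on UNIV k'" "\<And>x. (k has_real_derivative k' x) (at x)"
    "\<And>x. x \<le> - 1 / 2 \<Longrightarrow> k x = 0" "k 0 = 0" "k' 0 = 1" "\<kappa> > 0"
    "\<And>x b. \<delta> \<le> 1 + b \<Longrightarrow> \<bar>b\<bar> \<le> M \<Longrightarrow> \<kappa> \<le> 1 + k' x * b"
proof -
  obtain \<xi> :: "real \<Rightarrow> real" and C where \<xi>: "smooth_on UNIV \<xi>" "\<And>x. 0 \<le> \<xi> x" "\<And>x. \<xi> x \<le> 1"
    "\<And>x. x \<le> - 1 / 2 \<Longrightarrow> \<xi> x = 0" "\<xi> 0 = 1" and C: "C > 0" "\<And>x. \<bar>deriv \<xi> x\<bar> \<le> C"
    using smooth_step_exists by blast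
  \<comment> \<open>A lower bound for both 1 and 1 + b, the end values of 1 + z * b for z in
    [0,1].\<close>
  define \<delta>' where "\<delta>' = min \<delta> 1"
  have \<delta>': "\<delta>' > 0" "\<delta>' \<le> 1" "\<delta>' \<le> \<delta>" using \<delta> by (auto simp: \<delta>'_def)
  \<comment> \<open>Chosen so that C * (pi / 2) / N * M \<le> \<delta>' / 2, which leaves the other
    half of \<delta>' as the final bound; the summand 1 keeps N positive when M = 0.\<close>
  define N where "N = C * pi * M / \<delta>' + 1"
  have N: "N > 0" using C M \<delta>' by (simp add: N_def add_nonneg_pos)
  define k where "k x = \<xi> x * (arctan (N * x) / N)" for x
  define k' where "k' x = deriv \<xi> x * (arctan (N * x) / N) + \<xi> x * inverse (1 + (N * x)\<^sup>2)" for x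
  have nz: "1 + (N * x)\<^sup>2 \<noteq> 0" for x by (metis add_pos_nonneg less_irrefl zero_le_power2 zero_less_one)
  show ?thesis
  proof (rule that[of k k' "\<delta>' / 2"])
    show "smooth_on UNIV k" unfolding k_def using N
      by (intro smooth_on_mult \<xi>(1) smooth_on_divide smooth_on_arctan smooth_on_const smooth_on_id) auto
    show "smooth_on UNIV k'" unfolding k'_def using N
      by (intro smooth_on_add smooth_on_mult \<xi>(1) smooth_on_divide smooth_on_arctan smooth_on_const smooth_on_id
          smooth_on_deriv(2) smooth_on_inverse smooth_on_power nz) auto
    show "(k has_real_derivative k' x) (at x)" for x
    proof -
      have "((\<lambda>x. arctan (N * x) / N) has_real_derivative inverse (1 + (N * x)\<^sup>2) * N / N) (at x)"
        by (auto intro!: derivative_eq_intros)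
      then have "((\<lambda>x. arctan (N * x) / N) has_real_derivative inverse (1 + (N * x)\<^sup>2)) (at x)" using N by simp
      from DERIV_mult[OF smooth_on_deriv(1)[OF \<xi>(1)] this] show ?thesis
        unfolding k_def[abs_def] k'_def by (simp add: mult.commute)
    qed
    show "k x = 0" if "x \<le> - 1 / 2" for x using \<xi>(4)[OF that] by (simp add: k_def)
    show "k 0 = 0" "k' 0 = 1" using \<xi>(5) by (simp_all add: k_def k'_def)
    show "\<delta>' / 2 > 0" using \<delta>' by simp
    fix x b assume b: "\<delta> \<le> 1 + b" "\<bar>b\<bar> \<le> M"
    define y where "y = deriv \<xi> x * (arctan (N * x) / N)"
    define z where "z = \<xi> x * inverse (1 + (N * x)\<^sup>2)"
    have "inverse (1 + (N * x)\<^sup>2) \<le> 1" "0 \<le> inverse (1 + (N * x)\<^sup>2)" by (auto simp: field_simps add_pos_nonneg)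
    then have z: "0 \<le> z" "z \<le> 1" using \<xi>(2,3)[of x] by (auto simp: z_def intro: mult_le_one)
    have "\<bar>arctan (N * x)\<bar> \<le> pi / 2" using arctan_bounded[of "N * x"] by auto
    then have "\<bar>arctan (N * x) / N\<bar> \<le> (pi / 2) / N"
      using N divide_right_mono[of "\<bar>arctan (N * x)\<bar>" "pi / 2" N] by (simp add: abs_divide)
    then have "\<bar>y\<bar> \<le> C * ((pi / 2) / N)"
      unfolding y_def abs_mult using C by (intro mult_mono) auto
    then have "\<bar>y * b\<bar> \<le> C * ((pi / 2) / N) * M"
      unfolding abs_mult using b C N by (intro mult_mono) auto
    also have "\<dots> \<le> \<delta>' / 2"
    proof -
      have "C * pi * M \<le> \<delta>' * N" using \<delta>' by (simp add: N_def field_simps)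
      then show ?thesis using N by (simp add: field_simps)
    qed
    finally have yb: "\<bar>y * b\<bar> \<le> \<delta>' / 2" .
    have "\<delta>' * (1 - z) + \<delta>' * z \<le> 1 * (1 - z) + (1 + b) * z"
      using z \<delta>' b(1) by (intro add_mono mult_right_mono) auto
    then have "\<delta>' \<le> 1 + z * b" by (simp add: algebra_simps)
    with yb have "\<delta>' / 2 \<le> 1 + z * b + y * b" by linarith
    then show "\<delta>' / 2 \<le> 1 + k' x * b" by (simp add: k'_def y_def z_def algebra_simps)
  qed
qed

section \<open>Jacobians and smooth inverses in the plane\<close>

text \<open>In dimension two a linear map multiplies the area form by its determinant, here written
  \<open>omega p (L 1) (L \<i>)\<close>; expanding u and v in the basis 1, \<i> shows it.\<close>

lemma linear_omega:
  assumes "linear L"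
  shows "omega p (L u) (L v) = omega p (L 1) (L \<i>) * omega p u v"
proof -
  have L: "L z = Re z *\<^sub>R L 1 + Im z *\<^sub>R L \<i>" for z
  proof -
    have "z = Re z *\<^sub>R 1 + Im z *\<^sub>R \<i>" by (simp add: complex_eq_iff)
    then have "L z = L (Re z *\<^sub>R 1 + Im z *\<^sub>R \<i>)" by simp
    then show ?thesis by (simp only: linear_add[OF assms] linear_scale[OF assms])
  qed
  show ?thesis unfolding L[of u] L[of v] by (simp add: omega_def algebra_simps)
qed

lemma omega_cis: "omega p (cis s * x) (cis s * y) = omega p x y"
proof -
  have "omega p (cis s * x) (cis s * y) = ((sin s)\<^sup>2 + (cos s)\<^sup>2) * omega p x y"
    by (simp add: omega_def power2_eq_square algebra_simps del: sin_cos_squared_add sin_cos_squared_add2 sin_cos_squared_add3)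
  then show ?thesis by simp
qed

definition jacobian :: "(complex \<Rightarrow> complex) \<Rightarrow> complex \<Rightarrow> real"
  where "jacobian f w = omega w (frechet_derivative f (at w) 1) (frechet_derivative f (at w) \<i>)"

text \<open>The determinant may be read off on any frame. The radial and angular vectors w and \<i>
  * w span area w \<bullet> w and suit maps given in polar coordinates.\<close>

lemma jacobian_eq_polar:
  assumes f: "(f has_derivative D) (at w)" and w: "w \<noteq> 0" and D: "omega w (D w) (D (\<i> * w)) = j * (w \<bullet> w)"
  shows "jacobian f w = j"
proof -
  have "D = frechet_derivative f (at w)" by (rule frechet_derivative_at[OF f])
  then have "jacobian f w * (w \<bullet> w) = j * (w \<bullet> w)"
    using linear_omega[OF has_derivative_linear[OF f], of w w "\<i> * w"] D
    by (simp add: jacobian_def omega_def inner_complex_def)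
  then show ?thesis using w by simp
qed

lemma smooth_bij_inverse:
  assumes f: "smooth_on UNIV f" and bij: "bij f" and J: "\<And>w. jacobian f w \<noteq> 0"
  shows "smooth_on UNIV (inv_into UNIV f)"
proof (rule smooth_on_inverse_function)
  let ?D = "\<lambda>w. frechet_derivative f (at w)"
  show D: "(f has_derivative ?D w) (at w)" for w
    using smooth_on_has_derivative[OF open_UNIV f] by simp
  have sD: "smooth_on UNIV (\<lambda>w. ?D w v)" for v by (rule smooth_on_frechet_derivative[OF open_UNIV f])
  \<comment> \<open>Cramer's rule for the inverse of the derivative; it is smooth in w because the
    Jacobian in the denominator never vanishes.\<close>
  let ?A = "\<lambda>w v. of_real (omega w v (?D w \<i>) / jacobian f w) + of_real (omega w (?D w 1) v / jacobian f w) * \<i> :: complex"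
  show "?D w (?A w v) = v" for w v
  proof -
    have lin: "linear (?D w)" by (rule has_derivative_linear[OF D])
    have "?A w v = (omega w v (?D w \<i>) / jacobian f w) *\<^sub>R 1 + (omega w (?D w 1) v / jacobian f w) *\<^sub>R \<i>"
      by (simp add: scaleR_conv_of_real)
    then have "?D w (?A w v) = (omega w v (?D w \<i>) / jacobian f w) *\<^sub>R ?D w 1 + (omega w (?D w 1) v / jacobian f w) *\<^sub>R ?D w \<i>"
      by (simp only: linear_add[OF lin] linear_scale[OF lin])
    then have "jacobian f w *\<^sub>R ?D w (?A w v) = omega w v (?D w \<i>) *\<^sub>R ?D w 1 + omega w (?D w 1) v *\<^sub>R ?D w \<i>"
      using J[of w] by (simp add: scaleR_add_right)
    also have "\<dots> = jacobian f w *\<^sub>R v" by (simp add: jacobian_def omega_def complex_eq_iff algebra_simps)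
    finally show ?thesis using J[of w] by simp
  qed
  show "smooth_on UNIV (\<lambda>w. ?A w v)" for v
    unfolding jacobian_def omega_def
    by (intro smooth_on_add smooth_on_mult smooth_on_of_real smooth_on_divide smooth_on_diff smooth_on_Re smooth_on_Im
        smooth_on_const sD) (use J in \<open>simp_all add: jacobian_def omega_def\<close>)
  show "bounded_linear (?A w)" for w
    unfolding linear_conv_bounded_linear[symmetric]
    by (rule linearI) (auto simp: omega_def complex_eq_iff algebra_simps add_divide_distrib diff_divide_distrib)
qed (use bij in \<open>simp_all add: bij_is_inj bij_is_surj surj_f_inv_f\<close>)

text \<open>For maps of the whole plane, smoothness up to the boundary is automatic and the
  derivative within the disk is the ordinary one, so preservation of area becomes a condition on the
  Jacobian.\<close>

lemma restrict_symp_diskI: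
  assumes sm: "smooth_on UNIV f" "smooth_on UNIV g" and inv: "\<And>z. f (g z) = z" "\<And>z. g (f z) = z"
    and disk: "\<And>z. f z \<in> disk \<longleftrightarrow> z \<in> disk" and zero: "f 0 = 0" and J: "\<And>z. jacobian f z = 1"
  shows "restrict f disk \<in> carrier symp_disk"
proof -
  have g: "g z \<in> disk" if "z \<in> disk" for z using disk[of "g z"] that by (simp only: inv)
  have "bij_betw f disk disk"
    by (rule bij_betw_byWitness[where f' = g])
      (use inv in \<open>blast+, use disk in blast, use g in blast\<close>)
  then have bij: "bij_betw (restrict f disk) disk disk" by simp
  have "inv_into disk (restrict f disk) z = g z" if z: "z \<in> disk" for z
  proof (rule inv_into_f_eq)
    show "inj_on (restrict f disk) disk" using bij by (simp add: bij_betw_def)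
    show "g z \<in> disk" by (rule g[OF z])
    show "restrict f disk (g z) = z" using g[OF z] by (simp add: inv)
  qed
  with smooth_on_subset[OF sm(2) subset_UNIV]
  have "smooth_on disk (inv_into disk (restrict f disk))"
    by (rule smooth_on_cong[THEN iffD2, rotated])
  moreover have "smooth_on disk (restrict f disk)"
    by (rule smooth_on_cong[THEN iffD2, OF _ smooth_on_subset[OF sm(1) subset_UNIV]]) simp
  ultimately have "restrict f disk \<in> Diff disk" using bij by (simp add: Diff_def Bij_def)
  moreover have "pullback2 (restrict f disk) omega p u v = omega p u v" if p: "p \<in> disk" for p u v
  proof -
    let ?E = "frechet_derivative f (at p)"
    have E: "(f has_derivative ?E) (at p)" using smooth_on_has_derivative[OF open_UNIV sm(1)] by simp
    have "(restrict f disk has_derivative ?E) (at p within disk)"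
      by (rule has_derivative_transform[OF p _ has_derivative_at_withinI[OF E]]) simp
    then have "disk_deriv (restrict f disk) p = ?E" by (rule disk_deriv_eqI[OF p])
    then have "pullback2 (restrict f disk) omega p u v = omega p (?E u) (?E v)"
      by (simp add: pullback2_def omega_def)
    also have "\<dots> = jacobian f p * omega p u v"
      unfolding jacobian_def by (rule linear_omega[OF has_derivative_linear[OF E]])
    finally show ?thesis by (simp add: J)
  qed
  ultimately show ?thesis by (simp add: carrier_symp_disk zero fun_eq_iff)
qed

text \<open>
  In the symplectic coordinates \<open>U = |w|\<^sup>2 - 1\<close> and \<open>\<theta>\<close> (with \<open>2\<omega> = dU \<and> d\<theta>\<close>), the extension is the
  canonical transformation \<open>(u, \<theta>) \<mapsto> (U, \<Theta>)\<close> with mixed generating function \<open>U\<theta> + k(U)(\<phi>(\<theta>) - \<theta>)\<close>: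
  \<open>u = U + k(U)(\<phi>'(\<theta>) - 1)\<close> and \<open>\<Theta> = \<theta> + k'(U)(\<phi>(\<theta>) - \<theta>)\<close>. Below \<open>stretch\<close> is \<open>(U, \<theta>) \<mapsto> (u, \<theta>)\<close>
  and \<open>twist\<close> is \<open>(U, \<theta>) \<mapsto> (U, \<Theta>)\<close>; the two have the same Jacobian determinant \<open>1 + k'(U)(\<phi>'(\<theta>) - 1)\<close>,
  and a lower bound \<open>\<kappa> > 0\<close> for it makes both of them bijective.
\<close>

locale disk_extension =
  fixes \<phi> k k' :: "real \<Rightarrow> real" and \<kappa> :: real
  assumes \<phi>: "\<phi> \<in> carrier diff_circle_cover"
    and k: "smooth_on UNIV k" "smooth_on UNIV k'" "\<And>x. (k has_real_derivative k' x) (at x)"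
    and k_low: "\<And>x. x \<le> - 1 / 2 \<Longrightarrow> k x = 0" and k_zero: "k 0 = 0" and k'_zero: "k' 0 = 1"
    and \<kappa>: "\<kappa> > 0" "\<And>x t. \<kappa> \<le> 1 + k' x * (deriv \<phi> t - 1)"
begin

definition a :: "real \<Rightarrow> real" where "a t = \<phi> t - t"
definition b :: "real \<Rightarrow> real" where "b t = deriv \<phi> t - 1"

lemma a_period: "a (t + 2 * pi) = a t"
  using cover_period[OF \<phi>] by (simp add: a_def)

lemma a_smooth: "smooth_on UNIV a"
  unfolding a_def by (intro smooth_on_diff cover_smooth[OF \<phi>] smooth_on_id)

lemma a_deriv: "(a has_real_derivative b t) (at t)"
  unfolding a_def b_def by (intro DERIV_diff smooth_on_deriv(1) cover_smooth[OF \<phi>] DERIV_ident)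

lemma b_smooth: "smooth_on UNIV b"
  unfolding b_def by (intro smooth_on_diff smooth_on_const smooth_on_deriv(2) cover_smooth[OF \<phi>])

lemma b_period: "b (t + 2 * pi) = b t"
  by (simp add: b_def deriv_cover_period[OF \<phi>])

lemma k'_low: "x < - 1 / 2 \<Longrightarrow> k' x = 0"
proof -
  assume x: "x < - 1 / 2"
  have "(k has_real_derivative 0) (at x)"
    by (rule has_field_derivative_transform_within_open[OF DERIV_const[of 0], of "{..< - 1 / 2}"])
      (use x k_low in auto)
  then show ?thesis using DERIV_unique[OF k(3)] by blast
qed

definition u :: "real \<Rightarrow> real \<Rightarrow> real" where "u t x = x + k x * b t"

lemma u_deriv: "(u t has_real_derivative 1 + k' x * b t) (at x)"
  unfolding u_def by (auto intro!: derivative_eq_intros k(3))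

lemma u_strict_mono: "strict_mono (u t)"
proof (rule strict_monoI)
  have pos: "0 < 1 + k' x * b t" for x using less_le_trans[OF \<kappa>(1) \<kappa>(2)] by (simp add: b_def)
  fix x y :: real assume "x < y"
  then show "u t x < u t y" by (rule DERIV_pos_imp_increasing) (use u_deriv pos in blast)
qed

lemma u_low: "x \<le> - 1 / 2 \<Longrightarrow> u t x = x"
  by (simp add: u_def k_low)

lemma u_zero: "u t 0 = 0"
  by (simp add: u_def k_zero)

text \<open>The level U = -1 is the origin. Since \<open>u t\<close> fixes it and is increasing, the
  radicand in \<open>stretch\<close> is positive everywhere else.\<close>

lemma u_gt: "x > - 1 \<longleftrightarrow> u t x > - 1"
  using strict_mono_less[OF u_strict_mono, of t "- 1" x] u_low[of "- 1" t] by simp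

lemma u_surj: "\<exists>x. u t x = y"
proof (cases "y \<le> - 1 / 2")
  case True
  then show ?thesis using u_low by blast
next
  case False
  have low: "u t (- 1 / 2) \<le> y" using u_low[of "- 1 / 2" t] False by simp
  \<comment> \<open>\<open>u t\<close> vanishes at 0 and has slope at least \<kappa>, so it has
    reached y at |y| / \<kappa>.\<close>
  define L where "L = \<bar>y\<bar> / \<kappa>"
  have L: "0 \<le> L" using \<kappa> by (simp add: L_def)
  have "y \<le> u t L"
  proof (cases "L = 0")
    case True
    then show ?thesis using \<kappa> by (simp add: L_def u_zero)
  next
    case False
    then obtain z where "u t L - u t 0 = (L - 0) * (1 + k' z * b t)"
      using MVT2[of 0 L "u t" "\<lambda>x. 1 + k' x * b t"] u_deriv L by auto
    then have "u t L = L * (1 + k' z * b t)" by (simp add: u_zero)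
    moreover have "L * \<kappa> \<le> L * (1 + k' z * b t)" using L \<kappa>(2) by (intro mult_left_mono) (auto simp: b_def)
    moreover have "L * \<kappa> = \<bar>y\<bar>" using \<kappa> by (simp add: L_def)
    ultimately show ?thesis by linarith
  qed
  moreover have "continuous_on {- 1 / 2..L} (u t)"
    by (auto intro!: continuous_at_imp_continuous_on DERIV_isCont u_deriv)
  ultimately show ?thesis using IVT'[of "u t" "- 1 / 2", OF low] L by fastforce
qed

definition U :: "complex \<Rightarrow> real" where "U w = w \<bullet> w - 1"

text \<open>The factor turns the squared norm 1 + U into 1 + u and leaves the angle alone. At the
  origin the denominator is 0 and the quotient takes the value 0, which still gives the fixed point
  0.\<close>

definition stretch :: "complex \<Rightarrow> complex"
  where "stretch w = sqrt ((1 + u (Arg w) (U w)) / (1 + U w)) *\<^sub>R w"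

definition twist :: "complex \<Rightarrow> complex"
  where "twist w = cis (k' (U w) * a (Arg w)) * w"

lemma U_gt: "w \<noteq> 0 \<Longrightarrow> U w > - 1" by (simp add: U_def)

lemma U_low: "norm w < 1 / 2 \<Longrightarrow> U w < - 1 / 2"
  using power_strict_mono[of "norm w" "1 / 2" 2] by (simp add: U_def dot_square_norm power2_eq_square)

text \<open>k vanishes for U \<le> -1/2, which contains a neighbourhood of the origin. There
  \<open>Arg\<close> is singular, so smoothness at the origin rests on this.\<close>

lemma near_zero: 
  assumes "norm w < 1 / 2"
  shows "stretch w = w" "twist w = w"
  using U_low[OF assms] U_gt[of w] by (cases "w = 0"; simp add: stretch_def twist_def u_low k'_low)+

lemma U_smooth: "smooth_on M U"
  unfolding U_def by (intro smooth_on_diff smooth_on_inner smooth_on_id smooth_on_const)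

lemma comp_smooth: "smooth_on UNIV f \<Longrightarrow> smooth_on M g \<Longrightarrow> smooth_on M (\<lambda>x. f (g x))"
  by (rule smooth_on_compose[of UNIV]) auto

lemma smooth_near_zero:
  fixes f :: "complex \<Rightarrow> complex"
  assumes "smooth_on (- {0}) f" "\<And>w. norm w < 1 / 2 \<Longrightarrow> f w = w"
  shows "smooth_on UNIV f"
proof (rule smooth_on_local)
  fix w :: complex
  show "\<exists>V. open V \<and> w \<in> V \<and> smooth_on (V \<inter> UNIV) f"
  proof (cases "w = 0")
    case True
    have "smooth_on (ball 0 (1 / 2)) f"
      by (rule smooth_on_cong[THEN iffD2, OF _ smooth_on_id]) (use assms(2) in auto)
    then show ?thesis using True by (intro exI[of _ "ball 0 (1 / 2)"]) auto
  next
    case False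
    then show ?thesis using assms(1) by (intro exI[of _ "- {0}"]) (auto simp: open_Compl)
  qed
qed

definition \<rho> :: "complex \<Rightarrow> real" where "\<rho> w = sqrt ((1 + u (Arg w) (U w)) / (1 + U w))"

lemma \<rho>_pos: "w \<noteq> 0 \<Longrightarrow> (1 + u (Arg w) (U w)) / (1 + U w) > 0"
  using U_gt[of w] u_gt[of "U w" "Arg w"] by simp

lemma \<rho>_smooth: "smooth_on (- {0}) \<rho>"
  unfolding \<rho>_def
proof (rule smooth_on_sqrt)
  show "smooth_on (- {0}) (\<lambda>w. (1 + u (Arg w) (U w)) / (1 + U w))"
    unfolding u_def
    by (intro smooth_on_divide smooth_on_add smooth_on_const smooth_on_mult U_smooth
        comp_smooth[OF k(1)] smooth_on_periodic_Arg b_smooth b_period) (use U_gt in fastforce)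
qed (use \<rho>_pos in auto)

lemma stretch_smooth: "smooth_on UNIV stretch"
proof (rule smooth_near_zero)
  show "smooth_on (- {0}) stretch"
    unfolding stretch_def \<rho>_def[symmetric] by (intro smooth_on_scaleR \<rho>_smooth smooth_on_id)
qed (rule near_zero)

lemma twist_smooth: "smooth_on UNIV twist"
proof (rule smooth_near_zero)
  show "smooth_on (- {0}) twist"
    unfolding twist_def
    by (intro smooth_on_mult smooth_on_cis smooth_on_id comp_smooth[OF k(2)] U_smooth
        smooth_on_periodic_Arg a_smooth a_period)
qed (rule near_zero)

definition J :: "complex \<Rightarrow> real" where "J w = 1 + k' (U w) * b (Arg w)"

lemma J_pos: "J w > 0"
  using less_le_trans[OF \<kappa>(1) \<kappa>(2)] by (simp add: J_def b_def)

lemma U_has_derivative: "(U has_derivative (\<lambda>v. 2 * (w \<bullet> v))) (at w)"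
  unfolding U_def by (auto intro!: derivative_eq_intros simp: inner_commute)

lemma k_U_has_derivative:
  assumes "(f has_real_derivative D) (at (U w))"
  shows "((\<lambda>w. f (U w)) has_derivative (\<lambda>v. D * (2 * (w \<bullet> v)))) (at w)"
  by (rule has_derivative_compose[OF U_has_derivative]) (use assms in \<open>simp add: has_field_derivative_def\<close>)

lemma jacobian_near_zero:
  fixes f :: "complex \<Rightarrow> complex"
  assumes "\<And>w. norm w < 1 / 2 \<Longrightarrow> f w = w"
  shows "jacobian f 0 = 1"
proof -
  have "(f has_derivative (\<lambda>v. v)) (at 0)"
    by (rule has_derivative_transform_within_open[OF has_derivative_ident open_ball[of 0 "1 / 2"]])
      (use assms in auto)
  then have "frechet_derivative f (at 0) = (\<lambda>v. v)" by (metis frechet_derivative_at)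
  then show ?thesis by (simp add: jacobian_def omega_def)
qed

lemma J_zero: "J 0 = 1"
  by (simp add: J_def U_def k'_low)

text \<open>For a map \<open>\<rho> w *\<^sub>R w\<close> the Jacobian involves the derivative of
  \<rho> only in the radial direction. To avoid differentiating the square root, the formula
  expressing \<rho>^2 * (w \<bullet> w) through u is differentiated in two ways; on the vector w the
  term with the derivative of b drops out.\<close>

lemma jacobian_stretch: "jacobian stretch w = J w"
proof (cases "w = 0")
  case True
  then show ?thesis using jacobian_near_zero[of stretch] near_zero J_zero by simp
next
  case w: False
  define D where "D = frechet_derivative \<rho> (at w)"
  have D: "(\<rho> has_derivative D) (at w)"
    unfolding D_def by (rule smooth_on_has_derivative[OF _ \<rho>_smooth]) (use w in \<open>auto simp: open_Compl\<close>)
  have "((\<lambda>w. (\<rho> w)\<^sup>2 * (w \<bullet> w)) has_derivative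
      (\<lambda>v. 2 * \<rho> w * D v * (w \<bullet> w) + (\<rho> w)\<^sup>2 * (2 * (w \<bullet> v)))) (at w)"
    by (auto intro!: derivative_eq_intros D simp: inner_commute algebra_simps)
  moreover have "((\<lambda>w. 1 + u (Arg w) (U w)) has_derivative
      (\<lambda>v. 2 * (w \<bullet> v) + (k (U w) * (deriv b (Arg w) * Im (v / w)) + k' (U w) * (2 * (w \<bullet> v)) * b (Arg w)))) (at w)"
    unfolding u_def
    by (rule has_derivative_eq_rhs[OF has_derivative_add[OF has_derivative_const has_derivative_add[OF U_has_derivative
          has_derivative_mult[OF k_U_has_derivative[OF k(3)]
            has_derivative_periodic_Arg[OF smooth_on_deriv(1)[OF b_smooth] b_period w]]]]])
      simp
  then have "((\<lambda>w. (\<rho> w)\<^sup>2 * (w \<bullet> w)) has_derivative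
      (\<lambda>v. 2 * (w \<bullet> v) + (k (U w) * (deriv b (Arg w) * Im (v / w)) + k' (U w) * (2 * (w \<bullet> v)) * b (Arg w)))) (at w)"
  proof (rule has_derivative_transform_within_open[of _ _ _ _ "- {0}"])
    fix z :: complex assume "z \<in> - {0}"
    then have z: "z \<noteq> 0" by simp
    then have "(\<rho> z)\<^sup>2 = (1 + u (Arg z) (U z)) / (1 + U z)" using \<rho>_pos[OF z] by (simp add: \<rho>_def)
    then show "1 + u (Arg z) (U z) = (\<rho> z)\<^sup>2 * (z \<bullet> z)" using U_gt[OF z] by (simp add: U_def)
  qed (use w in \<open>auto simp: open_Compl\<close>)
  ultimately have "(\<lambda>v. 2 * \<rho> w * D v * (w \<bullet> w) + (\<rho> w)\<^sup>2 * (2 * (w \<bullet> v)))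
      = (\<lambda>v. 2 * (w \<bullet> v) + (k (U w) * (deriv b (Arg w) * Im (v / w)) + k' (U w) * (2 * (w \<bullet> v)) * b (Arg w)))"
    by (rule has_derivative_unique)
  from fun_cong[OF this, of w] have "2 * (w \<bullet> w) * (\<rho> w * (D w + \<rho> w)) = 2 * (w \<bullet> w) * J w"
    using w by (simp add: J_def algebra_simps power2_eq_square)
  then have J: "\<rho> w * (D w + \<rho> w) = J w" using w by simp
  have "(stretch has_derivative (\<lambda>v. \<rho> w *\<^sub>R v + D v *\<^sub>R w)) (at w)"
    unfolding stretch_def \<rho>_def[symmetric] by (intro has_derivative_scaleR D has_derivative_ident)
  then show ?thesis
  proof (rule jacobian_eq_polar[OF _ w])
    have "omega w (\<rho> w *\<^sub>R w + D w *\<^sub>R w) (\<rho> w *\<^sub>R (\<i> * w) + D (\<i> * w) *\<^sub>R w) = \<rho> w * (D w + \<rho> w) * (w \<bullet> w)"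
      by (simp add: omega_def inner_complex_def algebra_simps)
    then show "omega w (\<rho> w *\<^sub>R w + D w *\<^sub>R w) (\<rho> w *\<^sub>R (\<i> * w) + D (\<i> * w) *\<^sub>R w) = J w * (w \<bullet> w)"
      by (simp only: J)
  qed
qed

text \<open>The rotation preserves \<open>omega\<close> and can be removed. What remains adds D v
  times the angular vector \<i> * w, so the Jacobian involves only D (\<i> * w); there the
  derivative of k' disappears because \<i> * w is orthogonal to w.\<close>

lemma jacobian_twist: "jacobian twist w = J w"
proof (cases "w = 0")
  case True
  then show ?thesis using jacobian_near_zero[of twist] near_zero J_zero by simp
next
  case w: False
  define \<beta> where "\<beta> w = k' (U w) * a (Arg w)" for w
  define D where "D v = k' (U w) * (b (Arg w) * Im (v / w)) + deriv k' (U w) * (2 * (w \<bullet> v)) * a (Arg w)" for v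
  have D: "(\<beta> has_derivative D) (at w)"
    unfolding \<beta>_def D_def
    by (rule has_derivative_mult[OF k_U_has_derivative[OF smooth_on_deriv(1)[OF k(2)]]
          has_derivative_periodic_Arg[OF a_deriv a_period w]])
  have "((\<lambda>s. cis s) has_derivative (\<lambda>h. h *\<^sub>R (\<i> * cis (\<beta> w)))) (at (\<beta> w))"
    using cis_has_vector_derivative[OF DERIV_ident, of "\<beta> w"] by (simp add: has_vector_derivative_def)
  from has_derivative_compose[OF D this]
  have "((\<lambda>w. cis (\<beta> w)) has_derivative (\<lambda>v. D v *\<^sub>R (\<i> * cis (\<beta> w)))) (at w)" .
  from has_derivative_mult[OF this has_derivative_ident]
  have "(twist has_derivative (\<lambda>v. cis (\<beta> w) * v + D v *\<^sub>R (\<i> * cis (\<beta> w)) * w)) (at w)"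
    unfolding twist_def \<beta>_def .
  then have "(twist has_derivative (\<lambda>v. cis (\<beta> w) * (v + D v *\<^sub>R (\<i> * w)))) (at w)"
    by (rule has_derivative_eq_rhs) (simp add: fun_eq_iff algebra_simps)
  then show ?thesis
  proof (rule jacobian_eq_polar[OF _ w])
    have "w \<bullet> (\<i> * w) = 0" by (simp add: inner_complex_def)
    then have "D (\<i> * w) = k' (U w) * b (Arg w)" using w by (simp add: D_def)
    then show "omega w (cis (\<beta> w) * (w + D w *\<^sub>R (\<i> * w))) (cis (\<beta> w) * (\<i> * w + D (\<i> * w) *\<^sub>R (\<i> * w))) = J w * (w \<bullet> w)"
      unfolding omega_cis by (simp add: J_def omega_def inner_complex_def algebra_simps)
  qed
qed

lemma norm_stretch: "w \<noteq> 0 \<Longrightarrow> U (stretch w) = u (Arg w) (U w)"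
proof -
  assume w: "w \<noteq> 0"
  have "stretch w = \<rho> w *\<^sub>R w" by (simp add: stretch_def \<rho>_def)
  then have "stretch w \<bullet> stretch w = (\<rho> w)\<^sup>2 * (1 + U w)" by (simp add: power2_eq_square U_def)
  also have "(\<rho> w)\<^sup>2 = (1 + u (Arg w) (U w)) / (1 + U w)" using \<rho>_pos[OF w] by (simp add: \<rho>_def)
  finally show ?thesis using U_gt[OF w] by (simp add: U_def)
qed

lemma sgn_stretch: "w \<noteq> 0 \<Longrightarrow> sgn (stretch w) = sgn w"
  using \<rho>_pos[of w] by (simp add: stretch_def sgn_scaleR)

lemma stretch_zero: "stretch 0 = 0"
  by (simp add: stretch_def)

lemma sgn_U_eqI: "sgn w = sgn z \<Longrightarrow> U w = U z \<Longrightarrow> w = z"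
proof -
  assume *: "sgn w = sgn z" "U w = U z"
  then have "norm w = norm z" by (simp add: U_def norm_eq_sqrt_inner)
  then show ?thesis using *(1) by (cases "z = 0") (auto simp: sgn_div_norm)
qed

text \<open>Rays from the origin are preserved, and on the ray of angle t the level U moves by the
  increasing bijection \<open>u t\<close>, which respects the range U > -1.\<close>

lemma bij_stretch: "bij stretch"
proof (rule bijI)
  show "inj stretch"
  proof (rule injI)
    fix w z assume eq: "stretch w = stretch z"
    have nz: "stretch x = 0 \<longleftrightarrow> x = 0" for x
      using sgn_stretch[of x] by (metis sgn_zero_iff stretch_zero)
    show "w = z"
    proof (cases "w = 0")
      case True
      then show ?thesis using eq nz by metis
    next
      case False
      then have z: "z \<noteq> 0" using eq nz by metis
      have s: "sgn w = sgn z" using sgn_stretch[OF False] sgn_stretch[OF z] eq by simp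
      then have "Arg w = Arg z" using Arg_correct[OF False] Arg_correct[OF z] by (metis cis_Arg_unique)
      then have "u (Arg w) (U w) = u (Arg w) (U z)"
        using norm_stretch[OF False] norm_stretch[OF z] eq by simp
      then have "U w = U z" using strict_mono_eq[OF u_strict_mono] by blast
      with s show ?thesis by (rule sgn_U_eqI)
    qed
  qed
  show "surj stretch"
  proof -
    have "\<exists>w. stretch w = z" for z
    proof (cases "z = 0")
      case True
      then show ?thesis using stretch_zero by blast
    next
      case z: False
      obtain x where x: "u (Arg z) x = U z" using u_surj by blast
      have x1: "x > - 1" using u_gt[of x "Arg z"] x U_gt[OF z] by simp
      define w where "w = sqrt (1 + x) *\<^sub>R sgn z"
      have w: "w \<noteq> 0" "sgn w = sgn z" using x1 z by (simp_all add: w_def sgn_scaleR sgn_zero_iff)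
      have "Arg w = Arg z" using w Arg_correct[OF z] by (metis cis_Arg_unique)
      moreover have "U w = x" using x1 z by (simp add: w_def U_def dot_square_norm norm_sgn)
      ultimately have "U (stretch w) = U z" using norm_stretch[OF w(1)] x by simp
      moreover have "sgn (stretch w) = sgn z" using sgn_stretch w by simp
      ultimately show ?thesis using sgn_U_eqI by blast
    qed
    then show ?thesis by (metis surj_def)
  qed
qed

lemma U_twist: "U (twist w) = U w"
  by (simp add: U_def twist_def dot_square_norm norm_mult)

abbreviation angle :: "real \<Rightarrow> real \<Rightarrow> real" where "angle x \<equiv> \<lambda>t. t + k' x * a t"

lemma twist_angle_cover: "angle x \<in> carrier diff_circle_cover"
proof (rule cover_memI)
  show sm: "smooth_on UNIV (angle x)"
    by (intro smooth_on_add smooth_on_id smooth_on_mult smooth_on_const a_smooth)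
  show "deriv (angle x) t > 0" for t
  proof -
    have "((angle x) has_real_derivative 1 + k' x * b t) (at t)"
      by (auto intro!: derivative_eq_intros a_deriv)
    then show ?thesis using less_le_trans[OF \<kappa>(1) \<kappa>(2)] by (simp add: DERIV_imp_deriv b_def)
  qed
qed (simp add: a_period)

text \<open>Every circle about the origin is preserved, with a circle diffeomorphism acting on it.
  Bijectivity of \<open>twist\<close> is thereby reduced to bijectivity of these
  diffeomorphisms.\<close>

lemma twist_polar: "twist w = norm w *\<^sub>R cover_proj (angle (U w)) (sgn w)" if "w \<noteq> 0"
proof -
  have s: "sgn w = cis (Arg w)" using that by (simp add: cis_Arg)
  have "norm w *\<^sub>R sgn w = w" using that by (simp add: sgn_div_norm)
  then show ?thesis
    unfolding twist_def s cover_proj_cis[OF twist_angle_cover] cis_mult[symmetric]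
    by (metis mult.commute mult_scaleR_right s)
qed

lemma bij_twist: "bij twist"
proof (rule bijI)
  show "inj twist"
  proof (rule injI)
    fix w z assume eq: "twist w = twist z"
    have U: "U w = U z" using U_twist eq by metis
    then have n: "norm w = norm z" by (simp add: U_def norm_eq_sqrt_inner)
    show "w = z"
    proof (cases "w = 0")
      case True
      then show ?thesis using n by simp
    next
      case w: False
      then have z: "z \<noteq> 0" using n by auto
      have "norm w *\<^sub>R cover_proj (angle (U w)) (sgn w) = norm w *\<^sub>R cover_proj (angle (U w)) (sgn z)"
        using eq unfolding twist_polar[OF w] twist_polar[OF z] U n .
      then have "cover_proj (angle (U w)) (sgn w) = cover_proj (angle (U w)) (sgn z)"
        using w by simp
      moreover have "inj_on (cover_proj (angle (U w))) circle"
        using diff_circle_Bij[OF cover_proj_diff_circle[OF twist_angle_cover]] by (auto simp: Bij_def bij_betw_def)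
      ultimately have "sgn w = sgn z" using w z by (auto dest!: inj_onD simp: norm_sgn)
      then show ?thesis using U by (rule sgn_U_eqI)
    qed
  qed
  show "surj twist"
  proof -
    have "\<exists>w. twist w = z" for z
    proof (cases "z = 0")
      case True
      then show ?thesis using near_zero(2)[of 0] by auto
    next
      case z: False
      let ?c = "cover_proj (angle (U z))"
      have B: "?c \<in> Bij circle" by (rule diff_circle_Bij[OF cover_proj_diff_circle[OF twist_angle_cover]])
      have "sgn z \<in> circle" using z by (simp add: norm_sgn)
      then obtain s where s: "s \<in> circle" "?c s = sgn z" using Bij_inv_into[OF B] by blast
      define w where "w = norm z *\<^sub>R s"
      have ns: "norm s = 1" using s by simp
      have "norm w = norm z" "sgn w = s" using z ns by (simp_all add: w_def sgn_scaleR sgn_div_norm)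
      moreover from this have "w \<noteq> 0" using z by auto
      moreover have "U w = U z" using \<open>norm w = norm z\<close> by (simp add: U_def dot_square_norm)
      ultimately have "twist w = norm z *\<^sub>R sgn z" using twist_polar[of w] s by simp
      also have "\<dots> = z" using z by (simp add: sgn_div_norm)
      finally show ?thesis by blast
    qed
    then show ?thesis by (metis surj_def)
  qed
qed

definition ext :: "complex \<Rightarrow> complex" where "ext z = twist (inv_into UNIV stretch z)"
definition ext_inv :: "complex \<Rightarrow> complex" where "ext_inv z = stretch (inv_into UNIV twist z)"

lemma inv_stretch: "inv_into UNIV stretch (stretch w) = w" "stretch (inv_into UNIV stretch w) = w"
  using bij_stretch by (simp_all add: bij_is_inj bij_is_surj surj_f_inv_f)

lemma inv_twist: "inv_into UNIV twist (twist w) = w" "twist (inv_into UNIV twist w) = w"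
  using bij_twist by (simp_all add: bij_is_inj bij_is_surj surj_f_inv_f)

lemma ext_ext_inv: "ext (ext_inv z) = z" "ext_inv (ext z) = z"
  by (simp_all add: ext_def ext_inv_def inv_stretch inv_twist)

lemma ext_smooth: "smooth_on UNIV ext" "smooth_on UNIV ext_inv"
proof -
  have J: "J w \<noteq> 0" for w using J_pos[of w] by simp
  show "smooth_on UNIV ext"
    unfolding ext_def
    by (rule comp_smooth[OF twist_smooth smooth_bij_inverse[OF stretch_smooth bij_stretch]])
      (simp add: jacobian_stretch J)
  show "smooth_on UNIV ext_inv"
    unfolding ext_inv_def
    by (rule comp_smooth[OF stretch_smooth smooth_bij_inverse[OF twist_smooth bij_twist]])
      (simp add: jacobian_twist J)
qed

text \<open>Chain rule for \<open>twist\<close> as \<open>ext\<close> after \<open>stretch\<close>: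
  both \<open>twist\<close> and \<open>stretch\<close> have Jacobian J, which is positive and
  cancels.\<close>

lemma jacobian_ext: "jacobian ext z = 1"
proof -
  define w where "w = inv_into UNIV stretch z"
  have z: "z = stretch w" by (simp add: w_def inv_stretch)
  let ?S = "frechet_derivative stretch (at w)" and ?E = "frechet_derivative ext (at z)"
  have S: "(stretch has_derivative ?S) (at w)" and E: "(ext has_derivative ?E) (at (stretch w))"
    using smooth_on_has_derivative[OF open_UNIV] stretch_smooth ext_smooth by (auto simp: z)
  have "((\<lambda>x. ext (stretch x)) has_derivative (\<lambda>v. ?E (?S v))) (at w)"
    by (rule has_derivative_compose[OF S E])
  then have "(twist has_derivative (\<lambda>v. ?E (?S v))) (at w)" by (simp add: ext_def inv_stretch)
  then have T: "frechet_derivative twist (at w) = (\<lambda>v. ?E (?S v))" by (metis frechet_derivative_at)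
  have "J w = omega w (?E (?S 1)) (?E (?S \<i>))"
    unfolding jacobian_twist[symmetric] jacobian_def T ..
  also have "\<dots> = omega w (?E 1) (?E \<i>) * omega w (?S 1) (?S \<i>)"
    by (rule linear_omega[OF has_derivative_linear[OF E]])
  also have "\<dots> = jacobian ext z * J w"
    unfolding jacobian_stretch[symmetric] by (simp add: jacobian_def omega_def)
  finally show ?thesis using J_pos[of w] by simp
qed

lemma stretch_disk: "stretch w \<in> disk \<longleftrightarrow> w \<in> disk"
proof (cases "w = 0")
  case False
  have *: "z \<in> disk \<longleftrightarrow> U z \<le> 0" for z
    by (simp add: U_def dot_square_norm power_le_one_iff)
  show ?thesis
    unfolding * norm_stretch[OF False]
    using strict_mono_less_eq[OF u_strict_mono, of "Arg w" "U w" 0] by (simp add: u_zero)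
qed (simp add: stretch_zero)

lemma twist_disk: "twist w \<in> disk \<longleftrightarrow> w \<in> disk"
  by (simp add: twist_def norm_mult)

lemma ext_disk: "ext z \<in> disk \<longleftrightarrow> z \<in> disk"
  unfolding ext_def twist_disk using stretch_disk[of "inv_into UNIV stretch z"] by (simp only: inv_stretch)

text \<open>The boundary is the level U = 0. There k(0) = 0 lets \<open>stretch\<close> fix the
  circle, and k'(0) = 1 makes \<open>twist\<close> rotate by the full displacement \<phi> t -
  t.\<close>

lemma ext_circle: "ext (cis t) = cis (\<phi> t)"
proof -
  have U: "U (cis t) = 0" by (simp add: U_def dot_square_norm)
  have "stretch (cis t) = cis t" by (simp add: stretch_def U u_zero)
  then have "inv_into UNIV stretch (cis t) = cis t" by (metis inv_stretch(1))
  then have "ext (cis t) = cis (a (Arg (cis t))) * cis t" by (simp add: ext_def twist_def U k'_zero)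
  also have "a (Arg (cis t)) = a t"
    by (rule periodic_cis_cong[of a, OF a_period]) (simp add: circle_cis)
  finally show ?thesis by (simp add: cis_mult a_def)
qed

lemma ext_zero: "ext 0 = 0"
proof -
  have "inv_into UNIV stretch 0 = 0" using inv_stretch(1)[of 0] by (simp add: stretch_zero)
  then show ?thesis by (simp add: ext_def twist_def)
qed

lemma restrict_ext_symp: "restrict ext disk \<in> carrier symp_disk"
  by (rule restrict_symp_diskI[of ext ext_inv])
    (simp_all only: ext_smooth ext_ext_inv ext_disk ext_zero jacobian_ext)

end

text \<open>Periodicity reduces bounds on \<phi>' to a compact interval, where its minimum is
  attained and positive. These bounds are the input for the radial profile, which turns \<phi> into
  an instance of the construction above.\<close>

lemma symp_extension_exists:
  assumes \<phi>: "\<phi> \<in> carrier diff_circle_cover"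
  shows "\<exists>g\<in>carrier symp_disk. \<forall>t. g (cis t) = cis (\<phi> t)"
proof -
  note sm = cover_smooth[OF \<phi>]
  have range: "\<exists>s\<in>{- pi..pi}. deriv \<phi> t = deriv \<phi> s" for t
    using periodic_cis_cong[of "deriv \<phi>" t "Arg (cis t)", OF deriv_cover_period[OF \<phi>]] Arg_bounded[of "cis t"] circle_cis[of "cis t"]
    by (intro bexI[of _ "Arg (cis t)"]) auto
  have cont: "continuous_on {- pi..pi} (deriv \<phi>)"
    by (rule continuous_on_subset[OF smooth_on_continuous[OF smooth_on_deriv(2)[OF sm]] subset_UNIV])
  obtain s where s: "\<forall>t\<in>{- pi..pi}. deriv \<phi> s \<le> deriv \<phi> t"
    using continuous_attains_inf[OF compact_Icc _ cont] by auto
  obtain s' where s': "\<forall>t\<in>{- pi..pi}. deriv \<phi> t \<le> deriv \<phi> s'"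
    using continuous_attains_sup[OF compact_Icc _ cont] by auto
  define \<delta> where "\<delta> = deriv \<phi> s"
  \<comment> \<open>Bounds \<phi>' - 1 from both sides, since \<phi>' > 0.\<close>
  define M where "M = deriv \<phi> s' + 1"
  have pos: "deriv \<phi> t > 0" for t using \<phi> by (simp add: carrier_cover)
  have \<delta>: "\<delta> > 0" using pos by (simp add: \<delta>_def)
  have M: "M \<ge> 0" using pos[of s'] by (simp add: M_def)
  have bd: "\<delta> \<le> deriv \<phi> t" "\<bar>deriv \<phi> t - 1\<bar> \<le> M" for t
    using range[of t] s s' pos[of t] by (auto simp: \<delta>_def M_def abs_le_iff intro: add_increasing2)
  obtain k k' :: "real \<Rightarrow> real" and \<kappa> :: real
    where k: "smooth_on UNIV k" "smooth_on UNIV k'" "\<And>x. (k has_real_derivative k' x) (at x)"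
    "\<And>x. x \<le> - 1 / 2 \<Longrightarrow> k x = 0" "k 0 = 0" "k' 0 = 1" "\<kappa> > 0"
    "\<And>x b. \<delta> \<le> 1 + b \<Longrightarrow> \<bar>b\<bar> \<le> M \<Longrightarrow> \<kappa> \<le> 1 + k' x * b"
    using radial_profile_exists[OF \<delta> M] by blast
  interpret disk_extension \<phi> k k' \<kappa>
    by unfold_locales (use \<phi> k bd in auto)
  show ?thesis
    using restrict_ext_symp ext_circle by (intro bexI[of _ "restrict ext disk"]) auto
qed

section \<open>The flux extension\<close>

definition twist_map :: "real \<Rightarrow> complex \<Rightarrow> complex"
  where "twist_map c z = cis (c * (1 - z \<bullet> z)) * z"

lemma twist_map_has_derivative:
  "(twist_map c has_derivative
    (\<lambda>v. cis (c * (1 - z \<bullet> z)) * (v + (- 2 * c * (z \<bullet> v)) *\<^sub>R (\<i> * z)))) (at z)"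
proof -
  let ?\<beta> = "\<lambda>z::complex. c * (1 - z \<bullet> z)"
  have D: "(?\<beta> has_derivative (\<lambda>v. - 2 * c * (z \<bullet> v))) (at z)"
    by (auto intro!: derivative_eq_intros simp: inner_commute)
  have "((\<lambda>s. cis s) has_derivative (\<lambda>h. h *\<^sub>R (\<i> * cis (?\<beta> z)))) (at (?\<beta> z))"
    using cis_has_vector_derivative[OF DERIV_ident, of "?\<beta> z"] by (simp add: has_vector_derivative_def)
  from has_derivative_mult[OF has_derivative_compose[OF D this] has_derivative_ident]
  show ?thesis
    unfolding twist_map_def by (rule has_derivative_eq_rhs) (simp add: fun_eq_iff algebra_simps)
qed

text \<open>The norm is preserved, so angles add under composition and
  \<open>twist_map (- c)\<close> is the inverse. The rotation angle varies only radially, which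
  leaves area unchanged.\<close>

lemma twist_map_symp: "restrict (twist_map c) disk \<in> carrier symp_disk"
proof (rule restrict_symp_diskI[of _ "twist_map (- c)"])
  have smooth: "smooth_on UNIV (twist_map c)" for c
    unfolding twist_map_def
    by (intro smooth_on_mult smooth_on_cis smooth_on_id smooth_on_const smooth_on_diff smooth_on_inner)
  show "smooth_on UNIV (twist_map c)" "smooth_on UNIV (twist_map (- c))" by (rule smooth)+
  have inner: "twist_map c z \<bullet> twist_map c z = z \<bullet> z" for c z
    by (simp add: twist_map_def dot_square_norm norm_mult)
  have "twist_map c (twist_map d z) = cis (c * (1 - z \<bullet> z)) * twist_map d z" for c d z
    by (subst twist_map_def) (simp add: inner)
  then have comp: "twist_map c (twist_map d z) = cis (c * (1 - z \<bullet> z) + d * (1 - z \<bullet> z)) * z" for c d z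
    by (simp add: twist_map_def flip: cis_mult)
  show "twist_map c (twist_map (- c) z) = z" "twist_map (- c) (twist_map c z) = z" for z
    by (simp_all add: comp)
  show "twist_map c z \<in> disk \<longleftrightarrow> z \<in> disk" for z by (simp add: twist_map_def norm_mult)
  show "twist_map c 0 = 0" by (simp add: twist_map_def)
  show "jacobian (twist_map c) z = 1" for z
    unfolding jacobian_def frechet_derivative_at[OF twist_map_has_derivative, symmetric] omega_cis
    by (simp add: omega_def inner_complex_def algebra_simps)
qed

text \<open>On the segment the image of t has squared norm t^2 and angle c * (1 - t^2), whose
  derivative is -2 * c * t. Half the product is the integrand -c * t^3; \<open>eta\<close> itself
  vanishes along the segment.\<close>

lemma flux_twist_map: "flux (restrict (twist_map c) disk) = - c / 4"
proof -
  have form: "flux_form (restrict (twist_map c) disk) (Complex t 0) 1 = - c * t ^ 3" if t: "t \<in> {0..1}" for t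
  proof -
    let ?p = "Complex t 0" let ?s = "c * (1 - ?p \<bullet> ?p)"
    have p: "?p \<in> disk" using t by (simp add: complex_norm)
    have "disk_deriv (restrict (twist_map c) disk) ?p = (\<lambda>v. cis ?s * (v + (- 2 * c * (?p \<bullet> v)) *\<^sub>R (\<i> * ?p)))"
      by (rule disk_deriv_eqI[OF p has_derivative_transform[OF p _
              has_derivative_at_withinI[OF twist_map_has_derivative]]]) simp
    then have "flux_form (restrict (twist_map c) disk) ?p 1
        = omega ?p (cis ?s * ?p) (cis ?s * (1 + (- 2 * c * (?p \<bullet> 1)) *\<^sub>R (\<i> * ?p))) / 2"
      using p by (simp only: flux_form_eq) (simp add: omega_def twist_map_def)
    then show ?thesis unfolding omega_cis by (simp add: omega_def inner_complex_def power3_eq_cube)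
  qed
  have "((\<lambda>t. - c * t ^ 3) has_integral (- c * 1 ^ 4 / 4) - (- c * 0 ^ 4 / 4)) {0..1}"
  proof (rule fundamental_theorem_of_calculus)
    fix t :: real
    have "((\<lambda>t. - c * t ^ 4 / 4) has_real_derivative - c * t ^ 3) (at t within {0..1})"
      by (auto intro!: derivative_eq_intros)
    then show "((\<lambda>t. - c * t ^ 4 / 4) has_vector_derivative - c * t ^ 3) (at t within {0..1})"
      by (simp add: has_real_derivative_iff_has_vector_derivative)
  qed simp
  then have "((\<lambda>t. - c * t ^ 3) has_integral - c / 4) {0..1}" by simp
  then have "integral {0..1} (\<lambda>t. - c * t ^ 3) = - c / 4" by (rule integral_unique)
  moreover have "flux (restrict (twist_map c) disk) = integral {0..1} (\<lambda>t. - c * t ^ 3)"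
    unfolding flux_eq_integral using form by (rule integral_cong)
  ultimately show ?thesis by simp
qed

abbreviation bd_restrict :: "(complex \<Rightarrow> complex) \<Rightarrow> complex \<Rightarrow> complex"
  where "bd_restrict g \<equiv> restrict g circle"

lemma bd_restrict_hom: "bd_restrict \<in> hom symp_disk diff_circle"
proof (rule homI)
  fix g h assume g: "g \<in> carrier symp_disk" and h: "h \<in> carrier symp_disk"
  show "bd_restrict (g \<otimes>\<^bsub>symp_disk\<^esub> h) = bd_restrict g \<otimes>\<^bsub>diff_circle\<^esub> bd_restrict h"
    unfolding symp_mult[OF g h] diff_circle_mult[OF symp_restrict_circle[OF g] symp_restrict_circle[OF h]]
    by (rule extensionalityI[of _ circle]) (use symp_circle[OF h] in \<open>auto simp: compose_def\<close>)
qed (rule symp_restrict_circle)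

lemma bd_restrict_surj: "bd_restrict ` carrier symp_disk = carrier diff_circle"
proof (intro equalityI subsetI)
  fix \<mu> assume \<mu>: "\<mu> \<in> carrier diff_circle"
  obtain \<phi> where \<phi>: "\<phi> \<in> carrier diff_circle_cover" "\<And>t. \<mu> (cis t) = cis (\<phi> t)"
    using diff_circle_lift[OF \<mu>] by blast
  obtain g where g: "g \<in> carrier symp_disk" "\<And>t. g (cis t) = cis (\<phi> t)"
    using symp_extension_exists[OF \<phi>(1)] by blast
  have "bd_restrict g = cover_proj \<phi>"
    by (rule diff_circle_eqI[OF symp_restrict_circle[OF g(1)]]) (simp add: g(2))
  also have "\<dots> = \<mu>" by (rule diff_circle_eqI[OF \<mu> \<phi>(2), symmetric])
  finally show "\<mu> \<in> bd_restrict ` carrier symp_disk" using g(1) by blast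
qed (auto simp: symp_restrict_circle)

lemma carrier_symp_disk_rel: "carrier symp_disk_rel = kernel symp_disk diff_circle bd_restrict"
proof -
  have "bd_restrict g = (\<lambda>x\<in>circle. x) \<longleftrightarrow> (\<forall>z\<in>circle. g z = z)" for g
    by (auto simp: fun_eq_iff restrict_def)
  then show ?thesis by (simp add: symp_disk_rel_def kernel_def diff_circle_one)
qed

lemma symp_disk_rel_iff:
  "n \<in> carrier symp_disk_rel \<longleftrightarrow> n \<in> carrier symp_disk \<and> (\<forall>z\<in>circle. n z = z)"
  by (simp add: symp_disk_rel_def)

text \<open>A map fixing the boundary lifts to the identity, and then the defect \<phi> (\<psi> 0) -
  \<phi> 0 - \<psi> 0 vanishes whichever factor it is. This gives additivity on both sides.\<close>

interpretation flux: quotient_extension symp_disk diff_circle bd_restrict flux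
  "carrier symp_disk_rel" flux_kernel
proof (intro quotient_extension.intro group_hom.intro group_hom_axioms.intro
    quotient_extension_axioms.intro group_symp_disk group_diff_circle)
  show "bd_restrict \<in> hom symp_disk diff_circle" by (rule bd_restrict_hom)
  show "bd_restrict ` carrier symp_disk = carrier diff_circle" by (rule bd_restrict_surj)
  show "carrier symp_disk_rel = kernel symp_disk diff_circle bd_restrict" by (rule carrier_symp_disk_rel)
  show "flux_kernel = {n \<in> carrier symp_disk_rel. flux n = 0}" by (rule flux_kernel_def)
  fix g n assume g: "g \<in> carrier symp_disk" and n: "n \<in> carrier symp_disk_rel"
  have n': "n \<in> carrier symp_disk" "\<And>t. n (cis t) = cis t" using n by (auto simp: symp_disk_rel_iff)
  obtain \<phi> where \<phi>: "\<phi> \<in> carrier diff_circle_cover" "\<And>t. g (cis t) = cis (\<phi> t)"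
    using symp_lift[OF g] by blast
  show "flux (g \<otimes>\<^bsub>symp_disk\<^esub> n) = flux g + flux n"
    using flux_compose[OF g n'(1) cover_smooth[OF \<phi>(1)] \<phi>(2), of "\<lambda>t. t"] n'(2) symp_mult[OF g n'(1)] by simp
  show "flux (n \<otimes>\<^bsub>symp_disk\<^esub> g) = flux n + flux g"
    using flux_compose[OF n'(1) g smooth_on_id _ \<phi>(2)] n'(2) symp_mult[OF n'(1) g] by simp
next
  show "flux ` carrier symp_disk_rel = UNIV"
  proof (intro equalityI subsetI)
    fix a :: real
    have "restrict (twist_map (- 4 * a)) disk \<in> carrier symp_disk_rel"
      using twist_map_symp by (auto simp: symp_disk_rel_iff twist_map_def dot_square_norm)
    moreover have "flux (restrict (twist_map (- 4 * a)) disk) = a" by (simp add: flux_twist_map)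
    ultimately show "a \<in> flux ` carrier symp_disk_rel" by force
  qed simp
qed

lemma flux_incl_eq: "flux_incl = flux.incl"
  unfolding flux_incl_def using flux.incl_eq_inv_into by (simp add: symp_disk_rel_def)

lemma central_extension_flux: "central_extension flux_extension diff_circle flux_incl flux_proj"
  using flux.central_extension_quotient
  by (simp add: flux_extension_def flux_incl_eq flux_proj_def[abs_def])

section \<open>Comparison of the two Euler classes\<close>

definition lift :: "(complex \<Rightarrow> complex) \<Rightarrow> real \<Rightarrow> real"
  where "lift \<mu> = (SOME \<phi>. \<phi> \<in> carrier diff_circle_cover \<and> cover_proj \<phi> = \<mu>)"

lemma lift:
  assumes "\<mu> \<in> carrier diff_circle"
  shows "lift \<mu> \<in> carrier diff_circle_cover" "cover_proj (lift \<mu>) = \<mu>"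
proof -
  have "\<exists>\<phi>. \<phi> \<in> carrier diff_circle_cover \<and> cover_proj \<phi> = \<mu>"
    using assms by (auto simp: diff_circle_eq_range)
  from someI_ex[OF this] show "lift \<mu> \<in> carrier diff_circle_cover" "cover_proj (lift \<mu>) = \<mu>"
    by (simp_all add: lift_def)
qed

text \<open>2 * pi times the standard cocycle of the real Euler class, computed with the chosen
  lifts.\<close>

definition lift_cocycle :: "(complex \<Rightarrow> complex) \<Rightarrow> (complex \<Rightarrow> complex) \<Rightarrow> real"
  where "lift_cocycle \<mu> \<nu> = lift \<mu> (lift \<nu> 0) - lift \<mu> 0 - lift \<nu> 0"

text \<open>The convention for coboundaries subtracts the value on the product, so the defect of the
  flux enters with a minus sign; the sign in the definition of the Euler class removes it
  again.\<close>

lemma coboundary_flux: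
  assumes X: "X \<in> carrier flux_extension" and Y: "Y \<in> carrier flux_extension"
  shows "coboundary1 flux_extension (\<lambda>X. the_elem (flux ` X)) X Y
    = - (lift_cocycle (flux_proj X) (flux_proj Y) / 2)"
proof -
  obtain g where g: "g \<in> carrier symp_disk" "X = flux_kernel #>\<^bsub>symp_disk\<^esub> g"
    using X by (auto simp: flux_extension_def flux.carrier_quotient)
  obtain h where h: "h \<in> carrier symp_disk" "Y = flux_kernel #>\<^bsub>symp_disk\<^esub> h"
    using Y by (auto simp: flux_extension_def flux.carrier_quotient)
  have proj: "flux_proj X = bd_restrict g" "flux_proj Y = bd_restrict h"
    using flux.coset_values g h by (auto simp: flux_proj_def)
  have lift_cis: "f (cis t) = cis (lift (bd_restrict f) t)" if f: "f \<in> carrier symp_disk" for f t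
    using cover_proj_cis[OF lift(1)[OF symp_restrict_circle[OF f]], of t]
    by (simp add: lift(2)[OF symp_restrict_circle[OF f]])
  have "the_elem (flux ` X) = flux g" "the_elem (flux ` Y) = flux h"
    using flux.coset_values(2) g h by simp_all
  moreover have "the_elem (flux ` (X \<otimes>\<^bsub>flux_extension\<^esub> Y)) = flux (compose disk g h)"
    using flux.mult_quotient[OF g(1) h(1)] flux.coset_values(2)[OF symp_closed[OF g(1) h(1)]]
    by (simp add: flux_extension_def g(2) h(2) symp_mult[OF g(1) h(1)])
  moreover have "flux (compose disk g h) = flux g + flux h
      + lift_cocycle (bd_restrict g) (bd_restrict h) / 2"
    unfolding lift_cocycle_def
    by (rule flux_compose[OF g(1) h(1) cover_smooth[OF lift(1)[OF symp_restrict_circle[OF g(1)]]]])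
      (rule lift_cis g h)+
  ultimately show ?thesis by (simp only: coboundary1_def proj)
qed

lemma euler_class_flux:
  "euler_class flux_extension diff_circle flux_incl flux_proj
    = cohomology_class diff_circle (\<lambda>\<mu> \<nu>. lift_cocycle \<mu> \<nu> / 2)"
  "(\<lambda>\<mu> \<nu>. lift_cocycle \<mu> \<nu> / 2) \<in> cocycles2 diff_circle"
proof -
  have "connection_cochain flux_extension flux_incl (\<lambda>X. the_elem (flux ` X))"
    using flux.connection_cochain_quotient by (simp add: flux_extension_def flux_incl_eq)
  from euler_class_eqI[where \<sigma> = "\<lambda>\<mu> \<nu>. - (lift_cocycle \<mu> \<nu> / 2)", OF central_extension_flux this coboundary_flux]
  show "euler_class flux_extension diff_circle flux_incl flux_proj
    = cohomology_class diff_circle (\<lambda>\<mu> \<nu>. lift_cocycle \<mu> \<nu> / 2)" by simp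
  show "(\<lambda>\<mu> \<nu>. lift_cocycle \<mu> \<nu> / 2) \<in> cocycles2 diff_circle"
    using cocycles2_uminus[OF coboundary_descends_cocycle[where \<sigma> = "\<lambda>\<mu> \<nu>. - (lift_cocycle \<mu> \<nu> / 2)",
          OF central_extension_flux coboundary_flux]] by simp
qed

lemma cover_proj_eq_iff_deck:
  assumes \<phi>: "\<phi> \<in> carrier diff_circle_cover" and \<psi>: "\<psi> \<in> carrier diff_circle_cover"
    and eq: "cover_proj \<phi> = cover_proj \<psi>"
  obtains n where "\<phi> = \<psi> \<otimes>\<^bsub>diff_circle_cover\<^esub> deck_translation n"
proof -
  interpret E: group diff_circle_cover by (rule group_cover)
  interpret \<Gamma>: group diff_circle by (rule group_diff_circle)
  interpret p: group_hom diff_circle_cover diff_circle cover_proj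
    using central_extension_cover by unfold_locales (simp add: central_extension_def)
  have "inv\<^bsub>diff_circle_cover\<^esub> \<psi> \<otimes>\<^bsub>diff_circle_cover\<^esub> \<phi> \<in> kernel diff_circle_cover diff_circle cover_proj"
    using \<phi> \<psi> eq by (simp add: kernel_def)
  then obtain n where n: "inv\<^bsub>diff_circle_cover\<^esub> \<psi> \<otimes>\<^bsub>diff_circle_cover\<^esub> \<phi> = deck_translation n"
    using central_extension_cover by (auto simp: central_extension_def)
  have "\<phi> = \<psi> \<otimes>\<^bsub>diff_circle_cover\<^esub> deck_translation n"
    unfolding n[symmetric] using \<phi> \<psi> by (simp add: E.m_assoc[symmetric])
  then show ?thesis by (rule that)
qed

theorem theoremA:
  shows "euler_class flux_extension diff_circle flux_incl flux_proj
    = H2_scale diff_circle pi real_euler_class"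
proof -
  obtain \<tau> :: "(real \<Rightarrow> real) \<Rightarrow> int" and \<sigma>
    where conn: "connection_cochain diff_circle_cover deck_translation \<tau>"
      and \<sigma>: "\<And>g h. g \<in> carrier diff_circle_cover \<Longrightarrow> h \<in> carrier diff_circle_cover \<Longrightarrow>
        coboundary1 diff_circle_cover \<tau> g h = \<sigma> (cover_proj g) (cover_proj h)"
    using connection_cochain_exists[OF central_extension_cover] by metis
  have \<sigma>_cocycle: "(\<lambda>g h. - \<sigma> g h) \<in> cocycles2 diff_circle"
    by (rule cocycles2_uminus[OF coboundary_descends_cocycle[where \<sigma> = \<sigma>, OF central_extension_cover \<sigma>]])
  have integral: "integral_euler_class = cohomology_class diff_circle (\<lambda>g h. - \<sigma> g h)"
    unfolding integral_euler_class_def by (rule euler_class_eqI[where \<sigma> = \<sigma>, OF central_extension_cover conn \<sigma>])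
  have real: "real_euler_class = cohomology_class diff_circle (\<lambda>g h. of_int (- \<sigma> g h))"
    "(\<lambda>g h. of_int (- \<sigma> g h) :: real) \<in> cocycles2 diff_circle"
    unfolding real_euler_class_def integral
    by (rule H2_map_cohomology_class[OF _ \<sigma>_cocycle]; simp)+
  have scaled: "H2_scale diff_circle pi real_euler_class
      = cohomology_class diff_circle (\<lambda>g h. pi * of_int (- \<sigma> g h))"
    "(\<lambda>g h. pi * of_int (- \<sigma> g h)) \<in> cocycles2 diff_circle"
    unfolding H2_scale_def real(1)
    by (rule H2_map_cohomology_class[OF _ real(2)]; simp add: distrib_left)+
  \<comment> \<open>The cochain that relates the two cocycles. A deck translation by n adds pi * n
    to both terms, so f depends only on the circle diffeomorphism being lifted.\<close>
  define f where "f \<phi> = pi * of_int (\<tau> \<phi>) - \<phi> 0 / 2" for \<phi>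
  have f_cong: "f \<phi> = f \<psi>"
    if \<phi>: "\<phi> \<in> carrier diff_circle_cover" and \<psi>: "\<psi> \<in> carrier diff_circle_cover"
      and eq: "cover_proj \<phi> = cover_proj \<psi>" for \<phi> \<psi>
  proof -
    obtain n where n: "\<phi> = \<psi> \<otimes>\<^bsub>diff_circle_cover\<^esub> deck_translation n"
      using cover_proj_eq_iff_deck[OF \<phi> \<psi> eq] by blast
    then have "\<tau> \<phi> = \<tau> \<psi> + n" using conn \<psi> by (simp add: connection_cochain_def)
    moreover have "\<phi> 0 = \<psi> 0 + 2 * pi * of_int n"
      using cover_period_int[OF \<psi>, of 0 n] cover_mult[OF \<psi> deck_translation_cover, of n]
      by (simp add: n deck_translation_def)
    ultimately show ?thesis by (simp add: f_def field_simps)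
  qed
  show ?thesis unfolding euler_class_flux(1) scaled(1)
  proof (rule cohomology_class_eqI[symmetric, OF scaled(2) euler_class_flux(2)])
    fix \<mu> \<nu> assume \<mu>: "\<mu> \<in> carrier diff_circle" and \<nu>: "\<nu> \<in> carrier diff_circle"
    have \<mu>\<nu>: "\<mu> \<otimes>\<^bsub>diff_circle\<^esub> \<nu> \<in> carrier diff_circle"
      using \<mu> \<nu> group.is_monoid[OF group_diff_circle] by (simp add: monoid.m_closed)
    define \<phi> \<psi> where "\<phi> = lift \<mu>" and "\<psi> = lift \<nu>"
    have c: "\<phi> \<in> carrier diff_circle_cover" "\<psi> \<in> carrier diff_circle_cover"
      and p: "cover_proj \<phi> = \<mu>" "cover_proj \<psi> = \<nu>"
      using lift \<mu> \<nu> by (simp_all add: \<phi>_def \<psi>_def)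
    have "\<mu> \<otimes>\<^bsub>diff_circle\<^esub> \<nu> = cover_proj (\<lambda>x. \<phi> (\<psi> x))"
      using \<mu> \<nu> cover_proj_compose[OF c] by (simp add: diff_circle_mult p)
    \<comment> \<open>The chosen lift of the product and \<phi> composed with \<psi> are two lifts
      of the same map, which f cannot distinguish.\<close>
    then have F: "f (lift (\<mu> \<otimes>\<^bsub>diff_circle\<^esub> \<nu>)) = f (\<lambda>x. \<phi> (\<psi> x))"
      using lift[OF \<mu>\<nu>] cover_comp_closed[OF c] by (intro f_cong) simp_all
    have S: "\<sigma> \<mu> \<nu> = \<tau> \<psi> - \<tau> (\<lambda>x. \<phi> (\<psi> x)) + \<tau> \<phi>"
      using \<sigma>[OF c] by (simp add: coboundary1_def cover_mult[OF c] p)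
    show "lift_cocycle \<mu> \<nu> / 2 - pi * of_int (- \<sigma> \<mu> \<nu>)
        = coboundary1 diff_circle (\<lambda>\<mu>. f (lift \<mu>)) \<mu> \<nu>"
      unfolding coboundary1_def lift_cocycle_def S F \<phi>_def[symmetric] \<psi>_def[symmetric]
      by (simp add: f_def field_simps)
  qed
qed

end
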